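(* Let $S \subset \mathbb{R}^2$ be a compact set such that both $S$ and $S^\mathsf{c}$ satisfy the $r$-rolling condition, and let $\mathcal{X}_n = \{X_1,\ldots,X_n\}$ be an independent sample from the uniform distribution on $S$. Fix $\alpha \in (0,r)$. There is a constant $A>0$ depending only on $(\alpha, r, \operatorname{diam}(S))$ and a constant $t_0>0$ depending only on $(\alpha,r)$ such that, for all $n \ge 1$ and all $0 \le t \le t_0$, \[ \mathbb{P}\left(\left|\frac{\lambda(C_\alpha(\mathcal{X}_n))}{\lambda(\partial S)}-1\right| > t\right) \leq A\, n^2 \exp\left(- n t^{3/2}/A \right). \]
   Context: A set $T\subset\mathbb{R}^2$ satisfies the $r$-rolling condition ($r>0$) if for every $x \in \partial T$ there is an open ball $B$ of radius $r$ with $B \cap T = \emptyset$ and $x \in \partial B$. Here $S^\mathsf{c}=\mathbb{R}^2\setminus S$, $\partial S$ is the topological boundary, and $\operatorname{diam}(S)=\sup\{\|x-y\|: x,y\in S\}$. $\lambda$ denotes the one-dimensional Hausdorff measure on $\mathbb{R}^2$ (normalized so that a segment of length 1 has measure 1). For a finite point set $\mathcal{X}_n$, a pair of distinct points $(X_i,X_j)$ of $\mathcal{X}_n$ forms an $\alpha$-edge if there is an open ball $B$ of radius $\alpha$ with $X_i, X_j \in \partial B$ and $B \cap \mathcal{X}_n = \emptyset$. The $\alpha$-shape $C_\alpha(\mathcal{X}_n)$ is the polygon formed by the union of the line segments $[X_iX_j]$ over all $\alpha$-edges. *)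

theory Defs
  imports "HOL-Analysis.Analysis"
begin

definition rolling :: "real \<Rightarrow> (real^2) set \<Rightarrow> bool" where
  "rolling r T \<longleftrightarrow>
     (\<forall>x\<in>frontier T. \<exists>c. ball c r \<inter> T = {} \<and> x \<in> frontier (ball c r))"

text \<open>One-dimensional Hausdorff measure on the plane (normalized so that a segment of
  length 1 has measure 1): countable delta-covers by bounded sets, weighted by diameter.\<close>
definition hausdorff1_pre :: "real \<Rightarrow> (real^2) set \<Rightarrow> ennreal" where
  "hausdorff1_pre \<delta> A =
     (INF C \<in> {C :: nat \<Rightarrow> (real^2) set. A \<subseteq> (\<Union>i. C i) \<and> (\<forall>i. bounded (C i) \<and> diameter (C i) \<le> \<delta>)}.
        (\<Sum>i. ennreal (diameter (C i))))"

definition hausdorff1 :: "(real^2) set \<Rightarrow> ennreal" where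
  "hausdorff1 A = (SUP \<delta> \<in> {0<..}. hausdorff1_pre \<delta> A)"

definition alpha_edge :: "real \<Rightarrow> (real^2) set \<Rightarrow> real^2 \<Rightarrow> real^2 \<Rightarrow> bool" where
  "alpha_edge \<alpha> X x y \<longleftrightarrow> x \<in> X \<and> y \<in> X \<and> x \<noteq> y \<and>
     (\<exists>c. x \<in> frontier (ball c \<alpha>) \<and> y \<in> frontier (ball c \<alpha>) \<and> ball c \<alpha> \<inter> X = {})"

definition alpha_shape :: "real \<Rightarrow> (real^2) set \<Rightarrow> (real^2) set" where
  "alpha_shape \<alpha> X = \<Union>{closed_segment x y | x y. alpha_edge \<alpha> X x y}"

text \<open>Outer probability (coincides with the probability on measurable events; used so
  that no measurability question can trivialize the bound).\<close>
definition outer_prob :: "'a measure \<Rightarrow> 'a set \<Rightarrow> ennreal" where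
  "outer_prob M A = (INF B \<in> {B \<in> sets M. A \<inter> space M \<subseteq> B}. emeasure M B)"

definition sample_law :: "nat \<Rightarrow> (real^2) set \<Rightarrow> (nat \<Rightarrow> real^2) measure" where
  "sample_law n S = PiM {..<n} (\<lambda>_. uniform_measure lborel S)"

end

theory Submission
  imports Defs "HOL-Probability.Infinite_Product_Measure"
begin

text \<open>
  The two rolling conditions give every boundary point \<open>p\<close> a unit normal \<open>n\<close> with tangent balls of
  radius \<open>r\<close> inside and outside \<open>S\<close>; the normal is then Lipschitz, and the nearest-point projection
  onto the boundary is Lipschitz with constant \<open>1 + O(h)\<close> at distance \<open>O(h)\<close> from it. If the ball of
  an \<open>\<alpha>\<close>-edge reaches to depth \<open>h\<close> into \<open>S\<close>, it covers an area of order \<open>h\<^bsup>3/2\<^esup>\<close> of \<open>S\<close>, so a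
  union bound over the pairs of sample points shows that, outside an event of probability
  \<open>O(n\<^sup>2 exp (- c n h\<^bsup>3/2\<^esup>))\<close>, all these depths are at most \<open>h\<close>. Then the edges have slope
  \<open>O(h\<^bsup>1/2\<^esup>)\<close> against the boundary and join consecutive vertices, so the projection restricted to the
  \<open>\<alpha>\<close>-shape is injective with a local inverse of Lipschitz constant \<open>1 + O(h)\<close>. It is onto up to
  finitely many points because every empty ball pushed in along a normal gets stuck on sample points on
  both sides. Comparing Hausdorff measures in both directions gives the theorem with \<open>h\<close> proportional
  to \<open>t\<close>.
\<close>

section \<open>One-dimensional Hausdorff measure\<close>

text \<open>The boundary is never parametrized, and neither its components nor the finiteness of its
  length are assumed: lengths are compared only through maps that are Lipschitz at small scales,
  which is all that Hausdorff measure sees. A slope of order sqrt h lengthens an edge over its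
  tangential shadow only by a factor 1 + O(h), because slopes enter lengths quadratically. Hence a
  depth of order t is admissible, and the exponent 3/2 is the power of h in the area of a cap.

  The obstacle is surjectivity: shallow edges alone do not exclude a stretch of boundary without any
  edge. The additional input is density of the sample at a scale \<rho> that depends only on
  \<alpha> and r and does not shrink with t. It is tested on finitely many balls, each missed with
  probability exponentially small in n.

  Deep edges are excluded by fixing the two sample points on the circle: the centre is then one of
  two points, and the other n - 2 sample points are independent of it. The constant A sees S only
  through an area bound and a net of a disc of radius diam(S).\<close>

lemma hausdorff1_pre_le:
  assumes "A \<subseteq> (\<Union>i. C i)" "\<And>i. bounded (C i)" "\<And>i. diameter (C i) \<le> \<delta>"
  shows "hausdorff1_pre \<delta> A \<le> (\<Sum>i. ennreal (diameter (C i)))"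
  unfolding hausdorff1_pre_def using assms by (intro INF_lower) auto

lemma hausdorff1_pre_le_hausdorff1: "0 < \<delta> \<Longrightarrow> hausdorff1_pre \<delta> A \<le> hausdorff1 A"
  unfolding hausdorff1_def by (intro SUP_upper) auto

lemma hausdorff1_mono: "A \<subseteq> B \<Longrightarrow> hausdorff1 A \<le> hausdorff1 B"
  unfolding hausdorff1_def hausdorff1_pre_def
  by (intro SUP_mono' INF_superset_mono) auto

text \<open>Stated for a relation so that it serves both the projection and its inverse. Members of
  a cover are replaced by their images; a Lipschitz bound at distances up to \<rho> is enough
  because covers by small sets compute the measure.\<close>

lemma hausdorff1_relation_le:
  fixes R :: "real^2 \<Rightarrow> real^2 \<Rightarrow> bool"
  assumes L: "0 < L" and \<rho>: "0 < \<rho>"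
    and cover: "\<And>y. y \<in> B \<Longrightarrow> \<exists>x\<in>A. R x y"
    and lip: "\<And>x x' y y'. \<lbrakk>x \<in> A; x' \<in> A; y \<in> B; y' \<in> B; R x y; R x' y'; norm (x - x') \<le> \<rho>\<rbrakk>
      \<Longrightarrow> norm (y - y') \<le> L * norm (x - x')"
  shows "hausdorff1 B \<le> ennreal L * hausdorff1 A"
  unfolding hausdorff1_def[of B]
proof (rule SUP_least)
  fix \<delta> :: real assume "\<delta> \<in> {0<..}"
  then have \<delta>: "0 < \<delta>" by simp
  \<comment> \<open>Below \<rho> the Lipschitz bound applies; below \<delta> / L the image sets have
    diameter at most \<delta>.\<close>
  define \<delta>' where "\<delta>' = min \<rho> (\<delta> / L)"
  have \<delta>': "0 < \<delta>'" using \<rho> \<delta> L by (simp add: \<delta>'_def)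
  have *: "hausdorff1_pre \<delta> B \<le> ennreal L * (\<Sum>i. ennreal (diameter (C i)))"
    if C: "A \<subseteq> (\<Union>i. C i)" "\<And>i. bounded (C i)" "\<And>i. diameter (C i) \<le> \<delta>'" for C :: "nat \<Rightarrow> (real^2) set"
  proof -
    define E where "E i = {y\<in>B. \<exists>x\<in>A \<inter> C i. R x y}" for i
    have d: "norm (y - y') \<le> L * diameter (C i)" if "y \<in> E i" "y' \<in> E i" for y y' i
    proof -
      obtain x x' where x: "x \<in> A" "x' \<in> A" "x \<in> C i" "x' \<in> C i" "R x y" "R x' y'" and y: "y \<in> B" "y' \<in> B"
        using \<open>y \<in> E i\<close> \<open>y' \<in> E i\<close> by (auto simp: E_def)
      have xx: "norm (x - x') \<le> diameter (C i)"
        using diameter_bounded_bound[OF C(2) x(3,4)] by (simp add: dist_norm)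
      then have "norm (x - x') \<le> \<rho>" using C(3)[of i] by (simp add: \<delta>'_def)
      then have "norm (y - y') \<le> L * norm (x - x')" using lip x y by blast
      also have "\<dots> \<le> L * diameter (C i)" using xx L by simp
      finally show ?thesis .
    qed
    have bE: "bounded (E i)" for i
      unfolding bounded_two_points dist_norm using d by blast
    have dE: "diameter (E i) \<le> L * diameter (C i)" for i
      using d L diameter_ge_0[OF C(2)[of i]] by (intro diameter_le) auto
    have "hausdorff1_pre \<delta> B \<le> (\<Sum>i. ennreal (diameter (E i)))"
    proof (rule hausdorff1_pre_le)
      show "B \<subseteq> (\<Union>i. E i)"
      proof
        fix y assume y: "y \<in> B"
        then obtain x where "x \<in> A" "R x y" using cover by blast
        moreover from this obtain i where "x \<in> C i" using C(1) by blast
        ultimately have "y \<in> E i" using y by (auto simp: E_def)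
        then show "y \<in> (\<Union>i. E i)" by blast
      qed
      show "diameter (E i) \<le> \<delta>" for i
      proof -
        have "L * diameter (C i) \<le> L * (\<delta> / L)"
          using C(3)[of i] L by (intro mult_left_mono) (auto simp: \<delta>'_def)
        then show ?thesis using dE[of i] L by simp
      qed
    qed (rule bE)
    also have "\<dots> \<le> (\<Sum>i. ennreal L * ennreal (diameter (C i)))"
      using dE L by (intro suminf_le) (auto simp: ennreal_mult'[symmetric] intro!: ennreal_leI)
    also have "\<dots> = ennreal L * (\<Sum>i. ennreal (diameter (C i)))" by simp
    finally show ?thesis .
  qed
  have "ennreal (1 / L) * hausdorff1_pre \<delta> B \<le> hausdorff1_pre \<delta>' A"
    unfolding hausdorff1_pre_def[of \<delta>']
  proof (rule INF_greatest)
    fix C :: "nat \<Rightarrow> (real^2) set"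
    assume "C \<in> {C. A \<subseteq> (\<Union>i. C i) \<and> (\<forall>i. bounded (C i) \<and> diameter (C i) \<le> \<delta>')}"
    then have "ennreal (1 / L) * hausdorff1_pre \<delta> B \<le> ennreal (1 / L) * (ennreal L * (\<Sum>i. ennreal (diameter (C i))))"
      using * by (intro mult_left_mono) auto
    also have "\<dots> = (\<Sum>i. ennreal (diameter (C i)))"
      using L by (simp add: mult.assoc[symmetric] ennreal_mult[symmetric])
    finally show "ennreal (1 / L) * hausdorff1_pre \<delta> B \<le> (\<Sum>i. ennreal (diameter (C i)))" .
  qed
  also have "\<dots> \<le> hausdorff1 A" using \<delta>' by (rule hausdorff1_pre_le_hausdorff1)
  finally have "ennreal L * (ennreal (1 / L) * hausdorff1_pre \<delta> B) \<le> ennreal L * hausdorff1 A"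
    by (intro mult_left_mono) auto
  then show "hausdorff1_pre \<delta> B \<le> ennreal L * hausdorff1 A"
    using L by (simp add: mult.assoc[symmetric] ennreal_mult[symmetric])
qed

text \<open>Any cover can be prefixed by a singleton, which has diameter 0.\<close>

lemma hausdorff1_insert_le: "hausdorff1 (insert a A) \<le> hausdorff1 A"
  unfolding hausdorff1_def[of "insert a A"]
proof (rule SUP_least)
  fix \<delta> :: real assume "\<delta> \<in> {0<..}"
  then have \<delta>: "0 < \<delta>" by simp
  have "hausdorff1_pre \<delta> (insert a A) \<le> hausdorff1_pre \<delta> A"
    unfolding hausdorff1_pre_def[of \<delta> A]
  proof (rule INF_greatest)
    fix C :: "nat \<Rightarrow> (real^2) set"
    assume C: "C \<in> {C. A \<subseteq> (\<Union>i. C i) \<and> (\<forall>i. bounded (C i) \<and> diameter (C i) \<le> \<delta>)}"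
    define E where "E = case_nat {a} C"
    have "(\<Union>i. E i) = insert a (\<Union>i. C i)"
      by (auto simp: E_def split: nat.splits)
    then have "hausdorff1_pre \<delta> (insert a A) \<le> (\<Sum>i. ennreal (diameter (E i)))"
      using C \<delta> by (intro hausdorff1_pre_le) (auto simp: E_def split: nat.splits)
    also have "\<dots> = (\<Sum>i. ennreal (diameter (C i)))"
      using suminf_offset[of "\<lambda>i. ennreal (diameter (E i))" 1] by (simp add: E_def)
    finally show "hausdorff1_pre \<delta> (insert a A) \<le> (\<Sum>i. ennreal (diameter (C i)))" .
  qed
  also have "\<dots> \<le> hausdorff1 A" using \<delta> by (rule hausdorff1_pre_le_hausdorff1)
  finally show "hausdorff1_pre \<delta> (insert a A) \<le> hausdorff1 A" .
qed

text \<open>This disposes of the projections of the sample points, about which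
  \<open>frontier_covered\<close> says nothing.\<close>

lemma hausdorff1_union_finite_le:
  assumes "finite F"
  shows "hausdorff1 (A \<union> F) \<le> hausdorff1 A"
  using assms
proof induction
  case (insert a F)
  have "hausdorff1 (A \<union> insert a F) \<le> hausdorff1 (A \<union> F)"
    using hausdorff1_insert_le[of a "A \<union> F"] by simp
  then show ?case using insert.IH by (rule order_trans)
qed simp

lemma hausdorff1_Un_le: "hausdorff1 (A \<union> B) \<le> hausdorff1 A + hausdorff1 B"
  unfolding hausdorff1_def[of "A \<union> B"]
proof (rule SUP_least)
  fix \<delta> :: real assume "\<delta> \<in> {0<..}"
  then have \<delta>: "0 < \<delta>" by simp
  have *: "hausdorff1_pre \<delta> (A \<union> B) \<le> (\<Sum>i. ennreal (diameter (C i))) + (\<Sum>i. ennreal (diameter (D i)))"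
    if C: "A \<subseteq> (\<Union>i. C i)" "\<And>i. bounded (C i)" "\<And>i. diameter (C i) \<le> \<delta>"
      and D: "B \<subseteq> (\<Union>i. D i)" "\<And>i. bounded (D i)" "\<And>i. diameter (D i) \<le> \<delta>"
    for C D :: "nat \<Rightarrow> (real^2) set"
  proof -
    \<comment> \<open>The two covers are interleaved: C on even and D on odd indices.\<close>
    define E where "E i = (if even i then C (i div 2) else D (i div 2))" for i
    have CD: "E (2 * i) = C i" "E (Suc (2 * i)) = D i" for i by (simp_all add: E_def)
    let ?f = "\<lambda>i. ennreal (diameter (E i))"
    have "hausdorff1_pre \<delta> (A \<union> B) \<le> suminf ?f"
    proof (rule hausdorff1_pre_le)
      show "A \<union> B \<subseteq> (\<Union>i. E i)" 
      proof
        fix z assume "z \<in> A \<union> B"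
        then obtain i where "z \<in> C i \<or> z \<in> D i" using C(1) D(1) by blast
        then have "z \<in> E (2 * i) \<or> z \<in> E (Suc (2 * i))" by (simp only: CD)
        then show "z \<in> (\<Union>i. E i)" by blast
      qed
    qed (simp_all add: E_def C D)
    also have "suminf ?f = (\<Sum>i. sum ?f {i * 2..<i * 2 + 2})"
      by (intro sums_unique sums_group summable_sums) auto
    also have "\<dots> = (\<Sum>i. ennreal (diameter (C i)) + ennreal (diameter (D i)))"
      by (simp add: CD mult.commute[of _ 2] numeral_2_eq_2[symmetric])
    also have "\<dots> = (\<Sum>i. ennreal (diameter (C i))) + (\<Sum>i. ennreal (diameter (D i)))"
      by (intro suminf_add[symmetric]) auto
    finally show ?thesis .
  qed
  let ?P = "hausdorff1_pre \<delta>"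
  have fin: "?P (A \<union> B) \<le> ?P A + ?P B + ennreal e" if e: "0 < e" and f: "?P A + ?P B < top" for e
  proof -
    have "?P A < ?P A + ennreal (e / 2)" "?P B < ?P B + ennreal (e / 2)"
      using e f by (cases "?P A"; cases "?P B"; simp add: ennreal_less_iff flip: ennreal_plus)+
    then obtain C D where C: "A \<subseteq> (\<Union>i. C i)" "\<And>i. bounded (C i)" "\<And>i. diameter (C i) \<le> \<delta>"
        "(\<Sum>i. ennreal (diameter (C i))) < ?P A + ennreal (e / 2)"
      and D: "B \<subseteq> (\<Union>i. D i)" "\<And>i. bounded (D i)" "\<And>i. diameter (D i) \<le> \<delta>"
        "(\<Sum>i. ennreal (diameter (D i))) < ?P B + ennreal (e / 2)"
      unfolding hausdorff1_pre_def INF_less_iff by (metis (mono_tags, lifting) mem_Collect_eq)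
    have "?P (A \<union> B) \<le> (?P A + ennreal (e / 2)) + (?P B + ennreal (e / 2))"
      using *[OF C(1-3) D(1-3)] C(4) D(4) by (meson add_mono less_imp_le order_trans)
    also have "\<dots> = ?P A + ?P B + (ennreal (e / 2) + ennreal (e / 2))" by (simp add: ac_simps)
    also have "ennreal (e / 2) + ennreal (e / 2) = ennreal e" using e by (simp flip: ennreal_plus)
    finally show ?thesis .
  qed
  have "?P (A \<union> B) \<le> ?P A + ?P B"
    by (rule ennreal_le_epsilon) (use fin in auto)
  also have "\<dots> \<le> hausdorff1 A + hausdorff1 B"
    using \<delta> by (intro add_mono hausdorff1_pre_le_hausdorff1)
  finally show "?P (A \<union> B) \<le> hausdorff1 A + hausdorff1 B" .
qed


text \<open>Needed to see that an \<alpha>-shape has finite length. The segment is cut into N equal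
  pieces, none longer than \<delta>.\<close>

lemma hausdorff1_closed_segment: "hausdorff1 (closed_segment x y) \<le> ennreal (dist x y)"
  unfolding hausdorff1_def
proof (rule SUP_least)
  fix \<delta> :: real assume "\<delta> \<in> {0<..}"
  then have \<delta>: "0 < \<delta>" by simp
  obtain N :: nat where N: "dist x y / \<delta> < real N" "0 < N"
    using reals_Archimedean2[of "max 1 (dist x y / \<delta>)"] by (metis max_less_iff_conj of_nat_0_less_iff zero_less_one less_trans)
  define z where "z i = x + (real i / real N) *\<^sub>R (y - x)" for i
  define C where "C i = (if i < N then closed_segment (z i) (z (Suc i)) else {})" for i
  have dz: "dist (z i) (z (Suc i)) = dist x y / N" for i
  proof -
    have "z (Suc i) - z i = (1 / real N) *\<^sub>R (y - x)"
      by (simp add: z_def algebra_simps add_divide_distrib)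
    then show ?thesis by (simp add: dist_norm norm_minus_commute[of _ "z (Suc i)"] norm_minus_commute[of x])
  qed
  have seg: "dist a b \<le> dist x y / N" if "a \<in> C i" "b \<in> C i" for a b i
  proof -
    have "a \<in> closed_segment (z i) (z (Suc i))" "b \<in> closed_segment (z i) (z (Suc i))"
      using that by (auto simp: C_def split: if_splits)
    then obtain l m where l: "0 \<le> l" "l \<le> 1" "a = (1 - l) *\<^sub>R z i + l *\<^sub>R z (Suc i)"
      and m: "0 \<le> m" "m \<le> 1" "b = (1 - m) *\<^sub>R z i + m *\<^sub>R z (Suc i)" by (auto simp: in_segment)
    have "a - b = (m - l) *\<^sub>R (z i - z (Suc i))" by (simp add: l m algebra_simps)
    then have "dist a b = \<bar>m - l\<bar> * dist (z i) (z (Suc i))" by (simp add: dist_norm)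
    also have "\<dots> \<le> 1 * dist (z i) (z (Suc i))" using l m by (intro mult_right_mono) auto
    finally show ?thesis unfolding dz by simp
  qed
  have bC: "bounded (C i)" for i by (simp add: C_def bounded_closed_segment)
  have dC: "diameter (C i) \<le> dist x y / N" for i
    using seg[of _ i] by (intro diameter_le) (auto simp: dist_norm)
  have "hausdorff1_pre \<delta> (closed_segment x y) \<le> (\<Sum>i. ennreal (diameter (C i)))"
  proof (rule hausdorff1_pre_le)
    show "closed_segment x y \<subseteq> (\<Union>i. C i)"
    proof
      fix w assume "w \<in> closed_segment x y"
      then obtain l where l: "0 \<le> l" "l \<le> 1" "w = (1 - l) *\<^sub>R x + l *\<^sub>R y" by (auto simp: in_segment)
      define i where "i = min (nat \<lfloor>l * N\<rfloor>) (N - 1)"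
      have iN: "i < N" using N(2) unfolding i_def by linarith
      have i1: "real i \<le> l * N"
      proof -
        have "0 \<le> l * N" using l by simp
        then have "real (nat \<lfloor>l * N\<rfloor>) \<le> l * N" by (rule of_nat_floor)
        moreover have "real i \<le> real (nat \<lfloor>l * N\<rfloor>)" by (simp add: i_def)
        ultimately show ?thesis by linarith
      qed
      have i2: "l * N \<le> real i + 1"
      proof (cases "nat \<lfloor>l * N\<rfloor> \<le> N - 1")
        case True
        then show ?thesis unfolding i_def by simp linarith
      next
        case False
        then have "real i + 1 = N" using N by (simp add: i_def)
        then show ?thesis using l by (simp add: mult_le_cancel_right1)
      qed
      have "w = (1 - (l * N - i)) *\<^sub>R z i + (l * N - i) *\<^sub>R z (Suc i)"
      proof -
        have "(1 - (l * N - i)) *\<^sub>R z i + (l * N - i) *\<^sub>R z (Suc i) = z i + (l * N - i) *\<^sub>R (z (Suc i) - z i)"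
          by (simp add: algebra_simps)
        also have "z (Suc i) - z i = (1 / real N) *\<^sub>R (y - x)"
          by (simp add: z_def algebra_simps add_divide_distrib)
        also have "z i + (l * N - i) *\<^sub>R ((1 / real N) *\<^sub>R (y - x)) = x + (real i / N + (l * N - i) / N) *\<^sub>R (y - x)"
          by (simp add: z_def scaleR_add_left)
        also have "real i / N + (l * N - i) / N = l" using N by (simp add: field_simps)
        finally have "(1 - (l * N - i)) *\<^sub>R z i + (l * N - i) *\<^sub>R z (Suc i) = x + l *\<^sub>R (y - x)" .
        moreover have "w = x + l *\<^sub>R (y - x)" using l by (simp add: algebra_simps)
        ultimately show ?thesis by (simp only:)
      qed
      then have "w \<in> C i" using i1 i2 iN by (auto simp: C_def in_segment intro!: exI[of _ "l * N - i"])
      then show "w \<in> (\<Union>i. C i)" by blast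
    qed
    show "diameter (C i) \<le> \<delta>" for i
    proof -
      have "dist x y / N \<le> \<delta>" using N \<delta> by (simp add: field_simps)
      then show ?thesis using dC[of i] by linarith
    qed
  qed (rule bC)
  also have "\<dots> = (\<Sum>i<N. ennreal (diameter (C i)))"
    by (intro suminf_finite) (auto simp: C_def)
  also have "\<dots> \<le> (\<Sum>i<N. ennreal (dist x y / N))" using dC by (intro sum_mono ennreal_leI)
  also have "\<dots> = ennreal (dist x y)" using N by (simp add: ennreal_of_nat_eq_real_of_nat ennreal_mult'[symmetric])
  finally show "hausdorff1_pre \<delta> (closed_segment x y) \<le> ennreal (dist x y)" .
qed

lemma hausdorff1_finite_Union_segments:
  assumes "finite F" "\<And>A. A \<in> F \<Longrightarrow> \<exists>x y. A = closed_segment x y"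
  shows "hausdorff1 (\<Union>F) < top"
  using assms
proof induction
  case empty
  have "hausdorff1 {} \<le> hausdorff1 (closed_segment 0 0)" by (rule hausdorff1_mono) simp
  also have "\<dots> < top" using hausdorff1_closed_segment[of 0 0] by (simp add: le_less_trans)
  finally show ?case by simp
next
  case (insert A F)
  then obtain x y where "A = closed_segment x y" by blast
  then have "hausdorff1 A < top"
    using hausdorff1_closed_segment[of x y] by (simp add: le_less_trans[OF _ ennreal_less_top])
  moreover have "hausdorff1 (\<Union>F) < top" using insert by blast
  moreover have "hausdorff1 (\<Union>(insert A F)) \<le> hausdorff1 A + hausdorff1 (\<Union>F)"
    using hausdorff1_Un_le[of A "\<Union>F"] by simp
  ultimately show ?case by (meson ennreal_add_less_top le_less_trans)
qed

text \<open>On the line, a member of a cover is enclosed in an interval whose radius, not length, is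
  its diameter; this loses the factor 2. The loss is harmless, since the bound only serves to show
  that the boundary has positive length.\<close>

lemma hausdorff1_ge_shadow:
  assumes t: "norm t = 1" and sub: "{a..b} \<subseteq> (\<lambda>z. z \<bullet> t) ` A"
  shows "ennreal (b - a) \<le> 2 * hausdorff1 A"
proof (cases "a \<le> b")
  case True
  have "ennreal (1/2) * ennreal (b - a) \<le> hausdorff1_pre 1 A"
    unfolding hausdorff1_pre_def
  proof (rule INF_greatest)
    fix C :: "nat \<Rightarrow> (real^2) set"
    assume "C \<in> {C. A \<subseteq> (\<Union>i. C i) \<and> (\<forall>i. bounded (C i) \<and> diameter (C i) \<le> 1)}"
    then have C: "A \<subseteq> (\<Union>i. C i)" "\<And>i. bounded (C i)" by auto
    \<comment> \<open>For an empty \<open>C i\<close> the value is unspecified, but the interval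
      around it then has length 0.\<close>
    define m where "m i = (SOME z. z \<in> C i) \<bullet> t" for i
    let ?d = "\<lambda>i. diameter (C i)"
    have "{a..b} \<subseteq> (\<Union>i. {m i - ?d i .. m i + ?d i})"
    proof
      fix s assume "s \<in> {a..b}"
      then obtain z where z: "z \<in> A" "s = z \<bullet> t" using sub by auto
      then obtain i where i: "z \<in> C i" using C by auto
      define w where "w = (SOME z. z \<in> C i)"
      have "w \<in> C i" unfolding w_def using i by (rule someI)
      then have "norm (z - w) \<le> ?d i" using diameter_bounded_bound[OF C(2) i] by (simp add: dist_norm)
      moreover have "\<bar>(z - w) \<bullet> t\<bar> \<le> norm (z - w)" using Cauchy_Schwarz_ineq2[of "z - w" t] t by simp
      ultimately have "\<bar>s - m i\<bar> \<le> ?d i" by (simp add: z m_def w_def inner_diff_left)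
      then show "s \<in> (\<Union>i. {m i - ?d i .. m i + ?d i})" by (auto simp: abs_le_iff intro!: exI[of _ i])
    qed
    then have "emeasure lborel {a..b} \<le> emeasure lborel (\<Union>i. {m i - ?d i .. m i + ?d i})"
      by (intro emeasure_mono) auto
    also have "\<dots> \<le> (\<Sum>i. emeasure lborel {m i - ?d i .. m i + ?d i})"
      by (intro emeasure_subadditive_countably) auto
    also have "\<dots> = (\<Sum>i. ennreal 2 * ennreal (?d i))"
      using diameter_ge_0[OF C(2)] by (intro suminf_cong) (simp add: ennreal_mult'[symmetric] del: ennreal_numeral)
    also have "\<dots> = ennreal 2 * (\<Sum>i. ennreal (?d i))" by simp
    finally have "ennreal (b - a) \<le> ennreal 2 * (\<Sum>i. ennreal (?d i))" using True by simp
    then have "ennreal (1/2) * ennreal (b - a) \<le> ennreal (1/2) * (ennreal 2 * (\<Sum>i. ennreal (?d i)))"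
      by (intro mult_left_mono) auto
    also have "\<dots> = (ennreal (1/2) * ennreal 2) * (\<Sum>i. ennreal (?d i))" by (simp only: mult.assoc)
    also have "ennreal (1/2) * ennreal 2 = 1" by (subst ennreal_mult'[symmetric]) auto
    also have "1 * (\<Sum>i. ennreal (?d i)) = (\<Sum>i. ennreal (?d i))" by simp
    finally show "ennreal (1/2) * ennreal (b - a) \<le> (\<Sum>i. ennreal (?d i))" .
  qed
  also have "\<dots> \<le> hausdorff1 A" by (intro hausdorff1_pre_le_hausdorff1) simp
  finally have "ennreal 2 * (ennreal (1/2) * ennreal (b - a)) \<le> ennreal 2 * hausdorff1 A"
    by (intro mult_left_mono) auto
  moreover have "ennreal 2 * (ennreal (1/2) * ennreal (b - a)) = ennreal (b - a)"
    using True by (subst ennreal_mult'[symmetric], simp)+ simp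
  ultimately show ?thesis by (simp only: ennreal_numeral)
qed (simp add: ennreal_neg)

section \<open>Sets with the rolling property\<close>

definition perp :: "real^2 \<Rightarrow> real^2" where
  "perp v = vector [- (v $ 2), v $ 1]"

lemma inner_perp_self [simp]: "perp v \<bullet> v = 0" "v \<bullet> perp v = 0"
  by (simp_all add: perp_def inner_vec_def sum_2)

lemma norm_perp [simp]: "norm (perp v) = norm v"
  by (simp add: perp_def norm_vec_def L2_set_def sum_2 add.commute)

lemma inner_frame:
  fixes n z w :: "real^2"
  assumes "norm n = 1"
  shows "z \<bullet> w = (z \<bullet> n) * (w \<bullet> n) + (z \<bullet> perp n) * (w \<bullet> perp n)"
proof -
  have "n$1 * n$1 + n$2 * n$2 = 1"
    using assms by (simp add: norm_eq_1 inner_vec_def sum_2)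
  then show ?thesis
    unfolding perp_def inner_vec_def sum_2 inner_real_def vector_2 by algebra
qed

lemma norm_frame:
  fixes n z :: "real^2"
  assumes "norm n = 1"
  shows "(norm z)\<^sup>2 = (z \<bullet> n)\<^sup>2 + (z \<bullet> perp n)\<^sup>2"
  using inner_frame[OF assms, of z z] by (simp only: power2_norm_eq_inner power2_eq_square[of "_ \<bullet> _"])

lemma eq_of_frame:
  fixes n z w :: "real^2"
  assumes "norm n = 1" "z \<bullet> n = w \<bullet> n" "z \<bullet> perp n = w \<bullet> perp n"
  shows "z = w"
  using norm_frame[OF assms(1), of "z - w"] assms(2,3) by (simp add: inner_diff_left)

text \<open>The exact factor sqrt (1 + e^2) is bounded by 1 + e^2. The quadratic dependence turns
  slopes of order \<eta> into relative length errors of order \<eta>^2.\<close>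

lemma norm_le_of_tangential:
  fixes n v :: "real^2"
  assumes n: "norm n = 1" and e: "0 \<le> e" "\<bar>v \<bullet> n\<bar> \<le> e * \<bar>v \<bullet> perp n\<bar>"
  shows "norm v \<le> (1 + e\<^sup>2) * \<bar>v \<bullet> perp n\<bar>"
proof -
  have "(v \<bullet> n)\<^sup>2 \<le> (e * \<bar>v \<bullet> perp n\<bar>)\<^sup>2"
    using e by (metis abs_ge_zero power2_abs power_mono)
  then have "(norm v)\<^sup>2 \<le> (1 + e\<^sup>2) * \<bar>v \<bullet> perp n\<bar>\<^sup>2"
    by (simp add: norm_frame[OF n] power_mult_distrib algebra_simps)
  also have "\<dots> \<le> (1 + e\<^sup>2)\<^sup>2 * \<bar>v \<bullet> perp n\<bar>\<^sup>2"
    by (intro mult_right_mono self_le_power) auto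
  finally have "(norm v)\<^sup>2 \<le> ((1 + e\<^sup>2) * \<bar>v \<bullet> perp n\<bar>)\<^sup>2"
    by (simp add: power_mult_distrib)
  then show ?thesis
    by (rule power2_le_imp_le) simp
qed

lemma norm_plus_sq: "(norm (a + b))\<^sup>2 = (norm a)\<^sup>2 + 2 * (a \<bullet> b) + (norm b)\<^sup>2"
  for a b :: "'a::real_inner"
  by (simp add: power2_norm_eq_inner inner_add_left inner_add_right inner_commute)

lemma norm_minus_sq: "(norm (a - b))\<^sup>2 = (norm a)\<^sup>2 - 2 * (a \<bullet> b) + (norm b)\<^sup>2"
  for a b :: "'a::real_inner"
  by (simp add: power2_norm_eq_inner inner_diff_left inner_diff_right inner_commute)

text \<open>Balls tangent at a point have their centres on the common normal.\<close>
lemma tangent_centre: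
  fixes u n :: "'a::real_inner"
  assumes n: "norm n = 1" and r: "0 < r" and u: "d + r \<le> norm (u + r *\<^sub>R n)" "norm u = d"
  shows "u = d *\<^sub>R n"
proof -
  have d: "0 \<le> d" using u(2) by auto
  have "(d + r)\<^sup>2 \<le> (norm (u + r *\<^sub>R n))\<^sup>2"
    using u d r by (intro power_mono) auto
  also have "\<dots> = d\<^sup>2 + 2 * r * (u \<bullet> n) + r\<^sup>2"
    using n u r by (simp add: norm_plus_sq)
  finally have "r * (d - u \<bullet> n) \<le> 0" by (simp add: power2_eq_square algebra_simps)
  then have "d \<le> u \<bullet> n" using r by (simp add: mult_le_0_iff)
  then have "d * d \<le> d * (u \<bullet> n)" using d by (rule mult_left_mono)
  moreover have "(norm (u - d *\<^sub>R n))\<^sup>2 = 2 * (d * d) - 2 * (d * (u \<bullet> n))"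
    using n u by (simp add: norm_minus_sq power2_eq_square[of d])
  ultimately have "(norm (u - d *\<^sub>R n))\<^sup>2 \<le> 0" by simp
  then show ?thesis by simp
qed

lemma disjoint_balls_dist:
  fixes a b :: "'a::real_normed_vector"
  assumes "ball a s \<inter> ball b t = {}" "0 < s" "0 < t"
  shows "s + t \<le> dist a b"
  proof (rule ccontr)
  assume "\<not> s + t \<le> dist a b"
  then have d: "dist a b < s + t" by simp
  \<comment> \<open>z divides the segment from a to b in the ratio s : t, and would lie in both
    balls.\<close>
  define l where "l = s / (s + t)"
  define z where "z = a + l *\<^sub>R (b - a)"
  have l: "0 < l" "l < 1" "1 - l = t / (s + t)" using assms by (auto simp: l_def field_simps)
  have "dist a z = l * dist a b" using l by (simp add: z_def dist_norm norm_minus_commute)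
  also have "\<dots> < l * (s + t)" using d l by simp
  also have "\<dots> = s" using assms by (simp add: l_def)
  finally have 1: "z \<in> ball a s" by simp
  have "z - b = (1 - l) *\<^sub>R (a - b)" by (simp add: z_def algebra_simps)
  then have "dist b z = (1 - l) * dist a b"
    using l(2) by (simp add: dist_norm norm_minus_commute[of b z])
  also have "\<dots> < (1 - l) * (s + t)" using d l(2) by (intro mult_strict_left_mono) auto
  also have "\<dots> = t" using assms by (simp add: l(3))
  finally have "z \<in> ball b t" by simp
  with 1 assms(1) show False by auto
qed

section \<open>Normals of a rolling set\<close>

locale rolling_set =
  fixes S :: "(real^2) set" and r :: real
  assumes compact_S: "compact S" and S_nonempty: "S \<noteq> {}"
    and r_pos: "0 < r" and roll_out: "rolling r S" and roll_in: "rolling r (- S)"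
begin

lemma closed_S: "closed S" using compact_S by (rule compact_imp_closed)

lemma frontier_nonempty: "frontier S \<noteq> {}"
  using S_nonempty compact_S not_compact_UNIV frontier_eq_empty by metis

lemma closed_frontier_S: "closed (frontier S)" by simp

lemma frontier_sub: "p \<in> frontier S \<Longrightarrow> p \<in> S"
  using frontier_subset_closed[OF closed_S] by auto

text \<open>The two rolling conditions supply balls with a priori unrelated centres; this is one
  outward direction that serves both.\<close>

definition nrm :: "real^2 \<Rightarrow> real^2" where
  "nrm p = (SOME n. norm n = 1 \<and> ball (p + r *\<^sub>R n) r \<inter> S = {} \<and> ball (p - r *\<^sub>R n) r \<subseteq> S)"

text \<open>The two rolling balls at p are disjoint, so their centres are at least 2 * r apart,
  while both lie at distance r from p. By \<open>tangent_centre\<close> they are opposite each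
  other.\<close>

lemma nrm:
  assumes p: "p \<in> frontier S"
  shows "norm (nrm p) = 1" "ball (p + r *\<^sub>R nrm p) r \<inter> S = {}" "ball (p - r *\<^sub>R nrm p) r \<subseteq> S"
proof -
  obtain c where c: "ball c r \<inter> S = {}" "dist c p = r"
    using roll_out p r_pos unfolding rolling_def by auto
  obtain c' where c': "ball c' r \<inter> - S = {}" "dist c' p = r"
    using roll_in p r_pos unfolding rolling_def frontier_complement by auto
  define n where "n = (1/r) *\<^sub>R (c - p)"
  have n: "norm n = 1" using c r_pos by (simp add: n_def dist_norm)
  have cn: "c = p + r *\<^sub>R n" using r_pos by (simp add: n_def)
  have "ball c' r \<inter> ball c r = {}" using c c' by auto
  then have "r + r \<le> dist c' c" using disjoint_balls_dist r_pos by blast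
  then have "r + r \<le> norm ((p - c') + r *\<^sub>R n)" by (simp add: cn dist_norm norm_minus_commute algebra_simps)
  then have "p - c' = r *\<^sub>R n"
    using tangent_centre[OF n r_pos, of r "p - c'"] c' by (simp add: dist_norm norm_minus_commute)
  then have "c' = p - r *\<^sub>R n" by (simp add: algebra_simps)
  then have "norm n = 1 \<and> ball (p + r *\<^sub>R n) r \<inter> S = {} \<and> ball (p - r *\<^sub>R n) r \<subseteq> S"
    using n c c' cn by auto
  from someI[of "\<lambda>n. norm n = 1 \<and> ball (p + r *\<^sub>R n) r \<inter> S = {} \<and> ball (p - r *\<^sub>R n) r \<subseteq> S", OF this]
  show "norm (nrm p) = 1" "ball (p + r *\<^sub>R nrm p) r \<inter> S = {}" "ball (p - r *\<^sub>R nrm p) r \<subseteq> S"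
    unfolding nrm_def by auto
qed

text \<open>The second bound is the first one squared: a point of S rises above the tangent line at
  p at most quadratically in its distance from p.\<close>

lemma outer_ball:
  assumes "p \<in> frontier S" "x \<in> S"
  shows "r \<le> norm (x - p - r *\<^sub>R nrm p)" and "2 * r * ((x - p) \<bullet> nrm p) \<le> (norm (x - p))\<^sup>2"
proof -
  show 1: "r \<le> norm (x - p - r *\<^sub>R nrm p)"
    using nrm(2)[OF assms(1)] assms(2)
    by (auto simp: disjoint_iff dist_norm norm_minus_commute algebra_simps not_less)
  have "r\<^sup>2 \<le> (norm (x - p - r *\<^sub>R nrm p))\<^sup>2" using 1 r_pos by (intro power_mono) auto
  then show "2 * r * ((x - p) \<bullet> nrm p) \<le> (norm (x - p))\<^sup>2"
    using nrm(1)[OF assms(1)] by (simp add: norm_minus_sq[of "x - p"])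
qed

text \<open>Mirror image of \<open>outer_ball\<close>. The inner ball is open and so lies in
  \<open>interior S\<close>; hence the bound covers frontier points as well as points outside
  S.\<close>

lemma inner_ball:
  assumes "p \<in> frontier S" "x \<notin> interior S"
  shows "r \<le> norm (x - p + r *\<^sub>R nrm p)" and "- (2 * r * ((x - p) \<bullet> nrm p)) \<le> (norm (x - p))\<^sup>2"
proof -
  have "ball (p - r *\<^sub>R nrm p) r \<subseteq> interior S"
    using nrm(3)[OF assms(1)] by (simp add: interior_maximal)
  then have "x \<notin> ball (p - r *\<^sub>R nrm p) r" using assms by auto
  then show 1: "r \<le> norm (x - p + r *\<^sub>R nrm p)"
    by (auto simp: dist_norm norm_minus_commute algebra_simps not_less)
  have "r\<^sup>2 \<le> (norm (x - p + r *\<^sub>R nrm p))\<^sup>2" using 1 r_pos by (intro power_mono) auto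
  then show "- (2 * r * ((x - p) \<bullet> nrm p)) \<le> (norm (x - p))\<^sup>2"
    using nrm(1)[OF assms(1)] by (simp add: norm_plus_sq[of "x - p"])
qed

lemma frontier_quadratic:
  assumes "p \<in> frontier S" "q \<in> frontier S"
  shows "\<bar>(q - p) \<bullet> nrm p\<bar> \<le> (norm (q - p))\<^sup>2 / (2 * r)"
proof -
  have "q \<notin> interior S" using assms by (simp add: frontier_def)
  then show ?thesis
    using outer_ball(2)[OF assms(1) frontier_sub[OF assms(2)]] inner_ball(2)[OF assms(1), of q] r_pos
    by (simp add: field_simps abs_le_iff)
qed

text \<open>The inner ball at one point is disjoint from the outer ball at the other. Adding the
  squared distance inequalities for both choices cancels the linear terms, and the parallelogram
  identity replaces the sum of the normals by their difference.\<close>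

lemma normal_lipschitz:
  assumes p: "p \<in> frontier S" and q: "q \<in> frontier S"
  shows "norm (nrm p - nrm q) \<le> norm (p - q) / r"
proof -
  let ?m = "nrm p" and ?n = "nrm q"
  have *: "2 * r \<le> norm (a - b - r *\<^sub>R (nrm a + nrm b))"
    if a: "a \<in> frontier S" and b: "b \<in> frontier S" for a b
  proof -
    have "ball (a - r *\<^sub>R nrm a) r \<inter> ball (b + r *\<^sub>R nrm b) r = {}"
      using nrm[OF a] nrm[OF b] by auto
    from disjoint_balls_dist[OF this r_pos r_pos] show ?thesis
      by (simp add: dist_norm algebra_simps)
  qed
  have sq: "4 * r\<^sup>2 \<le> (norm (a - b))\<^sup>2 - 2 * r * ((a - b) \<bullet> (nrm a + nrm b)) + r\<^sup>2 * (norm (nrm a + nrm b))\<^sup>2"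
    if a: "a \<in> frontier S" and b: "b \<in> frontier S" for a b
  proof -
    have "(2 * r)\<^sup>2 \<le> (norm (a - b - r *\<^sub>R (nrm a + nrm b)))\<^sup>2"
      using *[OF a b] r_pos by (intro power_mono) auto
    then show ?thesis using r_pos
      by (simp add: norm_minus_sq[of "a - b"] power_mult_distrib)
  qed
  have par: "(norm (?m - ?n))\<^sup>2 = 4 - (norm (?m + ?n))\<^sup>2"
    using nrm(1)[OF p] nrm(1)[OF q] by (simp add: norm_minus_sq norm_plus_sq)
  have "8 * r\<^sup>2 \<le> 2 * (norm (p - q))\<^sup>2 + 2 * r\<^sup>2 * (norm (?m + ?n))\<^sup>2"
    using sq[OF p q] sq[OF q p]
    by (simp add: norm_minus_commute[of q p] add.commute[of ?n ?m] inner_diff_left algebra_simps)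
  then have "(r * norm (?m - ?n))\<^sup>2 \<le> (norm (p - q))\<^sup>2"
    by (simp add: power_mult_distrib par algebra_simps)
  then have "r * norm (?m - ?n) \<le> norm (p - q)" by (rule power2_le_imp_le) simp
  then show ?thesis using r_pos by (simp add: field_simps)
qed

section \<open>Nearest-point projection onto the boundary\<close>

abbreviation proj :: "real^2 \<Rightarrow> real^2" where
  "proj \<equiv> closest_point (frontier S)"

lemma proj_frontier: "proj u \<in> frontier S"
  using closest_point_exists(1)[OF closed_frontier_S frontier_nonempty] .

lemma proj_le: "p \<in> frontier S \<Longrightarrow> dist u (proj u) \<le> dist u p"
  using closest_point_le[OF closed_frontier_S] .

lemma ball_proj_disjoint: "ball u (dist u (proj u)) \<inter> frontier S = {}"
  using proj_le[of _ u] by force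

text \<open>The open ball about u up to its nearest frontier point is connected and misses the
  frontier, hence misses S. So it is disjoint from the inner ball at \<open>proj u\<close> and
  touches it there. The argument is valid for whichever nearest point \<open>closest_point\<close>
  selects.\<close>

lemma proj_normal_outside:
  assumes u: "u \<notin> S"
  shows "u = proj u + dist u (proj u) *\<^sub>R nrm (proj u)"
proof -
  let ?q = "proj u" and ?d = "dist u (proj u)"
  have q: "?q \<in> frontier S" by (rule proj_frontier)
  have d: "0 < ?d" using frontier_sub[OF q] u by auto
  have "ball u ?d \<inter> S = {}"
    using connected_Int_frontier[of "ball u ?d" S] ball_proj_disjoint[of u] u d
      centre_in_ball[of u ?d] by blast
  then have "ball u ?d \<inter> ball (?q - r *\<^sub>R nrm ?q) r = {}" using nrm(3)[OF q] by auto
  from disjoint_balls_dist[OF this d r_pos]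
  have "u - ?q = ?d *\<^sub>R nrm ?q"
    by (intro tangent_centre[OF nrm(1)[OF q] r_pos]) (auto simp: dist_norm algebra_simps)
  then show ?thesis by (simp add: algebra_simps)
qed

lemma ball_proj_inside:
  assumes u: "u \<in> S"
  shows "ball u (dist u (proj u)) \<subseteq> S"
proof (cases "u = proj u")
  case False
  then show ?thesis
    using connected_Int_frontier[of "ball u (dist u (proj u))" S] ball_proj_disjoint[of u] u
      centre_in_ball[of u "dist u (proj u)"] connected_ball by (metis Diff_eq_empty_iff IntI empty_iff zero_less_dist_iff)
qed (metis ball_empty dist_self empty_subsetI order_refl)

lemma proj_normal_inside:
  assumes u: "u \<in> S"
  shows "u = proj u - dist u (proj u) *\<^sub>R nrm (proj u)"
proof (cases "u = proj u")
  case False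
  let ?q = "proj u" and ?d = "dist u (proj u)"
  have q: "?q \<in> frontier S" by (rule proj_frontier)
  have d: "0 < ?d" using False by simp
  have "ball u ?d \<inter> ball (?q + r *\<^sub>R nrm ?q) r = {}"
    using nrm(2)[OF q] ball_proj_inside[OF u] by auto
  from disjoint_balls_dist[OF this d r_pos]
  have "?q - u = ?d *\<^sub>R nrm ?q"
    by (intro tangent_centre[OF nrm(1)[OF q] r_pos])
      (auto simp: dist_norm norm_minus_commute algebra_simps)
  then show ?thesis by (simp add: algebra_simps)
qed simp

text \<open>A signed distance to the boundary: positive outside S and negative in its interior,
  because \<open>nrm\<close> points outwards.\<close>

definition height :: "real^2 \<Rightarrow> real" where
  "height u = (u - proj u) \<bullet> nrm (proj u)"

lemma proj_height: "u = proj u + height u *\<^sub>R nrm (proj u)"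
proof -
  obtain d where d: "u = proj u + d *\<^sub>R nrm (proj u)"
    using proj_normal_outside[of u] proj_normal_inside[of u]
    by (metis add_uminus_conv_diff scaleR_minus_left)
  have "u - proj u = d *\<^sub>R nrm (proj u)" using d by (metis add_diff_cancel_left')
  then have "height u = d"
    using nrm(1)[OF proj_frontier[of u]] by (simp add: height_def norm_eq_1)
  then show ?thesis using d by simp
qed

text \<open>A frontier point q at least as near as p would satisfy |q - p|^2 <= (|s| / r) * |q -
  p|^2 by \<open>frontier_quadratic\<close>, so normals shorter than r do not meet another nearest
  point.\<close>

lemma proj_unique:
  assumes p: "p \<in> frontier S" and s: "\<bar>s\<bar> < r"
  shows "proj (p + s *\<^sub>R nrm p) = p"
proof (rule ccontr)
  let ?u = "p + s *\<^sub>R nrm p"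
  let ?q = "proj ?u"
  assume ne: "?q \<noteq> p"
  have q: "?q \<in> frontier S" by (rule proj_frontier)
  have "dist ?u ?q \<le> dist ?u p" by (rule proj_le[OF p])
  then have "norm ((?q - p) - s *\<^sub>R nrm p) \<le> \<bar>s\<bar>"
    using nrm(1)[OF p] by (simp add: dist_norm norm_minus_commute algebra_simps)
  then have "(norm ((?q - p) - s *\<^sub>R nrm p))\<^sup>2 \<le> \<bar>s\<bar>\<^sup>2" by (intro power_mono) auto
  then have "(norm (?q - p))\<^sup>2 \<le> 2 * (s * ((?q - p) \<bullet> nrm p))"
    using nrm(1)[OF p] by (simp add: norm_minus_sq[of "?q - p"])
  also have "\<dots> \<le> 2 * (\<bar>s\<bar> * \<bar>(?q - p) \<bullet> nrm p\<bar>)"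
    by (metis abs_ge_self abs_mult mult_left_mono zero_le_numeral)
  also have "\<dots> \<le> 2 * (\<bar>s\<bar> * ((norm (?q - p))\<^sup>2 / (2 * r)))"
    using frontier_quadratic[OF p q] by (intro mult_left_mono) auto
  also have "\<dots> = (\<bar>s\<bar> / r) * (norm (?q - p))\<^sup>2" by simp
  also have "\<dots> < 1 * (norm (?q - p))\<^sup>2"
    using s r_pos ne by (intro mult_strict_right_mono) auto
  finally show False by simp
qed

text \<open>Take the inner product of u - w with the difference of the projections. The heights
  enter only through the components of that difference along the normals, which are quadratically
  small, so the bound holds at all distances.\<close>

lemma proj_lipschitz:
  assumes u: "\<bar>height u\<bar> \<le> \<delta>" and w: "\<bar>height w\<bar> \<le> \<delta>"
  shows "(1 - \<delta> / r) * norm (proj u - proj w) \<le> norm (u - w)"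
proof -
  let ?p = "proj u" and ?q = "proj w"
  let ?N = "norm (?p - ?q)"
  have p: "?p \<in> frontier S" and q: "?q \<in> frontier S" by (rule proj_frontier)+
  have d: "0 \<le> \<delta>" using u by auto
  have "u - w = (?p - ?q) + height u *\<^sub>R nrm ?p - height w *\<^sub>R nrm ?q"
    using proj_height[of u] proj_height[of w] by (simp add: algebra_simps)
  then have "(u - w) \<bullet> (?p - ?q) = ?N\<^sup>2 + height u * ((?p - ?q) \<bullet> nrm ?p) - height w * ((?p - ?q) \<bullet> nrm ?q)"
    by (simp only: inner_add_left inner_diff_left[of "_ + _"] inner_scaleR_left power2_norm_eq_inner)
      (simp only: inner_commute)
  moreover have "\<bar>height u * ((?p - ?q) \<bullet> nrm ?p)\<bar> \<le> \<delta> * (?N\<^sup>2 / (2 * r))"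
    unfolding abs_mult using frontier_quadratic[OF p q] u d
    by (intro mult_mono) (auto simp: norm_minus_commute inner_diff_left abs_minus_commute)
  moreover have "\<bar>height w * ((?p - ?q) \<bullet> nrm ?q)\<bar> \<le> \<delta> * (?N\<^sup>2 / (2 * r))"
    unfolding abs_mult using frontier_quadratic[OF q p] w d by (intro mult_mono) auto
  ultimately have "?N\<^sup>2 - 2 * (\<delta> * (?N\<^sup>2 / (2 * r))) \<le> (u - w) \<bullet> (?p - ?q)" by linarith
  also have "\<dots> \<le> norm (u - w) * ?N" by (rule norm_cauchy_schwarz)
  finally have "(1 - \<delta> / r) * ?N * ?N \<le> norm (u - w) * ?N"
    by (simp add: power2_eq_square algebra_simps)
  then show ?thesis
    by (cases "?N = 0") (auto dest: mult_right_le_imp_le)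
qed

text \<open>Along the tangent at \<open>proj w\<close> the height of w drops out, and that of u
  counts only against the turning of the normal. The slope hypothesis recovers the whole vector from
  its tangential part.\<close>

lemma proj_expanding:
  assumes u: "\<bar>height u\<bar> \<le> \<delta>"
    and e: "0 \<le> e" "\<bar>(u - w) \<bullet> nrm (proj w)\<bar> \<le> e * \<bar>(u - w) \<bullet> perp (nrm (proj w))\<bar>"
  shows "norm (u - w) \<le> (1 + e\<^sup>2) * (1 + \<delta> / r) * norm (proj u - proj w)"
proof -
  let ?p = "proj u" and ?q = "proj w"
  let ?N = "norm (?p - ?q)"
  have p: "?p \<in> frontier S" and q: "?q \<in> frontier S" by (rule proj_frontier)+
  let ?t = "perp (nrm ?q)"
  have t: "norm ?t = 1" using nrm(1)[OF q] by simp
  have "u - w = (?p - ?q) + height u *\<^sub>R (nrm ?p - nrm ?q) + (height u - height w) *\<^sub>R nrm ?q"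
    using proj_height[of u] proj_height[of w] by (simp add: algebra_simps)
  then have "(u - w) \<bullet> ?t = (?p - ?q) \<bullet> ?t + height u * ((nrm ?p - nrm ?q) \<bullet> ?t)"
    by (simp add: inner_add_left)
  moreover have "\<bar>(?p - ?q) \<bullet> ?t\<bar> \<le> ?N" using Cauchy_Schwarz_ineq2[of "?p - ?q" ?t] t by simp
  moreover have "\<bar>height u * ((nrm ?p - nrm ?q) \<bullet> ?t)\<bar> \<le> \<delta> * (?N / r)"
    unfolding abs_mult
  proof (intro mult_mono u)
    show "\<bar>(nrm ?p - nrm ?q) \<bullet> ?t\<bar> \<le> ?N / r"
      using Cauchy_Schwarz_ineq2[of "nrm ?p - nrm ?q" ?t] t normal_lipschitz[OF p q] by simp
  qed (use u in auto)
  ultimately have "\<bar>(u - w) \<bullet> ?t\<bar> \<le> (1 + \<delta> / r) * ?N" by (simp add: algebra_simps)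
  then have "(1 + e\<^sup>2) * \<bar>(u - w) \<bullet> ?t\<bar> \<le> (1 + e\<^sup>2) * ((1 + \<delta> / r) * ?N)"
    by (intro mult_left_mono) auto
  then show ?thesis
    using norm_le_of_tangential[OF nrm(1)[OF q] e] by (simp add: mult.assoc)
qed

end

section \<open>Shallow edges\<close>

text \<open>The deterministic half of the theorem. \<open>\<eta>\<^sup>2\<close> is the admissible
  depth, and K * \<eta> the resulting distance of a contact point from the foot of the centre. The
  lower bounds on K are those met in \<open>touch_bounds\<close>; the 44 keeps \<open>slope\<close>
  at most 1/2. Only empty balls with two sample points on their sphere are required to be
  shallow.\<close>

locale alpha_sample = rolling_set +
  fixes \<alpha> K \<eta> :: real and X :: "(real^2) set"
  assumes \<alpha>: "0 < \<alpha>" "\<alpha> < r"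
    and K: "1 \<le> K" "2 * \<alpha> * r / (r - \<alpha>) \<le> K\<^sup>2" "\<alpha> / (r - \<alpha>) \<le> K"
    and \<eta>: "0 < \<eta>" "\<eta> \<le> 1" "44 * K * \<eta> \<le> \<alpha>"
    and X: "finite X" "X \<subseteq> S"
    and shallow: "\<And>c x y. \<lbrakk>x \<in> X; y \<in> X; x \<noteq> y; dist c x = \<alpha>; dist c y = \<alpha>; ball c \<alpha> \<inter> X = {}\<rbrakk>
      \<Longrightarrow> \<alpha> - \<eta>\<^sup>2 \<le> infdist c S"
    and no_triple: "\<And>c x y z. \<lbrakk>x \<in> X; y \<in> X; x \<noteq> y; dist c x = \<alpha>; dist c y = \<alpha>;
        z \<in> X; dist c z = \<alpha>\<rbrakk> \<Longrightarrow> z = x \<or> z = y"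
begin

lemma \<eta>_sq: "\<eta>\<^sup>2 \<le> \<eta>" "0 < \<eta>\<^sup>2"
  using \<eta> by (auto simp: power2_eq_square mult_left_le)

lemma K_\<eta>: "\<eta> \<le> K * \<eta>" "\<eta>\<^sup>2 \<le> K * \<eta>"
proof -
  have "1 * \<eta> \<le> K * \<eta>" using K(1) \<eta>(1) by (intro mult_right_mono) auto
  then show "\<eta> \<le> K * \<eta>" by simp
  then show "\<eta>\<^sup>2 \<le> K * \<eta>" using \<eta>_sq(1) by linarith
qed

lemma \<eta>_small: "\<eta> \<le> \<alpha> / 44"
  using \<eta>(3) K_\<eta>(1) by linarith

text \<open>p is the foot of the centre on the boundary and s the depth to which the ball dips below
  p. Both c and p are arguments so that the two ends of an edge can share them.\<close>

definition touch :: "real^2 \<Rightarrow> real^2 \<Rightarrow> real^2 \<Rightarrow> bool" where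
  "touch x c p \<longleftrightarrow> x \<in> X \<and> dist c x = \<alpha> \<and> ball c \<alpha> \<inter> X = {} \<and> p \<in> frontier S \<and>
     (\<exists>s. 0 \<le> s \<and> s \<le> \<eta>\<^sup>2 \<and> c = p + (\<alpha> - s) *\<^sub>R nrm p)"

text \<open>\<open>shallow\<close> keeps the centre outside S, hence on the normal at its nearest
  frontier point p. The depth s is nonnegative because x is a point of S on the sphere and no point
  of S is nearer to c than p.\<close>

lemma edge_touch:
  assumes "alpha_edge \<alpha> X x y"
  obtains c p where "touch x c p" "touch y c p" "x \<noteq> y"
proof -
  obtain c where c: "x \<in> X" "y \<in> X" "x \<noteq> y" "dist c x = \<alpha>" "dist c y = \<alpha>" "ball c \<alpha> \<inter> X = {}"
    using assms \<alpha> by (auto simp: alpha_edge_def)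
  have inf: "\<alpha> - \<eta>\<^sup>2 \<le> infdist c S" using shallow c by blast
  have "0 < \<alpha> - \<eta>\<^sup>2" using \<eta>_small \<eta>_sq \<alpha> by linarith
  then have cS: "c \<notin> S" using inf by auto
  define p where "p = proj c"
  have p: "p \<in> frontier S" unfolding p_def by (rule proj_frontier)
  define s where "s = \<alpha> - dist c p"
  have cp: "c = p + (\<alpha> - s) *\<^sub>R nrm p"
    using proj_normal_outside[OF cS] by (simp add: s_def p_def)
  have "infdist c S \<le> dist c p" using frontier_sub[OF p] by (rule infdist_le)
  then have s1: "s \<le> \<eta>\<^sup>2" using inf by (simp add: s_def)
  have "0 < dist c p" using cS frontier_sub[OF p] by auto
  then have "ball c (dist c p) \<inter> S = {}"
    using connected_Int_frontier[of "ball c (dist c p)" S] ball_proj_disjoint[of c] cS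
      centre_in_ball[of c "dist c p"] unfolding p_def by blast
  then have "dist c p \<le> dist c x" using c(1) X by (auto simp: disjoint_iff not_less)
  then have "0 \<le> s" by (simp add: s_def c)
  then show thesis using that[of c p] c cp s1 p by (auto simp: touch_def)
qed

text \<open>x lies on a sphere of radius \<alpha> dipping by s below p and outside the outer ball of
  larger radius r at p. The region between them has height of order s and width of order sqrt s;
  here \<alpha> < r is essential.\<close>

lemma touch_bounds:
  assumes "touch x c p"
  shows "norm (x - p) \<le> K * \<eta>" "- \<eta>\<^sup>2 \<le> (x - p) \<bullet> nrm p" "(x - p) \<bullet> nrm p \<le> K * \<eta>\<^sup>2"
    "norm (x - c + \<alpha> *\<^sub>R nrm p) \<le> 2 * K * \<eta>"
proof -
  obtain s where s: "0 \<le> s" "s \<le> \<eta>\<^sup>2" "c = p + (\<alpha> - s) *\<^sub>R nrm p"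
    and x: "x \<in> X" "dist c x = \<alpha>" and p: "p \<in> frontier S"
    using assms by (auto simp: touch_def)
  note n = nrm(1)[OF p]
  define w where "w = x - p"
  define m where "m = w \<bullet> nrm p"
  have sa: "s < \<alpha>" using s \<eta>_sq \<eta>_small \<alpha> by linarith
  have xc: "x - c = w - (\<alpha> - s) *\<^sub>R nrm p" by (simp add: w_def s)
  have nw: "norm (w - (\<alpha> - s) *\<^sub>R nrm p) = \<alpha>" using x(2) xc by (simp add: dist_norm norm_minus_commute[of c x])
  have "(norm w)\<^sup>2 - 2 * ((\<alpha> - s) * m) + (\<alpha> - s)\<^sup>2 = \<alpha>\<^sup>2"
    using nw n norm_minus_sq[of w "(\<alpha> - s) *\<^sub>R nrm p"] by (simp add: m_def)
  then have wsq: "(norm w)\<^sup>2 = 2 * \<alpha> * s - s\<^sup>2 + 2 * (\<alpha> - s) * m"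
    by (simp add: power2_eq_square algebra_simps)
  \<comment> \<open>Eliminating |w|^2 between the sphere equation and the outer ball leaves an
    inequality for the height m alone.\<close>
  have "2 * r * m \<le> (norm w)\<^sup>2"
    using outer_ball(2)[OF p, of x] x X by (auto simp: w_def m_def)
  then have "2 * (r - \<alpha>) * m + 2 * s * m \<le> 2 * \<alpha> * s - s\<^sup>2"
    unfolding wsq by (simp add: algebra_simps)
  then have m1: "(r - \<alpha>) * m \<le> \<alpha> * s"
  proof (cases "0 \<le> m")
    case True
    then have "0 \<le> s * m" using s by simp
    moreover have "0 \<le> s\<^sup>2" by simp
    ultimately show ?thesis
      using \<open>2 * (r - \<alpha>) * m + 2 * s * m \<le> _\<close> by linarith
  next
    case False
    then have "(r - \<alpha>) * m \<le> 0" using \<alpha> by (intro mult_nonneg_nonpos) auto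
    moreover have "0 \<le> \<alpha> * s" using \<alpha> s by simp
    ultimately show ?thesis by linarith
  qed
  then have m2: "m \<le> \<alpha> / (r - \<alpha>) * s" using \<alpha> by (simp add: field_simps)
  also have "\<dots> \<le> K * \<eta>\<^sup>2" using K s by (intro mult_mono) auto
  finally show "(x - p) \<bullet> nrm p \<le> K * \<eta>\<^sup>2" by (simp add: m_def w_def)
  have "\<bar>(w - (\<alpha> - s) *\<^sub>R nrm p) \<bullet> nrm p\<bar> \<le> \<alpha>"
    using Cauchy_Schwarz_ineq2[of "w - (\<alpha> - s) *\<^sub>R nrm p" "nrm p"] nw n by simp
  moreover have "(w - (\<alpha> - s) *\<^sub>R nrm p) \<bullet> nrm p = m - (\<alpha> - s)"
    using n by (simp add: inner_diff_left m_def norm_eq_1)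
  ultimately have "- s \<le> m" by linarith
  then show "- \<eta>\<^sup>2 \<le> (x - p) \<bullet> nrm p" using s by (simp add: m_def w_def)
  \<comment> \<open>Inserting the height bound into \<open>wsq\<close> gives 2 * \<alpha> * s times
    1 + \<alpha> / (r - \<alpha>), the origin of the constant 2 * \<alpha> * r / (r -
    \<alpha>).\<close>
  have "2 * (\<alpha> - s) * m \<le> 2 * \<alpha> * (\<alpha> / (r - \<alpha>) * s)"
  proof -
    have nn: "0 \<le> \<alpha> / (r - \<alpha>) * s" using \<alpha> s by simp
    have "2 * (\<alpha> - s) * m \<le> 2 * (\<alpha> - s) * (\<alpha> / (r - \<alpha>) * s)"
      using m2 sa by (intro mult_left_mono) auto
    also have "\<dots> \<le> 2 * \<alpha> * (\<alpha> / (r - \<alpha>) * s)"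
      using s by (intro mult_right_mono nn) auto
    finally show ?thesis .
  qed
  then have "(norm w)\<^sup>2 \<le> 2 * \<alpha> * s + 2 * \<alpha> * (\<alpha> / (r - \<alpha>) * s)"
    unfolding wsq using zero_le_power2[of s] by linarith
  also have "\<dots> = 2 * \<alpha> * r / (r - \<alpha>) * s" using \<alpha> by (simp add: field_simps)
  also have "\<dots> \<le> K\<^sup>2 * \<eta>\<^sup>2" using K s by (intro mult_mono) auto
  finally have "(norm w)\<^sup>2 \<le> (K * \<eta>)\<^sup>2" by (simp add: power_mult_distrib)
  then show nwK: "norm (x - p) \<le> K * \<eta>"
    unfolding w_def by (rule power2_le_imp_le) (use K \<eta> in simp)
  have "x - c + \<alpha> *\<^sub>R nrm p = (x - p) + s *\<^sub>R nrm p" by (simp add: s algebra_simps)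
  moreover have "norm ((x - p) + s *\<^sub>R nrm p) \<le> norm (x - p) + s"
    using norm_triangle_ineq[of "x - p" "s *\<^sub>R nrm p"] n s(1) by simp
  ultimately have "norm (x - c + \<alpha> *\<^sub>R nrm p) \<le> norm (x - p) + s" by metis
  then show "norm (x - c + \<alpha> *\<^sub>R nrm p) \<le> 2 * K * \<eta>" using nwK s K_\<eta> by simp
qed

text \<open>7 = 5 + 2: p and q are at most 5 * K * \<eta> apart, the normal turns by at most that
  over r, and \<alpha> < r; the 2 comes from \<open>touch_bounds\<close>.\<close>

lemma touch_normal_near:
  assumes "touch x c p" and q: "q \<in> frontier S" and xq: "norm (x - q) \<le> 4 * K * \<eta>"
  shows "norm (x - c + \<alpha> *\<^sub>R nrm q) \<le> 7 * K * \<eta>"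
proof -
  have p: "p \<in> frontier S" using assms by (simp add: touch_def)
  have "norm (p - q) \<le> norm (x - p) + norm (x - q)"
    using norm_triangle_ineq4[of "x - q" "x - p"] by (simp add: add.commute)
  then have pq: "norm (p - q) \<le> 5 * K * \<eta>" using touch_bounds(1)[OF assms(1)] xq by simp
  have "norm (nrm q - nrm p) \<le> 5 * K * \<eta> / r"
    using normal_lipschitz[OF p q] pq r_pos
    by (metis (no_types, lifting) divide_right_mono less_eq_real_def norm_minus_commute order_trans)
  then have "\<alpha> * norm (nrm q - nrm p) \<le> \<alpha> * (5 * K * \<eta> / r)" using \<alpha> by (intro mult_left_mono) auto
  also have "\<dots> = \<alpha> / r * (5 * K * \<eta>)" by simp
  also have "\<dots> \<le> 1 * (5 * K * \<eta>)" using \<alpha> K \<eta> by (intro mult_right_mono) auto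
  finally have 1: "norm (\<alpha> *\<^sub>R (nrm q - nrm p)) \<le> 5 * K * \<eta>" using \<alpha> by simp
  have "x - c + \<alpha> *\<^sub>R nrm q = (x - c + \<alpha> *\<^sub>R nrm p) + \<alpha> *\<^sub>R (nrm q - nrm p)"
    by (simp add: algebra_simps)
  then have "norm (x - c + \<alpha> *\<^sub>R nrm q) \<le> norm (x - c + \<alpha> *\<^sub>R nrm p) + norm (\<alpha> *\<^sub>R (nrm q - nrm p))"
    using norm_triangle_ineq by metis
  then show ?thesis using 1 touch_bounds(4)[OF assms(1)] by linarith
qed

text \<open>Half of this value bounds the normal component relative to the length in
  \<open>touch_horizontal\<close>; the doubling pays for replacing the length by the tangential
  component.\<close>

definition slope :: real where "slope = 22 * K * \<eta> / \<alpha>"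

lemma slope: "0 \<le> slope" "slope \<le> 1/2"
  using \<alpha> K \<eta> by (auto simp: slope_def field_simps)

text \<open>The empty ball resting on x keeps y from rising much above x, and the ball resting on y
  keeps x from rising much above y.\<close>

lemma touch_horizontal:
  assumes x: "touch x c p" and y: "touch y c' p'" and q: "q \<in> frontier S"
    and xq: "norm (x - q) \<le> 4 * K * \<eta>" and yq: "norm (y - q) \<le> 4 * K * \<eta>"
  shows "\<bar>(y - x) \<bullet> nrm q\<bar> \<le> slope * \<bar>(y - x) \<bullet> perp (nrm q)\<bar>"
proof -
  have one: "(y - x) \<bullet> nrm q \<le> slope / 2 * norm (y - x)"
    if x: "touch x c p" and y: "touch y c' p'" 
      and xq: "norm (x - q) \<le> 4 * K * \<eta>" and yq: "norm (y - q) \<le> 4 * K * \<eta>" for x y c c' p p'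
  proof -
    let ?v = "y - x"
    have "norm ?v \<le> norm (y - q) + norm (x - q)"
      using norm_triangle_ineq4[of "y - q" "x - q"] by simp
    then have v8: "norm ?v \<le> 8 * K * \<eta>" using xq yq by simp
    have "\<alpha> \<le> dist c y" "dist c x = \<alpha>"
      using x y by (auto simp: touch_def disjoint_iff not_less)
    then have "(norm (x - c))\<^sup>2 \<le> (norm (?v + (x - c)))\<^sup>2"
      by (intro power_mono) (auto simp: dist_norm norm_minus_commute)
    then have "0 \<le> (norm ?v)\<^sup>2 + 2 * (?v \<bullet> (x - c))"
      unfolding norm_plus_sq[of ?v] by simp
    moreover have "?v \<bullet> (x - c) = ?v \<bullet> (x - c + \<alpha> *\<^sub>R nrm q) - \<alpha> * (?v \<bullet> nrm q)"
      by (simp add: inner_add_right)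
    moreover have "?v \<bullet> (x - c + \<alpha> *\<^sub>R nrm q) \<le> norm ?v * (7 * K * \<eta>)"
      using norm_cauchy_schwarz[of ?v "x - c + \<alpha> *\<^sub>R nrm q"] touch_normal_near[OF x q xq]
        mult_left_mono[OF _ norm_ge_zero[of ?v]] by (meson order_trans)
    moreover have "(norm ?v)\<^sup>2 \<le> norm ?v * (8 * K * \<eta>)"
      using v8 by (simp add: power2_eq_square mult_left_mono)
    \<comment> \<open>11 = 7 + 8 / 2, where 8 * K * \<eta> bounds the distance of the two
      points.\<close>
    ultimately have "\<alpha> * (?v \<bullet> nrm q) \<le> norm ?v * (11 * K * \<eta>)" by linarith
    then show ?thesis using \<alpha> by (simp add: slope_def field_simps)
  qed
  let ?v = "y - x" and ?n = "nrm q"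
  have ab: "\<bar>?v \<bullet> ?n\<bar> \<le> slope / 2 * norm ?v"
    using one[OF x y xq yq] one[OF y x yq xq]
    unfolding norm_minus_commute[of x y] inner_diff_left by linarith
  have "(norm ?v)\<^sup>2 \<le> (\<bar>?v \<bullet> ?n\<bar> + \<bar>?v \<bullet> perp ?n\<bar>)\<^sup>2"
    unfolding norm_frame[OF nrm(1)[OF q], of ?v] by (simp add: power2_sum)
  then have "norm ?v \<le> \<bar>?v \<bullet> ?n\<bar> + \<bar>?v \<bullet> perp ?n\<bar>" by (rule power2_le_imp_le) simp
  moreover have "slope / 2 * norm ?v \<le> 1/2 * norm ?v" using slope by (intro mult_right_mono) auto
  ultimately have "norm ?v \<le> 2 * \<bar>?v \<bullet> perp ?n\<bar>" using ab by linarith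
  then have "slope / 2 * norm ?v \<le> slope / 2 * (2 * \<bar>?v \<bullet> perp ?n\<bar>)"
    using slope by (intro mult_left_mono) auto
  then show ?thesis using ab by simp
qed

text \<open>Near q the tangential coordinate separates contact points, so it can be used to order
  them.\<close>

lemma touch_eq:
  assumes "touch x c p" "touch y c' p'" "q \<in> frontier S"
    and "norm (x - q) \<le> 4 * K * \<eta>" "norm (y - q) \<le> 4 * K * \<eta>"
    and "x \<bullet> perp (nrm q) = y \<bullet> perp (nrm q)"
  shows "x = y"
proof -
  have "(y - x) \<bullet> perp (nrm q) = 0" using assms(6) by (simp add: inner_diff_left)
  moreover from this have "(y - x) \<bullet> nrm q = 0"
    using touch_horizontal[OF assms(1-5)] by simp
  ultimately show ?thesis
    using eq_of_frame[OF nrm(1)[OF assms(3)], of "y - x" 0] by simp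
qed

text \<open>The difference of the squared distances to the two centres is affine and takes both signs
  on either side of \<open>z\<close>, so the centres would have to be displaced vertically, and then one ball
  would contain a sample point.\<close>
lemma no_touch_between:
  assumes x: "touch x c p" and y: "touch y c p" and z: "touch z c' p'" and q: "q \<in> frontier S"
    and xq: "norm (x - q) \<le> 4 * K * \<eta>" and yq: "norm (y - q) \<le> 4 * K * \<eta>"
    and zq: "norm (z - q) \<le> 4 * K * \<eta>"
    and xz: "x \<bullet> perp (nrm q) < z \<bullet> perp (nrm q)" and zy: "z \<bullet> perp (nrm q) < y \<bullet> perp (nrm q)"
  shows False
proof -
  let ?n = "nrm q" and ?t = "perp (nrm q)"
  note n = nrm(1)[OF q]
  define D where "D = c' - c"
  define a where "a = D \<bullet> ?t"
  define b where "b = D \<bullet> ?n"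
  have sph: "dist c x = \<alpha>" "dist c y = \<alpha>" "dist c' z = \<alpha>" "\<alpha> \<le> dist c' x" "\<alpha> \<le> dist c' y" "\<alpha> \<le> dist c z"
    and mem: "x \<in> X" "y \<in> X" "z \<in> X"
    using x y z by (auto simp: touch_def disjoint_iff not_less)
  have "z \<noteq> x" "z \<noteq> y" "x \<noteq> y" using xz zy by auto
  then have "c' \<noteq> c" using no_triple[OF mem(1,2) _ sph(1,2) mem(3)] sph by auto
  then have D0: "D \<noteq> 0" by (simp add: D_def)
  have le: "2 * ((u - c) \<bullet> D) \<le> (norm D)\<^sup>2" if "dist c u = \<alpha>" "\<alpha> \<le> dist c' u" for u
  proof -
    have "(norm (u - c))\<^sup>2 \<le> (norm ((u - c) - D))\<^sup>2"
      using that \<alpha> by (intro power_mono) (auto simp: D_def dist_norm norm_minus_commute)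
    then show ?thesis unfolding norm_minus_sq[of "u - c" D] by simp
  qed
  have ge: "- (norm D)\<^sup>2 \<le> 2 * ((z - c') \<bullet> D)"
  proof -
    have "(norm (z - c'))\<^sup>2 \<le> (norm ((z - c') + D))\<^sup>2"
      using sph \<alpha> by (intro power_mono) (auto simp: D_def dist_norm norm_minus_commute)
    then show ?thesis unfolding norm_plus_sq[of "z - c'" D] by simp
  qed
  have zc: "(z - c) \<bullet> D = (z - c') \<bullet> D + (norm D)\<^sup>2"
    by (simp add: D_def power2_norm_eq_inner flip: inner_add_left)
  have fr: "v \<bullet> D = (v \<bullet> ?n) * b + (v \<bullet> ?t) * a" for v
    using inner_frame[OF n, of v D] by (simp add: a_def b_def)
  have hor: "0 \<le> \<bar>v \<bullet> ?t\<bar> * (slope * \<bar>b\<bar>) + (v \<bullet> ?t) * a"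
    if "\<bar>v \<bullet> ?n\<bar> \<le> slope * \<bar>v \<bullet> ?t\<bar>" "0 \<le> v \<bullet> D" for v
  proof -
    have "(v \<bullet> ?n) * b \<le> \<bar>v \<bullet> ?n\<bar> * \<bar>b\<bar>" by (metis abs_ge_self abs_mult)
    also have "\<dots> \<le> slope * \<bar>v \<bullet> ?t\<bar> * \<bar>b\<bar>" using that by (intro mult_right_mono) auto
    finally show ?thesis using that(2) fr[of v] by (simp add: mult_ac)
  qed
  \<comment> \<open>With respect to the bisector of the two centres, x and y lie weakly on the side
    of c and z on the side of c'.\<close>
  have 1: "0 \<le> (z - x) \<bullet> D" "0 \<le> (z - y) \<bullet> D"
    using le[of x] le[of y] sph ge zc by (auto simp: inner_diff_left)
  have "0 \<le> ((z - x) \<bullet> ?t) * (slope * \<bar>b\<bar> + a)"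
    using hor[OF touch_horizontal[OF x z q xq zq] 1(1)] xz by (simp add: inner_diff_left algebra_simps)
  then have a1: "0 \<le> slope * \<bar>b\<bar> + a" using xz by (simp add: zero_le_mult_iff inner_diff_left)
  have "0 \<le> ((y - z) \<bullet> ?t) * (slope * \<bar>b\<bar> - a)"
    using hor[OF touch_horizontal[OF y z q yq zq] 1(2)] zy by (simp add: inner_diff_left algebra_simps)
  then have a2: "0 \<le> slope * \<bar>b\<bar> - a" using zy by (simp add: zero_le_mult_iff inner_diff_left)
  have "slope * \<bar>b\<bar> \<le> 1/2 * \<bar>b\<bar>" using slope by (intro mult_right_mono) auto
  then have ab: "\<bar>a\<bar> \<le> \<bar>b\<bar>" using a1 a2 by linarith
  have "(norm D)\<^sup>2 \<le> (\<bar>a\<bar> + \<bar>b\<bar>)\<^sup>2"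
    unfolding norm_frame[OF n, of D] by (simp add: a_def b_def power2_sum)
  then have "norm D \<le> \<bar>a\<bar> + \<bar>b\<bar>" by (rule power2_le_imp_le) simp
  then have Db: "norm D \<le> 2 * \<bar>b\<bar>" using ab by simp
  have bpos: "0 < \<bar>b\<bar>" using Db D0 by (smt (verit) zero_less_norm_iff)
  have nx: "norm (x - c + \<alpha> *\<^sub>R ?n) \<le> 7 * K * \<eta>" and nz: "norm (z - c' + \<alpha> *\<^sub>R ?n) \<le> 7 * K * \<eta>"
    using touch_normal_near[OF x q xq] touch_normal_near[OF z q zq] by auto
  have "D = (z - q) - (x - q) + (x - c + \<alpha> *\<^sub>R ?n) - (z - c' + \<alpha> *\<^sub>R ?n)" by (simp add: D_def)
  then have "norm D \<le> norm (z - q) + norm (x - q) + norm (x - c + \<alpha> *\<^sub>R ?n) + norm (z - c' + \<alpha> *\<^sub>R ?n)"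
    using norm_triangle_ineq4[of "(z - q) - (x - q) + (x - c + \<alpha> *\<^sub>R ?n)" "z - c' + \<alpha> *\<^sub>R ?n"]
      norm_triangle_ineq[of "(z - q) - (x - q)" "x - c + \<alpha> *\<^sub>R ?n"] norm_triangle_ineq4[of "z - q" "x - q"]
    by (smt (verit))
  then have D22: "norm D \<le> 22 * K * \<eta>" using nx nz xq zq by simp
  have Dsq: "(norm D)\<^sup>2 \<le> norm D * (22 * K * \<eta>)"
    using D22 by (simp add: power2_eq_square mult_left_mono)
  have cs: "\<bar>v \<bullet> D\<bar> \<le> norm D * (7 * K * \<eta>)" if "norm v \<le> 7 * K * \<eta>" for v
    using Cauchy_Schwarz_ineq2[of v D] mult_left_mono[OF that norm_ge_zero[of D]] by (simp add: mult.commute)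
  \<comment> \<open>Raising c' above c would put z into \<open>ball c \<alpha>\<close>; lowering it
    would put x into \<open>ball c' \<alpha>\<close>. Here 18 = 7 + 22 / 2, and the factor 2 in
    \<open>Db\<close> makes it 36, which is below the 44 of the locale.\<close>
  have "\<alpha> * \<bar>b\<bar> \<le> norm D * (18 * K * \<eta>)"
  proof (cases "0 < b")
    case True
    have "(z - c') \<bullet> D = (z - c' + \<alpha> *\<^sub>R ?n) \<bullet> D - \<alpha> * b" by (simp add: inner_add_left b_def inner_commute[of D])
    then have "\<alpha> * b \<le> norm D * (7 * K * \<eta>) + (norm D)\<^sup>2 / 2" using cs[OF nz] ge by linarith
    then show ?thesis using Dsq True by simp
  next
    case False
    have "(x - c) \<bullet> D = (x - c + \<alpha> *\<^sub>R ?n) \<bullet> D - \<alpha> * b" by (simp add: inner_add_left b_def inner_commute[of D])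
    then have "\<alpha> * (- b) \<le> norm D * (7 * K * \<eta>) + (norm D)\<^sup>2 / 2" using cs[OF nx] le[of x] sph by simp
    then show ?thesis using Dsq False by simp
  qed
  also have "\<dots> \<le> (2 * \<bar>b\<bar>) * (18 * K * \<eta>)" using Db K \<eta> by (intro mult_right_mono) auto
  also have "\<dots> = \<bar>b\<bar> * (36 * K * \<eta>)" by simp
  finally have "\<alpha> \<le> 36 * K * \<eta>" using bpos by (simp add: mult.commute)
  moreover have "0 < K * \<eta>" using K \<eta> by simp
  ultimately show False using \<eta>(3) by simp
qed


text \<open>Vectors of bounded slope with nonnegative tangential part form a convex cone, so a chain
  of steps in one tangential direction keeps the slope bound.\<close>

lemma horizontal_add:
  assumes "\<bar>v \<bullet> n\<bar> \<le> slope * \<bar>v \<bullet> t\<bar>" "\<bar>w \<bullet> n\<bar> \<le> slope * \<bar>w \<bullet> t\<bar>" "0 \<le> v \<bullet> t" "0 \<le> w \<bullet> t"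
  shows "\<bar>(v + w) \<bullet> n\<bar> \<le> slope * \<bar>(v + w) \<bullet> t\<bar>"
proof -
  have "\<bar>(v + w) \<bullet> n\<bar> \<le> \<bar>v \<bullet> n\<bar> + \<bar>w \<bullet> n\<bar>" by (simp add: inner_add_left)
  also have "\<dots> \<le> slope * \<bar>v \<bullet> t\<bar> + slope * \<bar>w \<bullet> t\<bar>" using assms by linarith
  also have "\<dots> = slope * \<bar>(v + w) \<bullet> t\<bar>" using assms by (simp add: inner_add_left algebra_simps)
  finally show ?thesis .
qed

lemma horizontal_scale:
  assumes "\<bar>v \<bullet> n\<bar> \<le> slope * \<bar>v \<bullet> t\<bar>"
  shows "\<bar>(l *\<^sub>R v) \<bullet> n\<bar> \<le> slope * \<bar>(l *\<^sub>R v) \<bullet> t\<bar>"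
proof -
  have "\<bar>l\<bar> * \<bar>v \<bullet> n\<bar> \<le> \<bar>l\<bar> * (slope * \<bar>v \<bullet> t\<bar>)" by (intro mult_left_mono assms) simp
  then show ?thesis by (simp add: abs_mult mult_ac)
qed

lemma edges_horizontal_separated:
  assumes x: "touch x c p" and y: "touch y c p" and x': "touch x' c' p'" and y': "touch y' c' p'"
    and q: "q \<in> frontier S" and near: "norm (x - q) \<le> 4 * K * \<eta>" "norm (y - q) \<le> 4 * K * \<eta>"
      "norm (x' - q) \<le> 4 * K * \<eta>" "norm (y' - q) \<le> 4 * K * \<eta>"
    and ord: "x \<bullet> perp (nrm q) < y \<bullet> perp (nrm q)" "x' \<bullet> perp (nrm q) < y' \<bullet> perp (nrm q)"
      "y \<bullet> perp (nrm q) \<le> x' \<bullet> perp (nrm q)"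
    and u: "u \<in> closed_segment x y" and w: "w \<in> closed_segment x' y'"
  shows "\<bar>(w - u) \<bullet> nrm q\<bar> \<le> slope * \<bar>(w - u) \<bullet> perp (nrm q)\<bar>"
proof -
  let ?t = "perp (nrm q)"
  obtain l where l: "0 \<le> l" "l \<le> 1" "u = (1 - l) *\<^sub>R x + l *\<^sub>R y"
    using u by (auto simp: in_segment)
  obtain m where m: "0 \<le> m" "m \<le> 1" "w = (1 - m) *\<^sub>R x' + m *\<^sub>R y'"
    using w by (auto simp: in_segment)
  \<comment> \<open>From u to the end of its edge, across the gap, and along the other edge to
    w.\<close>
  have eq: "w - u = m *\<^sub>R (y' - x') + ((x' - y) + (1 - l) *\<^sub>R (y - x))"
    by (simp add: l m algebra_simps)
  have 1: "0 \<le> (m *\<^sub>R (y' - x')) \<bullet> ?t" "0 \<le> (x' - y) \<bullet> ?t" "0 \<le> ((1 - l) *\<^sub>R (y - x)) \<bullet> ?t"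
    using ord l m by (simp_all add: inner_diff_left)
  have 2: "0 \<le> ((x' - y) + (1 - l) *\<^sub>R (y - x)) \<bullet> ?t"
    using 1 by (simp only: inner_add_left)
  show ?thesis
    unfolding eq
    by (intro horizontal_add horizontal_scale 1 2)
      (use touch_horizontal[OF x' y' q near(3,4)] touch_horizontal[OF y x' q near(2,3)]
        touch_horizontal[OF x y q near(1,2)] in auto)
qed

text \<open>If the tangential ranges overlap, \<open>no_touch_between\<close> forbids an end of one
  edge strictly inside the range of the other, so the edges coincide. Otherwise one edge precedes
  the other.\<close>

lemma edges_horizontal_ordered:
  assumes x: "touch x c p" and y: "touch y c p" and x': "touch x' c' p'" and y': "touch y' c' p'"
    and q: "q \<in> frontier S" and near: "norm (x - q) \<le> 4 * K * \<eta>" "norm (y - q) \<le> 4 * K * \<eta>"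
      "norm (x' - q) \<le> 4 * K * \<eta>" "norm (y' - q) \<le> 4 * K * \<eta>"
    and ord: "x \<bullet> perp (nrm q) < y \<bullet> perp (nrm q)" "x' \<bullet> perp (nrm q) < y' \<bullet> perp (nrm q)"
    and u: "u \<in> closed_segment x y" and w: "w \<in> closed_segment x' y'"
  shows "\<bar>(u - w) \<bullet> nrm q\<bar> \<le> slope * \<bar>(u - w) \<bullet> perp (nrm q)\<bar>"
proof -
  let ?t = "perp (nrm q)"
  consider "y \<bullet> ?t \<le> x' \<bullet> ?t" | "y' \<bullet> ?t \<le> x \<bullet> ?t" | "x' \<bullet> ?t < y \<bullet> ?t" "x \<bullet> ?t < y' \<bullet> ?t"
    by linarith
  then show ?thesis
  proof cases
    case 1
    have "\<bar>(w - u) \<bullet> nrm q\<bar> \<le> slope * \<bar>(w - u) \<bullet> ?t\<bar>"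
      by (rule edges_horizontal_separated[OF x y x' y' q near ord 1 u w])
    then show ?thesis by (simp add: inner_diff_left abs_minus_commute)
  next
    case 2
    show ?thesis
      by (rule edges_horizontal_separated[OF x' y' x y q near(3,4,1,2) ord(2,1) 2 w u])
  next
    case 3
    have "\<not> x \<bullet> ?t < x' \<bullet> ?t" using no_touch_between[OF x y x' q near(1-3)] 3 by blast
    moreover have "\<not> x' \<bullet> ?t < x \<bullet> ?t" using no_touch_between[OF x' y' x q near(3,4,1)] 3 by blast
    ultimately have xx: "x = x'" using touch_eq[OF x x' q near(1,3)] by simp
    have "\<not> y' \<bullet> ?t < y \<bullet> ?t" using no_touch_between[OF x y y' q near(1,2,4)] 3 by blast
    moreover have "\<not> y \<bullet> ?t < y' \<bullet> ?t" using no_touch_between[OF x' y' y q near(3,4,2)] 3 by blast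
    ultimately have yy: "y = y'" using touch_eq[OF y y' q near(2,4)] by simp
    obtain l where l: "u = (1 - l) *\<^sub>R x + l *\<^sub>R y" using u by (auto simp: in_segment)
    obtain m where m: "w = (1 - m) *\<^sub>R x + m *\<^sub>R y" using w xx yy by (auto simp: in_segment)
    have "u - w = (l - m) *\<^sub>R (y - x)" by (simp add: l m algebra_simps)
    then show ?thesis using horizontal_scale[OF touch_horizontal[OF x y q near(1,2)]] by simp
  qed
qed

lemma edges_horizontal:
  assumes x: "touch x c p" and y: "touch y c p" and x': "touch x' c' p'" and y': "touch y' c' p'"
    and ne: "x \<noteq> y" "x' \<noteq> y'"
    and q: "q \<in> frontier S" and near: "norm (x - q) \<le> 4 * K * \<eta>" "norm (y - q) \<le> 4 * K * \<eta>"
      "norm (x' - q) \<le> 4 * K * \<eta>" "norm (y' - q) \<le> 4 * K * \<eta>"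
    and u: "u \<in> closed_segment x y" and w: "w \<in> closed_segment x' y'"
  shows "\<bar>(u - w) \<bullet> nrm q\<bar> \<le> slope * \<bar>(u - w) \<bullet> perp (nrm q)\<bar>"
proof -
  let ?t = "perp (nrm q)"
  have ne': "x \<bullet> ?t \<noteq> y \<bullet> ?t" "x' \<bullet> ?t \<noteq> y' \<bullet> ?t"
    using ne touch_eq[OF x y q near(1,2)] touch_eq[OF x' y' q near(3,4)] by auto
  have u': "u \<in> closed_segment y x" and w': "w \<in> closed_segment y' x'"
    using u w by (simp_all add: closed_segment_commute)
  consider "x \<bullet> ?t < y \<bullet> ?t" "x' \<bullet> ?t < y' \<bullet> ?t" | "x \<bullet> ?t < y \<bullet> ?t" "y' \<bullet> ?t < x' \<bullet> ?t"
    | "y \<bullet> ?t < x \<bullet> ?t" "x' \<bullet> ?t < y' \<bullet> ?t" | "y \<bullet> ?t < x \<bullet> ?t" "y' \<bullet> ?t < x' \<bullet> ?t"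
    using ne' by linarith
  then show ?thesis
  proof cases
    case 1 show ?thesis by (rule edges_horizontal_ordered[OF x y x' y' q near 1 u w])
  next
    case 2 show ?thesis by (rule edges_horizontal_ordered[OF x y y' x' q near(1,2,4,3) 2 u w'])
  next
    case 3 show ?thesis by (rule edges_horizontal_ordered[OF y x x' y' q near(2,1,3,4) 3 u' w])
  next
    case 4 show ?thesis by (rule edges_horizontal_ordered[OF y x y' x' q near(2,1,4,3) 4 u' w'])
  qed
qed

text \<open>By convexity u stays within K * \<eta> of the foot p, hence of its own projection, which
  puts the ends of the edge within 3 * K * \<eta> of \<open>proj u\<close>. The radius 4 * K *
  \<eta> used above leaves room for changing to the projection of a second point.\<close>

lemma alpha_shape_touch:
  assumes "u \<in> alpha_shape \<alpha> X"
  obtains x y c p where "touch x c p" "touch y c p" "x \<noteq> y" "u \<in> closed_segment x y"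
    "p \<in> frontier S" "norm (u - p) \<le> K * \<eta>" "\<bar>(u - p) \<bullet> nrm p\<bar> \<le> K * \<eta>\<^sup>2"
    "norm (x - proj u) \<le> 3 * K * \<eta>" "norm (y - proj u) \<le> 3 * K * \<eta>" "norm (u - proj u) \<le> K * \<eta>"
proof -
  obtain x y where e: "alpha_edge \<alpha> X x y" and u: "u \<in> closed_segment x y"
    using assms by (auto simp: alpha_shape_def)
  obtain c p where x: "touch x c p" and y: "touch y c p" and ne: "x \<noteq> y" by (rule edge_touch[OF e])
  have p: "p \<in> frontier S" using x by (simp add: touch_def)
  note bx = touch_bounds[OF x] and b_y = touch_bounds[OF y]
  have "closed_segment x y \<subseteq> cball p (K * \<eta>)"
    using bx b_y by (intro closed_segment_subset) (auto simp: dist_norm norm_minus_commute)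
  then have up: "norm (u - p) \<le> K * \<eta>" using u by (auto simp: dist_norm norm_minus_commute)
  have "K * \<eta>\<^sup>2 \<ge> \<eta>\<^sup>2" using K(1) mult_right_mono[of 1 K "\<eta>\<^sup>2"] by simp
  then have ax: "\<bar>(x - p) \<bullet> nrm p\<bar> \<le> K * \<eta>\<^sup>2" and ay: "\<bar>(y - p) \<bullet> nrm p\<bar> \<le> K * \<eta>\<^sup>2"
    using bx b_y by auto
  obtain l where l: "0 \<le> l" "l \<le> 1" "u = (1 - l) *\<^sub>R x + l *\<^sub>R y"
    using u by (auto simp: in_segment)
  have "u - p = (1 - l) *\<^sub>R (x - p) + l *\<^sub>R (y - p)" by (simp add: l algebra_simps)
  then have "(u - p) \<bullet> nrm p = (1 - l) * ((x - p) \<bullet> nrm p) + l * ((y - p) \<bullet> nrm p)"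
    by (simp add: inner_add_left)
  then have "\<bar>(u - p) \<bullet> nrm p\<bar> \<le> (1 - l) * \<bar>(x - p) \<bullet> nrm p\<bar> + l * \<bar>(y - p) \<bullet> nrm p\<bar>"
    using l abs_triangle_ineq[of "(1 - l) * ((x - p) \<bullet> nrm p)" "l * ((y - p) \<bullet> nrm p)"]
    by (simp add: abs_mult)
  also have "\<dots> \<le> (1 - l) * (K * \<eta>\<^sup>2) + l * (K * \<eta>\<^sup>2)"
    using ax ay l by (intro add_mono mult_left_mono) auto
  also have "\<dots> = K * \<eta>\<^sup>2" by (simp add: algebra_simps)
  finally have un: "\<bar>(u - p) \<bullet> nrm p\<bar> \<le> K * \<eta>\<^sup>2" .
  have uq: "norm (u - proj u) \<le> K * \<eta>" using proj_le[OF p, of u] up by (simp add: dist_norm)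
  have near: "norm (z - proj u) \<le> 3 * K * \<eta>" if "norm (z - p) \<le> K * \<eta>" for z
    using norm_triangle_ineq[of "(z - p) - (u - p)" "u - proj u"] norm_triangle_ineq4[of "z - p" "u - p"]
      that up uq by simp
  show thesis using that[OF x y ne u p up un near[OF bx(1)] near[OF b_y(1)] uq] .
qed

text \<open>Passing from the foot p to \<open>proj u\<close> costs the turning of the normal and a
  displacement along the curved boundary, each at most
  \<open>2 * K\<^sup>2 / r * \<eta>\<^sup>2\<close>.\<close>

lemma alpha_shape_height:
  assumes "u \<in> alpha_shape \<alpha> X"
  shows "\<bar>height u\<bar> \<le> (K + 4 * K\<^sup>2 / r) * \<eta>\<^sup>2"
proof -
  obtain p where p: "p \<in> frontier S" "norm (u - p) \<le> K * \<eta>" "\<bar>(u - p) \<bullet> nrm p\<bar> \<le> K * \<eta>\<^sup>2"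
    "norm (u - proj u) \<le> K * \<eta>"
    using alpha_shape_touch[OF assms] by metis
  let ?q = "proj u"
  have q: "?q \<in> frontier S" by (rule proj_frontier)
  have pq: "norm (p - ?q) \<le> 2 * K * \<eta>"
    using norm_triangle_ineq4[of "u - ?q" "u - p"] p by simp
  have eq: "height u = (u - p) \<bullet> nrm p + (u - p) \<bullet> (nrm ?q - nrm p) + (p - ?q) \<bullet> nrm ?q"
    by (simp add: height_def inner_diff_left inner_diff_right)
  have "\<bar>(u - p) \<bullet> (nrm ?q - nrm p)\<bar> \<le> norm (u - p) * norm (nrm ?q - nrm p)"
    by (rule Cauchy_Schwarz_ineq2)
  also have "\<dots> \<le> (K * \<eta>) * (2 * K * \<eta> / r)"
  proof (intro mult_mono p)
    have "norm (nrm ?q - nrm p) \<le> norm (p - ?q) / r"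
      using normal_lipschitz[OF q p(1)] by (simp add: norm_minus_commute)
    also have "\<dots> \<le> 2 * K * \<eta> / r" using pq r_pos by (intro divide_right_mono) auto
    finally show "norm (nrm ?q - nrm p) \<le> 2 * K * \<eta> / r" .
  qed (use K \<eta> in auto)
  finally have 1: "\<bar>(u - p) \<bullet> (nrm ?q - nrm p)\<bar> \<le> 2 * K\<^sup>2 / r * \<eta>\<^sup>2"
    by (simp add: power2_eq_square algebra_simps)
  have "\<bar>(p - ?q) \<bullet> nrm ?q\<bar> \<le> (norm (p - ?q))\<^sup>2 / (2 * r)"
    by (rule frontier_quadratic[OF q p(1)])
  also have "\<dots> \<le> (2 * K * \<eta>)\<^sup>2 / (2 * r)"
    using pq r_pos by (intro divide_right_mono power_mono) auto
  also have "\<dots> = 2 * K\<^sup>2 / r * \<eta>\<^sup>2" by (simp add: power_mult_distrib)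
  finally have 2: "\<bar>(p - ?q) \<bullet> nrm ?q\<bar> \<le> 2 * K\<^sup>2 / r * \<eta>\<^sup>2" .
  have "\<bar>height u\<bar> \<le> K * \<eta>\<^sup>2 + 2 * K\<^sup>2 / r * \<eta>\<^sup>2 + 2 * K\<^sup>2 / r * \<eta>\<^sup>2"
    unfolding eq using 1 2 p(3) by linarith
  also have "\<dots> = (K + 4 * K\<^sup>2 / r) * \<eta>\<^sup>2" by (simp add: algebra_simps)
  finally show ?thesis .
qed

text \<open>Projections at most \<open>\<eta>\<^sup>2\<close> apart bring the ends of both edges
  within 4 * K * \<eta> of \<open>proj w\<close>, where \<open>edges_horizontal\<close> applies.
  Equal projections in particular force u = w.\<close>

lemma alpha_shape_expanding:
  assumes u: "u \<in> alpha_shape \<alpha> X" and w: "w \<in> alpha_shape \<alpha> X"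
    and d: "norm (proj u - proj w) \<le> \<eta>\<^sup>2"
  shows "norm (u - w) \<le> (1 + slope\<^sup>2) * (1 + (K + 4 * K\<^sup>2 / r) * \<eta>\<^sup>2 / r) * norm (proj u - proj w)"
proof -
  obtain x y c p where x: "touch x c p" and y: "touch y c p" and ne: "x \<noteq> y" "u \<in> closed_segment x y"
    and xu: "norm (x - proj u) \<le> 3 * K * \<eta>" and yu: "norm (y - proj u) \<le> 3 * K * \<eta>"
    using alpha_shape_touch[OF u] by metis
  obtain x' y' c' p' where x': "touch x' c' p'" and y': "touch y' c' p'" and ne': "x' \<noteq> y'" "w \<in> closed_segment x' y'"
    and xw: "norm (x' - proj w) \<le> 3 * K * \<eta>" and yw: "norm (y' - proj w) \<le> 3 * K * \<eta>"
    using alpha_shape_touch[OF w] by metis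
  have K\<eta>: "0 \<le> K * \<eta>" using K \<eta> by simp
  have near: "norm (z - proj w) \<le> 4 * K * \<eta>" if "norm (z - proj u) \<le> 3 * K * \<eta>" for z
    using norm_triangle_ineq[of "z - proj u" "proj u - proj w"] that d K_\<eta>(2) by simp
  have "\<bar>(u - w) \<bullet> nrm (proj w)\<bar> \<le> slope * \<bar>(u - w) \<bullet> perp (nrm (proj w))\<bar>"
    by (rule edges_horizontal[OF x y x' y' ne(1) ne'(1) proj_frontier near[OF xu] near[OF yu] _ _ ne(2) ne'(2)])
      (use xw yw K\<eta> in auto)
  then show ?thesis
    by (rule proj_expanding[OF alpha_shape_height[OF u] slope(1)])
qed

end

section \<open>Edges over every boundary point\<close>

text \<open>The centre divides the segment from a to b in the ratio of s - \<rho> to t - \<rho>. The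
  lemma turns an overlap with an inner ball into a ball to which density applies.\<close>

lemma ball_in_lens:
  fixes a b :: "'a::real_normed_vector"
  assumes "dist a b \<le> s + t - 2 * \<rho>" "\<rho> < s" "\<rho> < t"
  obtains q where "ball q \<rho> \<subseteq> ball a s" "ball q \<rho> \<subseteq> ball b t"
proof -
  define l where "l = (s - \<rho>) / (s + t - 2 * \<rho>)"
  have pos: "0 < s + t - 2 * \<rho>" using assms by linarith
  have l: "0 \<le> l" "l \<le> 1" "l * (s + t - 2 * \<rho>) = s - \<rho>" "(1 - l) * (s + t - 2 * \<rho>) = t - \<rho>"
    using assms pos by (auto simp: l_def field_simps)
  define q where "q = a + l *\<^sub>R (b - a)"
  have qa: "dist q a \<le> s - \<rho>"
  proof -
    have "dist q a = l * dist a b" using l by (simp add: q_def dist_norm norm_minus_commute)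
    also have "\<dots> \<le> l * (s + t - 2 * \<rho>)" using assms l by (intro mult_left_mono) auto
    finally show ?thesis using l by simp
  qed
  have qb: "dist q b \<le> t - \<rho>"
  proof -
    have "q - b = (1 - l) *\<^sub>R (a - b)" by (simp add: q_def algebra_simps)
    then have "dist q b = (1 - l) * dist a b" using l(2) by (simp add: dist_norm)
    also have "\<dots> \<le> (1 - l) * (s + t - 2 * \<rho>)" using assms l by (intro mult_left_mono) auto
    finally show ?thesis using l by simp
  qed
  have "ball q \<rho> \<subseteq> ball e v" if "dist q e \<le> v - \<rho>" for e v
  proof
    fix x assume "x \<in> ball q \<rho>"
    then show "x \<in> ball e v" using that dist_triangle[of e x q] by (simp add: dist_commute)
  qed
  then show thesis using that qa qb by blast
qed

text \<open>\<open>b \<bullet> perp a\<close> is the determinant of a and b. On the lower half of a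
  circle the tangential order is the angular order, and this fixes the sign.\<close>

lemma perp_inner_lower_arc:
  fixes a b n :: "real^2"
  assumes n: "norm n = 1" and ab: "norm a = norm b"
    and low: "a \<bullet> n < 0" "b \<bullet> n < 0" and lt: "a \<bullet> perp n < b \<bullet> perp n"
  shows "b \<bullet> perp a < 0"
proof -
  define a1 where "a1 = a \<bullet> perp n"
  define a2 where "a2 = a \<bullet> n"
  define b1 where "b1 = b \<bullet> perp n"
  define b2 where "b2 = b \<bullet> n"
  have "n$1 * n$1 + n$2 * n$2 = 1"
    using n by (simp add: norm_eq_1 inner_vec_def sum_2)
  then have eq: "b \<bullet> perp a = a2 * b1 - a1 * b2"
    unfolding a1_def a2_def b1_def b2_def perp_def inner_vec_def sum_2 inner_real_def vector_2 by algebra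
  have sq: "a1\<^sup>2 + a2\<^sup>2 = b1\<^sup>2 + b2\<^sup>2"
    using norm_frame[OF n, of a] norm_frame[OF n, of b] ab by (simp add: a1_def a2_def b1_def b2_def)
  have s: "a2 < 0" "b2 < 0" "a1 < b1" using low lt by (auto simp: a1_def a2_def b1_def b2_def)
  consider "a1 \<le> 0" "0 \<le> b1" | "0 < a1" | "b1 < 0" by linarith
  then have "a2 * b1 < a1 * b2"
  proof cases
    case 1
    then have "a2 * b1 \<le> 0" "0 \<le> a1 * b2" using s by (auto simp: mult_nonpos_nonneg mult_nonpos_nonpos)
    moreover have "a2 * b1 \<noteq> 0 \<or> a1 * b2 \<noteq> 0" using s by auto
    ultimately show ?thesis by linarith
  next
    case 2
    then have "a1\<^sup>2 < b1\<^sup>2" using s by (intro power_strict_mono) auto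
    then have "b2\<^sup>2 < a2\<^sup>2" using sq by linarith
    then have "- b2 < - a2" using s power2_less_imp_less[of "- b2" "- a2"] by simp
    then have "a1 * (- b2) < b1 * (- a2)" using s 2 by (intro mult_strict_mono) auto
    then show ?thesis by (simp add: mult.commute)
  next
    case 3
    then have "(- b1)\<^sup>2 < (- a1)\<^sup>2" using s by (intro power_strict_mono) auto
    then have "a2\<^sup>2 < b2\<^sup>2" using sq by simp
    then have "- a2 < - b2" using s power2_less_imp_less[of "- a2" "- b2"] by simp
    then have "(- b1) * (- a2) < (- a1) * (- b2)" using s 3 by (intro mult_strict_mono) auto
    then show ?thesis by (simp add: mult.commute)
  qed
  then show ?thesis using eq by simp
qed

lemma perp_inner_lower_arc_signed:
  fixes a b n :: "real^2"
  assumes n: "norm n = 1" and ab: "norm a = norm b"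
    and low: "a \<bullet> n < 0" "b \<bullet> n < 0" and s: "s = 1 \<or> s = -1" and lt: "s * (a \<bullet> perp n) < s * (b \<bullet> perp n)"
  shows "s * (b \<bullet> perp a) < 0"
proof (cases "s = 1")
  case True
  then show ?thesis using perp_inner_lower_arc[OF n ab low] lt by simp
next
  case False
  then have "s = -1" using s by simp
  moreover from this have "a \<bullet> perp b < 0"
    using perp_inner_lower_arc[OF n ab[symmetric] low(2,1)] lt by simp
  moreover have "b \<bullet> perp a = - (a \<bullet> perp b)"
    by (simp add: perp_def inner_vec_def sum_2)
  ultimately show ?thesis by simp
qed

context rolling_set
begin

text \<open>Among the empty balls near the outer tangent ball at \<open>p\<close>, take one that reaches deepest below
  \<open>p\<close> along the normal. It touches sample points on both sides of the normal: otherwise it could be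
  rotated away from them and then lowered.\<close>
lemma frontier_covered:
  assumes \<alpha>: "0 < \<alpha>" "\<alpha> < r" and K: "2 * \<alpha> * r / (r - \<alpha>) \<le> K\<^sup>2" "0 \<le> K"
    and X: "finite X" "X \<subseteq> S"
    and \<zeta>: "0 < \<zeta>" "r * \<zeta>\<^sup>2 < \<alpha> * (r - \<alpha>)" "K * \<zeta> + \<zeta>\<^sup>2 < r"
    and \<rho>: "0 < \<rho>" "8 * \<alpha> * \<rho> < \<zeta>^4" "8 * \<rho> < \<zeta>\<^sup>2" "4 * \<rho> < \<alpha>"
    and dense: "\<And>q. ball q \<rho> \<subseteq> S \<Longrightarrow> ball q \<rho> \<inter> X \<noteq> {}"
    and p: "p \<in> frontier S" "p \<notin> proj ` X"
  shows "p \<in> proj ` alpha_shape \<alpha> X"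
proof -
  define z where "z = \<zeta>\<^sup>2"
  have z: "0 < z" using \<zeta> by (simp add: z_def)
  let ?n = "nrm p"
  let ?t = "perp ?n"
  note n = nrm(1)[OF p(1)]
  have nn: "?n \<bullet> ?n = 1" using n by (simp add: norm_eq_1)
  \<comment> \<open>Empty balls paired with a depth \<sigma> such that the closed ball contains the
    point at depth \<sigma> below p. The bounds z and z / 4 make this set compact.\<close>
  define F where "F = {(c, \<sigma>). c \<in> cball (p + \<alpha> *\<^sub>R ?n) z \<and> \<sigma> \<in> {0..z / 4} \<and>
      norm (p - \<sigma> *\<^sub>R ?n - c) \<le> \<alpha> \<and> (\<forall>x\<in>X. \<alpha> \<le> dist c x)}"
  \<comment> \<open>The bounds z and z / 4 are never attained, so a maximal pair can still be
    perturbed: a ball reaching too far inwards would contain a ball of radius \<rho> inside S, and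
    hence a sample point.\<close>
  have feas: "\<sigma> < z / 4" "norm (c - p - \<alpha> *\<^sub>R ?n) < z" "0 < (c - p) \<bullet> ?n" if "(c, \<sigma>) \<in> F" for c \<sigma>
  proof -
    have f: "norm (c - p - \<alpha> *\<^sub>R ?n) \<le> z" "0 \<le> \<sigma>" "\<sigma> \<le> z / 4" "norm (p - \<sigma> *\<^sub>R ?n - c) \<le> \<alpha>"
      "\<And>x. x \<in> X \<Longrightarrow> \<alpha> \<le> dist c x"
      using that by (auto simp: F_def dist_norm norm_minus_commute algebra_simps)
    have far: "\<alpha> + r - 2 * \<rho> < dist c (p - r *\<^sub>R ?n)"
    proof (rule ccontr)
      assume "\<not> ?thesis"
      then obtain q where "ball q \<rho> \<subseteq> ball c \<alpha>" "ball q \<rho> \<subseteq> ball (p - r *\<^sub>R ?n) r"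
        using ball_in_lens[of c "p - r *\<^sub>R ?n" \<alpha> r \<rho>] \<rho> \<alpha> by auto
      then show False using dense[of q] nrm(3)[OF p(1)] f(5) by fastforce
    qed
    have s1: "norm (c - p + \<sigma> *\<^sub>R ?n) \<le> \<alpha>"
      using f(4) by (simp add: norm_minus_commute algebra_simps)
    define C where "C = c - p"
    define m where "m = C \<bullet> ?n"
    have zr: "z < r"
    proof -
      have "\<alpha> * (r - \<alpha>) \<le> r * r" using \<alpha> by (intro mult_mono) auto
      then have "r * z < r * r" using \<zeta>(2) unfolding z_def by linarith
      then show ?thesis using r_pos by simp
    qed
    then have sr: "\<sigma> < r" using f(3) z by linarith
    have "dist c (p - r *\<^sub>R ?n) = norm ((C + \<sigma> *\<^sub>R ?n) + (r - \<sigma>) *\<^sub>R ?n)"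
      by (simp add: C_def dist_norm algebra_simps)
    also have "\<dots> \<le> norm (C + \<sigma> *\<^sub>R ?n) + (r - \<sigma>)"
      using norm_triangle_ineq[of "C + \<sigma> *\<^sub>R ?n" "(r - \<sigma>) *\<^sub>R ?n"] n sr by simp
    finally have "\<sigma> < 2 * \<rho>" using far s1 by (simp add: C_def)
    then show "\<sigma> < z / 4" using \<rho>(3) z_def by simp
    have e1: "(norm (C + \<sigma> *\<^sub>R ?n))\<^sup>2 = (norm C)\<^sup>2 + 2 * \<sigma> * m + \<sigma>\<^sup>2"
      using n f(2) by (simp add: norm_plus_sq[of C] m_def)
    have "(norm (C + \<sigma> *\<^sub>R ?n))\<^sup>2 \<le> \<alpha>\<^sup>2" using s1 by (intro power_mono) (auto simp: C_def)
    then have e1': "(norm C)\<^sup>2 + 2 * \<sigma> * m + \<sigma>\<^sup>2 \<le> \<alpha>\<^sup>2" using e1 by simp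
    have "(\<alpha> + r - 2 * \<rho>)\<^sup>2 \<le> (norm (C + r *\<^sub>R ?n))\<^sup>2"
      using far \<rho> \<alpha> by (intro power_mono) (auto simp: C_def dist_norm algebra_simps)
    also have "\<dots> = (norm C)\<^sup>2 + 2 * r * m + r\<^sup>2"
      using n r_pos by (simp add: norm_plus_sq[of C] m_def)
    finally have "(\<alpha> + r - 2 * \<rho>)\<^sup>2 - r\<^sup>2 - \<alpha>\<^sup>2 \<le> 2 * (r - \<sigma>) * m - \<sigma>\<^sup>2"
      using e1' by (simp add: algebra_simps)
    then have "2 * \<alpha> * r - 4 * \<rho> * (\<alpha> + r) + 4 * \<rho>\<^sup>2 \<le> 2 * (r - \<sigma>) * m - \<sigma>\<^sup>2"
      by (simp add: power2_eq_square algebra_simps)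
    then have "2 * \<alpha> * r - 4 * \<rho> * (\<alpha> + r) \<le> 2 * (r - \<sigma>) * m"
      using zero_le_power2[of \<rho>] zero_le_power2[of \<sigma>] by linarith
    moreover have "4 * \<rho> * (\<alpha> + r) \<le> 4 * \<rho> * (2 * r)" using \<rho> \<alpha> by (intro mult_left_mono) auto
    ultimately have mm: "2 * (\<alpha> - 4 * \<rho>) * r \<le> 2 * (r - \<sigma>) * m" by (simp add: algebra_simps)
    moreover have "0 < 2 * (\<alpha> - 4 * \<rho>) * r" using \<rho>(4) r_pos by simp
    ultimately have "0 < 2 * (r - \<sigma>) * m" by linarith
    then have m: "0 < m" using sr by (simp add: zero_less_mult_iff)
    then show "0 < (c - p) \<bullet> ?n" by (simp add: m_def C_def)
    have "2 * (r - \<sigma>) * m \<le> 2 * r * m" using m f(2) by (intro mult_right_mono) auto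
    then have "(\<alpha> - 4 * \<rho>) * r \<le> m * r" using mm by (simp add: algebra_simps)
    \<comment> \<open>The centre has height almost \<alpha> over p and distance at most \<alpha>
      from it, so it is within sqrt (8 * \<alpha> * \<rho>) < z of p + \<alpha> * n.\<close>
    then have m4: "\<alpha> - 4 * \<rho> \<le> m" using r_pos by simp
    have "0 \<le> 2 * \<sigma> * m" using f(2) m by simp
    then have "(norm C)\<^sup>2 \<le> \<alpha>\<^sup>2" using e1' zero_le_power2[of \<sigma>] by linarith
    moreover have "(norm (C - \<alpha> *\<^sub>R ?n))\<^sup>2 = (norm C)\<^sup>2 - 2 * \<alpha> * m + \<alpha>\<^sup>2"
      using n \<alpha> by (simp add: norm_minus_sq[of C] m_def)
    moreover have "2 * \<alpha> * (\<alpha> - 4 * \<rho>) \<le> 2 * \<alpha> * m" using m4 \<alpha> by (intro mult_left_mono) auto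
    ultimately have "(norm (C - \<alpha> *\<^sub>R ?n))\<^sup>2 \<le> 8 * \<alpha> * \<rho>" by (simp add: power2_eq_square algebra_simps)
    also have "\<dots> < z\<^sup>2" using \<rho>(2) by (simp add: z_def)
    finally have "norm (C - \<alpha> *\<^sub>R ?n) < z" by (rule power2_less_imp_less) (use z in auto)
    then show "norm (c - p - \<alpha> *\<^sub>R ?n) < z" by (simp add: C_def)
  qed
  have "closed {(c, \<sigma>). norm (p - \<sigma> *\<^sub>R ?n - c) \<le> \<alpha>}"
    unfolding case_prod_unfold by (intro closed_Collect_le continuous_intros)
  moreover have "closed {(c, \<sigma>::real). \<forall>x\<in>X. \<alpha> \<le> dist c x}"
  proof -
    have "{(c, \<sigma>::real). \<forall>x\<in>X. \<alpha> \<le> dist c x} = (\<Inter>x\<in>X. {y. \<alpha> \<le> dist (fst y) x})" by auto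
    moreover have "closed {y::(real^2) \<times> real. \<alpha> \<le> dist (fst y) x}" for x
      by (intro closed_Collect_le continuous_intros)
    ultimately show ?thesis by (simp add: closed_INT)
  qed
  moreover have "compact (cball (p + \<alpha> *\<^sub>R ?n) z \<times> {0..z / 4})" by (intro compact_Times) auto
  moreover have "F = (cball (p + \<alpha> *\<^sub>R ?n) z \<times> {0..z / 4}) \<inter>
      ({(c, \<sigma>). norm (p - \<sigma> *\<^sub>R ?n - c) \<le> \<alpha>} \<inter> {(c, \<sigma>). \<forall>x\<in>X. \<alpha> \<le> dist c x})"
    by (auto simp: F_def)
  ultimately have "compact F" by (simp only: compact_Int_closed closed_Int)
  moreover have "(p + \<alpha> *\<^sub>R ?n, 0) \<in> F"
  proof -
    have "\<alpha> \<le> dist (p + \<alpha> *\<^sub>R ?n) x" if "x \<in> X" for x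
    proof -
      have "r \<le> norm (x - p - r *\<^sub>R ?n)" using outer_ball(1)[OF p(1)] that X by auto
      also have "x - p - r *\<^sub>R ?n = (x - p - \<alpha> *\<^sub>R ?n) - (r - \<alpha>) *\<^sub>R ?n" by (simp add: algebra_simps)
      also have "norm \<dots> \<le> norm (x - p - \<alpha> *\<^sub>R ?n) + (r - \<alpha>)"
        using norm_triangle_ineq4[of "x - p - \<alpha> *\<^sub>R ?n" "(r - \<alpha>) *\<^sub>R ?n"] n \<alpha> by simp
      finally show ?thesis by (simp add: dist_norm norm_minus_commute algebra_simps)
    qed
    then show ?thesis using z n \<alpha> by (simp add: F_def)
  qed
  ultimately obtain c \<sigma> where c\<sigma>: "(c, \<sigma>) \<in> F" and max: "\<And>c' \<sigma>'. (c', \<sigma>') \<in> F \<Longrightarrow> \<sigma>' \<le> \<sigma>"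
    using continuous_attains_sup[of F snd] by (fastforce intro: continuous_intros)
  \<comment> \<open>Proved for every feasible centre at the maximal depth, because
    \<open>side\<close> contradicts it for a displaced one.\<close>
  have tight: "norm (p - \<sigma> *\<^sub>R ?n - c') = \<alpha>" if "(c', \<sigma>) \<in> F" for c'
  proof (rule ccontr)
    assume "norm (p - \<sigma> *\<^sub>R ?n - c') \<noteq> \<alpha>"
    then have lt: "norm (p - \<sigma> *\<^sub>R ?n - c') < \<alpha>" using that by (simp add: F_def)
    define e where "e = min (\<alpha> - norm (p - \<sigma> *\<^sub>R ?n - c')) (z / 4 - \<sigma>)"
    have e: "0 < e" using lt feas(1)[OF that] by (simp add: e_def)
    have "p - (\<sigma> + e) *\<^sub>R ?n - c' = (p - \<sigma> *\<^sub>R ?n - c') - e *\<^sub>R ?n" by (simp add: algebra_simps)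
    moreover have "norm ((p - \<sigma> *\<^sub>R ?n - c') - e *\<^sub>R ?n) \<le> norm (p - \<sigma> *\<^sub>R ?n - c') + e"
      using norm_triangle_ineq4[of "p - \<sigma> *\<^sub>R ?n - c'" "e *\<^sub>R ?n"] n e by simp
    ultimately have "norm (p - (\<sigma> + e) *\<^sub>R ?n - c') \<le> norm (p - \<sigma> *\<^sub>R ?n - c') + e" by metis
    also have "\<dots> \<le> \<alpha>" by (simp add: e_def)
    finally have "(c', \<sigma> + e) \<in> F"
      using that e min.cobounded2[of "\<alpha> - norm (p - \<sigma> *\<^sub>R ?n - c')" "z / 4 - \<sigma>", folded e_def]
      by (auto simp: F_def)
    then show False using max[of c' "\<sigma> + e"] e by simp
  qed
  have empty: "\<alpha> \<le> dist c x" if "x \<in> X" for x using c\<sigma> that by (auto simp: F_def)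
  define T where "T = {x\<in>X. dist c x = \<alpha>}"
  define Q where "Q = p - \<sigma> *\<^sub>R ?n - c"
  have Q: "norm Q = \<alpha>" unfolding Q_def by (rule tight[OF c\<sigma>])
  have \<sigma>0: "0 \<le> \<sigma>" using c\<sigma> by (simp add: F_def)
  have Qn: "Q \<bullet> ?n < 0"
    using feas(3)[OF c\<sigma>] \<sigma>0 nn by (simp add: Q_def inner_diff_left)
  have Qt: "Q \<bullet> ?t = (p - c) \<bullet> ?t" by (simp add: Q_def inner_diff_left)
  \<comment> \<open>Contact points are outside the outer ball at p but on a sphere nearly tangent to
    it from within, so they lie near the bottom of the sphere.\<close>
  have w: "(x - c) \<bullet> ?n \<le> - \<alpha> + r * z / (r - \<alpha>)" if "x \<in> T" for x
  proof -
    define W where "W = x - c"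
    have W: "norm W = \<alpha>" using that by (simp add: W_def T_def dist_norm norm_minus_commute)
    have "r \<le> norm (x - p - r *\<^sub>R ?n)" using outer_ball(1)[OF p(1)] that X by (auto simp: T_def)
    also have "x - p - r *\<^sub>R ?n = (W - (r - \<alpha>) *\<^sub>R ?n) + (c - p - \<alpha> *\<^sub>R ?n)"
      by (simp add: W_def algebra_simps)
    also have "norm \<dots> \<le> norm (W - (r - \<alpha>) *\<^sub>R ?n) + z"
      using norm_triangle_ineq[of "W - (r - \<alpha>) *\<^sub>R ?n" "c - p - \<alpha> *\<^sub>R ?n"] feas(2)[OF c\<sigma>] by linarith
    finally have "r - z \<le> norm (W - (r - \<alpha>) *\<^sub>R ?n)" by simp
    moreover have "0 \<le> r - z"
    proof -
      have "\<alpha> * (r - \<alpha>) \<le> r * r" using \<alpha> by (intro mult_mono) auto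
      then have "r * z < r * r" using \<zeta>(2) unfolding z_def by linarith
      then show ?thesis using r_pos by simp
    qed
    ultimately have "(r - z)\<^sup>2 \<le> (norm (W - (r - \<alpha>) *\<^sub>R ?n))\<^sup>2" by (intro power_mono)
    also have "\<dots> = \<alpha>\<^sup>2 - 2 * (r - \<alpha>) * (W \<bullet> ?n) + (r - \<alpha>)\<^sup>2"
      using n W \<alpha> by (simp add: norm_minus_sq[of W])
    finally have "z * z + 2 * ((r - \<alpha>) * (W \<bullet> ?n)) \<le> 2 * ((r - \<alpha>) * (- \<alpha>) + r * z)"
      by (simp add: power2_eq_square algebra_simps)
    then have "(r - \<alpha>) * (W \<bullet> ?n) \<le> (r - \<alpha>) * (- \<alpha>) + r * z"
      using zero_le_square[of z] by argo
    then show ?thesis using \<alpha> by (simp add: W_def field_simps)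
  qed
  \<comment> \<open>The bound on \<open>r * \<zeta>\<^sup>2\<close> thus puts all contact points on
    the lower half of the sphere.\<close>
  have rz: "r * z / (r - \<alpha>) < \<alpha>" using \<zeta>(2) \<alpha> by (simp add: z_def field_simps)
  have low: "(x - c) \<bullet> ?n < 0" if "x \<in> T" for x using w[OF that] rz by linarith
  have near: "norm (x - p) < r" if "x \<in> T" for x
  proof -
    have W: "norm (x - c) = \<alpha>" using that by (simp add: T_def dist_norm norm_minus_commute)
    have "(norm ((x - c) + \<alpha> *\<^sub>R ?n))\<^sup>2 = 2 * \<alpha>\<^sup>2 + 2 * \<alpha> * ((x - c) \<bullet> ?n)"
      using W n \<alpha> by (simp add: norm_plus_sq[of "x - c"])
    also have "\<dots> \<le> 2 * \<alpha>\<^sup>2 + 2 * \<alpha> * (- \<alpha> + r * z / (r - \<alpha>))"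
      using w[OF that] \<alpha> by (intro add_left_mono mult_left_mono) auto
    also have "\<dots> = (2 * \<alpha> * r / (r - \<alpha>)) * z" by (simp add: power2_eq_square algebra_simps)
    also have "\<dots> \<le> K\<^sup>2 * z" using K z by (intro mult_right_mono) auto
    also have "\<dots> = (K * \<zeta>)\<^sup>2" by (simp add: z_def power_mult_distrib)
    finally have "norm ((x - c) + \<alpha> *\<^sub>R ?n) \<le> K * \<zeta>"
      by (rule power2_le_imp_le) (use K \<zeta> in simp)
    moreover have "x - p = ((x - c) + \<alpha> *\<^sub>R ?n) + (c - p - \<alpha> *\<^sub>R ?n)" by simp
    ultimately show ?thesis
      using norm_triangle_ineq[of "(x - c) + \<alpha> *\<^sub>R ?n" "c - p - \<alpha> *\<^sub>R ?n"] feas(2)[OF c\<sigma>] \<zeta>(3)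
      unfolding z_def by (smt (verit))
  qed
  \<comment> \<open>Excludes contact points on the normal line, since p is not the projection of a
    sample point, and later identifies the crossing point of the edge.\<close>
  have on_normal: "proj u = p" if "norm (u - p) < r" "(u - p) \<bullet> ?t = 0" for u
  proof -
    have "u - p = ((u - p) \<bullet> ?n) *\<^sub>R ?n"
      using that(2) nn by (intro eq_of_frame[OF n]) auto
    then have "u = p + ((u - p) \<bullet> ?n) *\<^sub>R ?n" by (metis add.commute diff_add_cancel)
    moreover have "\<bar>(u - p) \<bullet> ?n\<bar> < r"
      using Cauchy_Schwarz_ineq2[of "u - p" ?n] n that(1) by simp
    ultimately show ?thesis using proj_unique[OF p(1)] by metis
  qed
  have side: "\<exists>x\<in>T. s * ((x - p) \<bullet> ?t) < 0" if s: "s = 1 \<or> s = -1" for s :: real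
  proof (rule ccontr)
    assume neg: "\<not> ?thesis"
    have right: "0 < s * ((x - p) \<bullet> ?t)" if x: "x \<in> T" for x
    proof -
      have "(x - p) \<bullet> ?t \<noteq> 0" using on_normal[OF near[OF x]] x p(2) by (auto simp: T_def)
      then have "s * ((x - p) \<bullet> ?t) \<noteq> 0" using s by auto
      then show ?thesis using neg x by (meson linorder_neqE_linordered_idom)
    qed
    have "finite T" using X by (simp add: T_def)
    \<comment> \<open>A direction that brings the centre closer to the deepest point but to no
      contact point. Without contacts it is Q itself; otherwise it is perpendicular to x0 - c for
      the contact x0 nearest to the normal line, which to first order turns the ball about
      x0.\<close>
    obtain v where v: "0 < v \<bullet> Q" "\<And>x. x \<in> T \<Longrightarrow> v \<bullet> (x - c) \<le> 0"
    proof (cases "T = {}")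
      case True
      have "0 < Q \<bullet> Q" using Q \<alpha> by auto
      then show thesis using that[of Q] True by auto
    next
      case False
      then obtain x0 where x0: "x0 \<in> T" and mn: "\<And>x. x \<in> T \<Longrightarrow> s * (x0 \<bullet> ?t) \<le> s * (x \<bullet> ?t)"
        using ex_is_arg_min_if_finite[OF \<open>finite T\<close>, of "\<lambda>x. s * (x \<bullet> ?t)"]
        unfolding is_arg_min_linorder by auto
      have nT: "norm (x - c) = \<alpha>" if "x \<in> T" for x
        using that by (simp add: T_def dist_norm norm_minus_commute)
      have Q0: "s * (Q \<bullet> ?t) < s * ((x0 - c) \<bullet> ?t)"
        using right[OF x0] unfolding Qt by (simp add: inner_diff_left algebra_simps)
      have "s * ((x0 - c) \<bullet> perp Q) < 0"
        using perp_inner_lower_arc_signed[OF n _ Qn low[OF x0] s Q0] Q nT[OF x0] by simp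
      moreover have "(x0 - c) \<bullet> perp Q = - (perp (x0 - c) \<bullet> Q)"
        by (simp add: perp_def inner_vec_def sum_2 algebra_simps)
      ultimately have v1: "0 < (s *\<^sub>R perp (x0 - c)) \<bullet> Q" by simp
      have v2: "(s *\<^sub>R perp (x0 - c)) \<bullet> (x - c) \<le> 0" if x: "x \<in> T" for x
      proof (cases "s * (x0 \<bullet> ?t) = s * (x \<bullet> ?t)")
        case True
        then have te: "(x0 - c) \<bullet> ?t = (x - c) \<bullet> ?t" using s by (auto simp: inner_diff_left)
        then have "((x0 - c) \<bullet> ?n)\<^sup>2 = ((x - c) \<bullet> ?n)\<^sup>2"
          using norm_frame[OF n, of "x0 - c"] norm_frame[OF n, of "x - c"] nT[OF x] nT[OF x0] by simp
        then have "(x0 - c) \<bullet> ?n = (x - c) \<bullet> ?n"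
          using low[OF x] low[OF x0] by (simp add: power2_eq_iff)
        then have "x0 - c = x - c" using te by (intro eq_of_frame[OF n])
        then show ?thesis by simp
      next
        case False
        then have "s * (x0 \<bullet> ?t) < s * (x \<bullet> ?t)" using mn[OF x] by (rule order.not_eq_order_implies_strict)
        then have "s * ((x0 - c) \<bullet> ?t) < s * ((x - c) \<bullet> ?t)"
          by (simp add: inner_diff_left right_diff_distrib)
        then have "s * ((x - c) \<bullet> perp (x0 - c)) < 0"
          using perp_inner_lower_arc_signed[OF n _ low[OF x0] low[OF x] s] nT[OF x] nT[OF x0] by simp
        then show ?thesis by (simp add: inner_commute)
      qed
      show thesis by (rule that[OF v1 v2])
    qed
    have lim: "((\<lambda>e. c + e *\<^sub>R v) \<longlongrightarrow> c) (at_right 0)"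
      by (auto intro!: tendsto_eq_intros)
    have "((\<lambda>e. norm (c + e *\<^sub>R v - p - \<alpha> *\<^sub>R ?n)) \<longlongrightarrow> norm (c - p - \<alpha> *\<^sub>R ?n)) (at_right 0)"
      by (intro tendsto_intros lim)
    then have ev1: "\<forall>\<^sub>F e in at_right 0. norm (c + e *\<^sub>R v - p - \<alpha> *\<^sub>R ?n) < z"
      using feas(2)[OF c\<sigma>] by (rule order_tendstoD)
    have ev2: "\<forall>\<^sub>F e in at_right 0. \<forall>x\<in>X - T. \<alpha> < dist (c + e *\<^sub>R v) x"
    proof (rule eventually_ball_finite)
      show "\<forall>x\<in>X - T. \<forall>\<^sub>F e in at_right 0. \<alpha> < dist (c + e *\<^sub>R v) x"
      proof
        fix x assume x: "x \<in> X - T"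
        have "((\<lambda>e. dist (c + e *\<^sub>R v) x) \<longlongrightarrow> dist c x) (at_right 0)"
          by (intro tendsto_intros lim)
        moreover have "\<alpha> < dist c x" using empty[of x] x by (auto simp: T_def)
        ultimately show "\<forall>\<^sub>F e in at_right 0. \<alpha> < dist (c + e *\<^sub>R v) x" by (rule order_tendstoD)
      qed
    qed (use X in simp)
    have "((\<lambda>e. e * (norm v)\<^sup>2) \<longlongrightarrow> 0) (at_right 0)" by (auto intro!: tendsto_eq_intros)
    then have ev3: "\<forall>\<^sub>F e in at_right 0. e * (norm v)\<^sup>2 < v \<bullet> Q"
      using v(1) by (rule order_tendstoD)
    have "\<forall>\<^sub>F e in at_right (0::real). 0 < e" by (simp add: eventually_at_right_less)
    with ev1 ev2 ev3 have "\<forall>\<^sub>F e in at_right 0. norm (c + e *\<^sub>R v - p - \<alpha> *\<^sub>R ?n) < z \<and>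
        (\<forall>x\<in>X - T. \<alpha> < dist (c + e *\<^sub>R v) x) \<and> e * (norm v)\<^sup>2 < v \<bullet> Q \<and> 0 < e"
      by eventually_elim auto
    then obtain e where e: "norm (c + e *\<^sub>R v - p - \<alpha> *\<^sub>R ?n) < z"
        "\<And>x. x \<in> X - T \<Longrightarrow> \<alpha> < dist (c + e *\<^sub>R v) x" "e * (norm v)\<^sup>2 < v \<bullet> Q" "0 < e"
      using eventually_happens' trivial_limit_at_right_real by (metis (mono_tags, lifting))
    \<comment> \<open>The second-order term only increases the distance, so not approaching x to
      first order suffices.\<close>
    have eT: "\<alpha> \<le> dist (c + e *\<^sub>R v) x" if x: "x \<in> T" for x
    proof -
      have "(norm ((x - c) - e *\<^sub>R v))\<^sup>2 = \<alpha>\<^sup>2 - 2 * (e * (v \<bullet> (x - c))) + (e * norm v)\<^sup>2"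
        using x e(4) by (simp add: norm_minus_sq[of "x - c"] T_def dist_norm norm_minus_commute[of c] inner_commute)
      moreover have "e * (v \<bullet> (x - c)) \<le> 0" using v(2)[OF x] e(4) by (simp add: mult_nonneg_nonpos)
      ultimately have "\<alpha>\<^sup>2 \<le> (norm ((x - c) - e *\<^sub>R v))\<^sup>2" using zero_le_power2[of "e * norm v"] by linarith
      then have "\<alpha> \<le> norm ((x - c) - e *\<^sub>R v)" by (rule power2_le_imp_le) simp
      then show ?thesis by (simp add: dist_norm norm_minus_commute algebra_simps)
    qed
    have "(norm (Q - e *\<^sub>R v))\<^sup>2 = \<alpha>\<^sup>2 - 2 * (e * (v \<bullet> Q)) + e * (e * (norm v)\<^sup>2)"
      using Q e(4) by (simp add: norm_minus_sq[of Q] inner_commute power_mult_distrib power2_eq_square[of e])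
    also have "e * (e * (norm v)\<^sup>2) < e * (v \<bullet> Q)" using e by simp
    finally have "(norm (Q - e *\<^sub>R v))\<^sup>2 < \<alpha>\<^sup>2" using e(4) v(1) mult_pos_pos[of e "v \<bullet> Q"] by linarith
    then have lt: "norm (Q - e *\<^sub>R v) < \<alpha>" by (rule power2_less_imp_less) (use \<alpha> in auto)
    have QQ: "p - \<sigma> *\<^sub>R ?n - (c + e *\<^sub>R v) = Q - e *\<^sub>R v" by (simp add: Q_def)
    have "\<forall>x\<in>X. \<alpha> \<le> dist (c + e *\<^sub>R v) x" using e(2) eT by force
    moreover have "dist (p + \<alpha> *\<^sub>R ?n) (c + e *\<^sub>R v) \<le> z"
      using e(1) by (simp add: dist_norm norm_minus_commute diff_diff_eq)
    moreover have "norm (p - \<sigma> *\<^sub>R ?n - (c + e *\<^sub>R v)) \<le> \<alpha>" using lt unfolding QQ by simp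
    ultimately have "(c + e *\<^sub>R v, \<sigma>) \<in> F" using c\<sigma> unfolding F_def by simp
    then show False using tight lt QQ by fastforce
  qed
  obtain x where x: "x \<in> T" "(x - p) \<bullet> ?t < 0" using side[of 1] by auto
  obtain y where y: "y \<in> T" "0 < (y - p) \<bullet> ?t" using side[of "-1"] by auto
  have edge: "alpha_edge \<alpha> X x y"
    unfolding alpha_edge_def
  proof (intro conjI exI[of _ c])
    show "x \<noteq> y" using x y by auto
    show "ball c \<alpha> \<inter> X = {}" using empty by (force simp: disjoint_iff)
  qed (use x y \<alpha> in \<open>auto simp: T_def\<close>)
  define a where "a = - ((x - p) \<bullet> ?t)"
  define b where "b = (y - p) \<bullet> ?t"
  have ab: "0 < a" "0 < b" using x y by (auto simp: a_def b_def)
  \<comment> \<open>Chosen so that u is the point where the edge crosses the normal line.\<close>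
  define l where "l = a / (a + b)"
  have l: "0 \<le> l" "l \<le> 1" using ab by (auto simp: l_def)
  define u where "u = (1 - l) *\<^sub>R x + l *\<^sub>R y"
  have u: "u \<in> closed_segment x y" using l by (auto simp: in_segment u_def)
  have "closed_segment x y \<subseteq> ball p r"
    using near[OF x(1)] near[OF y(1)] by (intro closed_segment_subset) (auto simp: dist_norm norm_minus_commute)
  then have ur: "norm (u - p) < r" using u by (auto simp: dist_norm norm_minus_commute)
  have "u - p = (1 - l) *\<^sub>R (x - p) + l *\<^sub>R (y - p)" by (simp add: u_def algebra_simps)
  then have "(u - p) \<bullet> ?t = (1 - l) * (- a) + l * b" by (simp add: inner_add_left a_def b_def)
  also have "\<dots> = 0" using ab by (simp add: l_def field_simps)
  finally have "proj u = p" using on_normal[OF ur] by simp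
  moreover have "u \<in> alpha_shape \<alpha> X" using edge u by (auto simp: alpha_shape_def)
  ultimately show ?thesis by force
qed

end

section \<open>Caps and perimeters\<close>

lemma orthogonal_frame:
  fixes n :: "real^2"
  assumes "norm n = 1"
  shows "orthogonal_transformation (\<lambda>z::real^2. z $ 1 *\<^sub>R perp n + z $ 2 *\<^sub>R n)"
  unfolding orthogonal_transformation
proof
  show "linear (\<lambda>z::real^2. z $ 1 *\<^sub>R perp n + z $ 2 *\<^sub>R n)"
    by (rule linearI) (simp_all add: algebra_simps scaleR_add_left)
  show "\<forall>v::real^2. norm (v $ 1 *\<^sub>R perp n + v $ 2 *\<^sub>R n) = norm v"
  proof
    fix v :: "real^2"
    have "(norm (v $ 1 *\<^sub>R perp n + v $ 2 *\<^sub>R n))\<^sup>2 = (v $ 1)\<^sup>2 + (v $ 2)\<^sup>2"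
      using assms by (simp add: norm_plus_sq)
    also have "\<dots> = (norm v)\<^sup>2"
      unfolding power2_norm_eq_inner inner_vec_def[of v] sum_2 by (simp add: power2_eq_square)
    finally show "norm (v $ 1 *\<^sub>R perp n + v $ 2 *\<^sub>R n) = norm v"
      by (rule power2_eq_imp_eq) auto
  qed
qed

lemma emeasure_ge_rectangle:
  fixes n b :: "real^2"
  assumes n: "norm n = 1" and a: "0 \<le> a" and h: "0 \<le> h" and A: "A \<in> sets lborel"
    and sub: "\<And>z. \<lbrakk>\<bar>(z - b) \<bullet> perp n\<bar> \<le> a; - h / 2 \<le> (z - b) \<bullet> n; (z - b) \<bullet> n \<le> - h / 4\<rbrakk> \<Longrightarrow> z \<in> A"
  shows "ennreal (a * h / 2) \<le> emeasure lborel A"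
proof -
  let ?f = "\<lambda>z::real^2. z $ 1 *\<^sub>R perp n + z $ 2 *\<^sub>R n"
  define Q where "Q = cbox (vector [-a, -h/2]) (vector [a, -h/4] :: real^2)"
  define R where "R = (+) b ` ?f ` Q"
  have ot: "orthogonal_transformation ?f" by (rule orthogonal_frame[OF n])
  have lin: "linear ?f" using ot by (rule orthogonal_transformation_linear)
  have "compact R" unfolding R_def Q_def
    by (intro compact_translation compact_continuous_image linear_continuous_on lin compact_cbox)
      (use lin linear_conv_bounded_linear in blast)
  then have R: "R \<in> sets lborel" "emeasure lborel R < top"
    using emeasure_bounded_finite[of R] by (auto intro: borel_compact compact_imp_bounded simp: less_top)
  have nn: "n \<bullet> n = 1" "perp n \<bullet> perp n = 1" using n by (simp_all add: norm_eq_1[symmetric])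
  have "R \<subseteq> A"
  proof
    fix z assume "z \<in> R"
    then obtain v where v: "v \<in> Q" "z = b + ?f v" by (auto simp: R_def)
    have "(z - b) \<bullet> perp n = v $ 1" "(z - b) \<bullet> n = v $ 2"
      using nn by (simp_all add: v inner_add_left)
    moreover have "\<bar>v $ 1\<bar> \<le> a" "- h / 2 \<le> v $ 2" "v $ 2 \<le> - h / 4"
      using v(1) by (auto simp: Q_def mem_box_cart forall_2 abs_le_iff)
    ultimately show "z \<in> A" using sub by simp
  qed
  have ne: "Q \<noteq> {}" using a h unfolding Q_def interval_ne_empty_cart by (simp add: forall_2)
  have "measure lebesgue R = measure lebesgue (?f ` Q)" by (simp add: R_def measure_translation)
  also have "\<dots> = measure lebesgue Q"
    by (intro measure_orthogonal_image[OF ot]) (simp add: Q_def)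
  also have "\<dots> = 2 * a * (h / 4)"
    using ne unfolding Q_def by (subst measure_completion) (auto simp: content_cbox_cart prod_2 UNIV_2)
  finally have "measure lborel R = a * h / 2" using R by (simp add: measure_completion)
  then have "ennreal (a * h / 2) = emeasure lborel R"
    using R(2) by (metis emeasure_eq_ennreal_measure less_top)
  also have "\<dots> \<le> emeasure lborel A" using \<open>R \<subseteq> A\<close> A by (rule emeasure_mono)
  finally show ?thesis .
qed

context rolling_set
begin

text \<open>A rectangle of half-width a, of order sqrt (\<alpha> * h), at depths between h / 4 and h
  / 2 fits into the ball, which dips to depth h, and into the inner tangent ball: over that width
  both bend by only a fraction of h. Its area is of order \<eta>^3.\<close>

lemma cap_area:
  assumes \<alpha>: "0 < \<alpha>" "\<alpha> < r" and \<eta>: "0 < \<eta>" "\<eta>\<^sup>2 \<le> \<alpha> / 2" and c: "infdist c S \<le> \<alpha> - \<eta>\<^sup>2"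
  shows "ennreal (sqrt \<alpha> / 4 * \<eta>^3) \<le> emeasure lborel (ball c \<alpha> \<inter> S)"
proof -
  define h where "h = \<eta>\<^sup>2"
  have h: "0 < h" "h \<le> \<alpha> / 2" using \<eta> by (auto simp: h_def)
  define a where "a = sqrt \<alpha> / 2 * \<eta>"
  have a: "0 \<le> a" "a\<^sup>2 = \<alpha> * h / 4"
    using \<alpha> \<eta> by (auto simp: a_def h_def power_mult_distrib power_divide)
  have area: "sqrt \<alpha> / 4 * \<eta>^3 = a * h / 2"
    by (simp add: a_def h_def power2_eq_square power3_eq_cube)
  have A: "ball c \<alpha> \<inter> S \<in> sets lborel" using closed_S by auto
  have hh: "h * h \<le> h * (\<alpha> / 2)" using h by (intro mult_left_mono) auto
  have ha: "0 < h * \<alpha>" using h \<alpha> by simp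
  let ?p = "proj c" and ?d = "dist c (proj c)"
  let ?n = "nrm ?p"
  have p: "?p \<in> frontier S" by (rule proj_frontier)
  note n = nrm(1)[OF p]
  have nn: "?n \<bullet> ?n = 1" using n by (simp add: norm_eq_1)
  \<comment> \<open>d is the signed height of the centre: this covers centres outside S and those at
    most \<alpha> / 2 inside.\<close>
  have at_p: "ennreal (a * h / 2) \<le> emeasure lborel (ball c \<alpha> \<inter> S)"
    if d: "c = ?p + d *\<^sub>R ?n" "- \<alpha> / 2 \<le> d" "d \<le> \<alpha> - h" for d
  proof (rule emeasure_ge_rectangle[OF n a(1) _ A, of h ?p])
    fix z assume z: "\<bar>(z - ?p) \<bullet> perp ?n\<bar> \<le> a" "- h / 2 \<le> (z - ?p) \<bullet> ?n" "(z - ?p) \<bullet> ?n \<le> - h / 4"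
    define z1 where "z1 = (z - ?p) \<bullet> perp ?n"
    define z2 where "z2 = (z - ?p) \<bullet> ?n"
    have "\<bar>z1\<bar>\<^sup>2 \<le> a\<^sup>2" using z unfolding z1_def by (intro power_mono) auto
    then have z1: "z1\<^sup>2 \<le> \<alpha> * h / 4" using a by simp
    have "\<bar>z2 - d\<bar>\<^sup>2 \<le> (\<alpha> - h / 2)\<^sup>2" using z d h unfolding z2_def by (intro power_mono) auto
    then have "(z2 - d)\<^sup>2 \<le> \<alpha>\<^sup>2 - \<alpha> * h + h * h / 4" by (simp add: power2_eq_square algebra_simps)
    moreover have eq1: "(norm (z - c))\<^sup>2 = (z2 - d)\<^sup>2 + z1\<^sup>2"
    proof -
      have "z - c = (z - ?p) - d *\<^sub>R ?n" using d(1) by (simp add: algebra_simps)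
      then have "(z - c) \<bullet> ?n = z2 - d" "(z - c) \<bullet> perp ?n = z1"
        using nn unfolding z1_def z2_def by (simp_all only: inner_diff_left inner_scaleR_left inner_perp_self)
      then show ?thesis using norm_frame[OF n, of "z - c"] by simp
    qed
    ultimately have "(norm (z - c))\<^sup>2 < \<alpha>\<^sup>2" using z1 hh ha by (simp add: mult.commute[of \<alpha>])
    then have "norm (z - c) < \<alpha>" by (rule power2_less_imp_less) (use \<alpha> in auto)
    then have zc: "z \<in> ball c \<alpha>" by (simp add: dist_norm norm_minus_commute)
    have "(z2 + r)\<^sup>2 \<le> (r - h / 4)\<^sup>2" using z h \<alpha> unfolding z2_def by (intro power_mono) auto
    then have "(z2 + r)\<^sup>2 \<le> r\<^sup>2 - r * h / 2 + h * h / 16" by (simp add: power2_eq_square algebra_simps)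
    moreover have "(norm (z - (?p - r *\<^sub>R ?n)))\<^sup>2 = (z2 + r)\<^sup>2 + z1\<^sup>2"
    proof -
      have "z - (?p - r *\<^sub>R ?n) = (z - ?p) + r *\<^sub>R ?n" by (simp add: algebra_simps)
      then have "(z - (?p - r *\<^sub>R ?n)) \<bullet> ?n = z2 + r" "(z - (?p - r *\<^sub>R ?n)) \<bullet> perp ?n = z1"
        using nn unfolding z1_def z2_def by (simp_all only: inner_add_left inner_scaleR_left inner_perp_self)
      then show ?thesis using norm_frame[OF n, of "z - (?p - r *\<^sub>R ?n)"] by simp
    qed
    moreover have "\<alpha> * h < r * h" using \<alpha> h by simp
    ultimately have "(norm (z - (?p - r *\<^sub>R ?n)))\<^sup>2 < r\<^sup>2" using z1 hh ha by (simp add: mult.commute[of \<alpha>] mult.commute[of r])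
    then have "norm (z - (?p - r *\<^sub>R ?n)) < r" by (rule power2_less_imp_less) (use r_pos in auto)
    then have "z \<in> ball (?p - r *\<^sub>R ?n) r" by (simp add: dist_norm norm_minus_commute)
    then show "z \<in> ball c \<alpha> \<inter> S" using zc nrm(3)[OF p] by auto
  qed (use h in auto)
  show ?thesis
    unfolding area
  proof (cases "c \<in> S")
    case False
    obtain y where y: "y \<in> S" "infdist c S = dist c y"
      using infdist_attains_inf[OF closed_S S_nonempty] by blast
    have "0 < ?d" using False frontier_sub[OF p] by auto
    then have "ball c ?d \<inter> S = {}"
      using connected_Int_frontier[of "ball c ?d" S] ball_proj_disjoint[of c] False
        centre_in_ball[of c ?d] by blast
    then have "?d \<le> dist c y" using y(1) by (auto simp: disjoint_iff not_less)
    then have "?d \<le> \<alpha> - h" using y c by (simp add: h_def)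
    then show "ennreal (a * h / 2) \<le> emeasure lborel (ball c \<alpha> \<inter> S)"
      using at_p[of ?d] proj_normal_outside[OF False] \<alpha> zero_le_dist[of c ?p] by linarith
  next
    case True
    show "ennreal (a * h / 2) \<le> emeasure lborel (ball c \<alpha> \<inter> S)"
    proof (cases "?d \<le> \<alpha> / 2")
      case d: True
      show ?thesis
        using at_p[of "- ?d"] proj_normal_inside[OF True] d h zero_le_dist[of c ?p] \<alpha> by simp
    next
      \<comment> \<open>A deep centre: the ball of radius \<alpha> / 2 about c lies in S, so the
        rectangle can be placed at c itself.\<close>
      case d: False
      show ?thesis
      proof (rule emeasure_ge_rectangle[OF n a(1) _ A, of h c])
        fix z assume z: "\<bar>(z - c) \<bullet> perp ?n\<bar> \<le> a" "- h / 2 \<le> (z - c) \<bullet> ?n" "(z - c) \<bullet> ?n \<le> - h / 4"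
        have "\<bar>(z - c) \<bullet> perp ?n\<bar>\<^sup>2 \<le> a\<^sup>2" using z by (intro power_mono) auto
        moreover have "\<bar>(z - c) \<bullet> ?n\<bar>\<^sup>2 \<le> (h / 2)\<^sup>2" using z h by (intro power_mono) auto
        moreover have "h * \<alpha> \<le> \<alpha> / 2 * \<alpha>" using h \<alpha> by (intro mult_right_mono) auto
        moreover have "0 < \<alpha> * \<alpha>" using \<alpha> by simp
        ultimately have "(norm (z - c))\<^sup>2 < (\<alpha> / 2)\<^sup>2"
          using norm_frame[OF n, of "z - c"] a(2) hh by (simp add: power2_eq_square mult.commute[of \<alpha> h])
        then have "norm (z - c) < \<alpha> / 2" by (rule power2_less_imp_less) (use \<alpha> in auto)
        then have "z \<in> ball c \<alpha>" "z \<in> ball c ?d"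
          using \<alpha> d by (auto simp: dist_norm norm_minus_commute)
        then show "z \<in> ball c \<alpha> \<inter> S" using ball_proj_inside[OF True] by auto
      qed (use h in auto)
    qed
  qed
qed

text \<open>A line parallel to the normal that meets the middle half of an inner ball must leave the
  bounded set S, hence crosses the frontier. The frontier therefore has a shadow of length
  r.\<close>

lemma hausdorff1_frontier_pos: "0 < hausdorff1 (frontier S)"
proof -
  obtain p where p: "p \<in> frontier S" using frontier_nonempty by auto
  let ?n = "nrm p"
  let ?t = "perp ?n"
  note n = nrm(1)[OF p]
  have tt: "?t \<bullet> ?t = 1" using n by (simp add: norm_eq_1[symmetric])
  define b where "b = p - r *\<^sub>R ?n"
  have "{b \<bullet> ?t - r / 2 .. b \<bullet> ?t + r / 2} \<subseteq> (\<lambda>z. z \<bullet> ?t) ` frontier S"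
  proof
    fix s assume s: "s \<in> {b \<bullet> ?t - r / 2 .. b \<bullet> ?t + r / 2}"
    define w where "w = b + (s - b \<bullet> ?t) *\<^sub>R ?t"
    have "dist b w = \<bar>s - b \<bullet> ?t\<bar>" using n by (simp add: w_def dist_norm)
    also have "\<dots> < r" using s r_pos by (auto simp: abs_less_iff)
    finally have wS: "w \<in> S" using nrm(3)[OF p] by (auto simp: b_def)
    have wt: "(w + l *\<^sub>R ?n) \<bullet> ?t = s" for l
      using tt by (simp add: w_def inner_add_left)
    obtain B where B: "\<And>x. x \<in> S \<Longrightarrow> norm x \<le> B"
      using compact_imp_bounded[OF compact_S] by (auto simp: bounded_iff)
    define l where "l = \<bar>B\<bar> + norm w + 1"
    have "norm (l *\<^sub>R ?n) = \<bar>B\<bar> + norm w + 1" using n by (simp add: l_def)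
    then have "B < norm (w + l *\<^sub>R ?n)"
      using norm_diff_ineq[of "l *\<^sub>R ?n" w] abs_ge_self[of B] unfolding add.commute[of w] by linarith
    then have out: "w + l *\<^sub>R ?n \<notin> S" using B by force
    let ?L = "closed_segment w (w + l *\<^sub>R ?n)"
    have "?L \<inter> frontier S \<noteq> {}"
      using wS out by (intro connected_Int_frontier) auto
    then obtain z where z: "z \<in> ?L" "z \<in> frontier S" by auto
    then obtain u where "z = (1 - u) *\<^sub>R w + u *\<^sub>R (w + l *\<^sub>R ?n)" by (auto simp: in_segment)
    then have "z = w + (u * l) *\<^sub>R ?n" by (simp add: algebra_simps)
    then have "z \<bullet> ?t = s" using wt by simp
    then show "s \<in> (\<lambda>z. z \<bullet> ?t) ` frontier S" using z by force
  qed
  then have "ennreal (b \<bullet> ?t + r / 2 - (b \<bullet> ?t - r / 2)) \<le> 2 * hausdorff1 (frontier S)"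
    using n by (intro hausdorff1_ge_shadow) auto
  then have "ennreal r \<le> 2 * hausdorff1 (frontier S)" by simp
  moreover have "0 < ennreal r" using r_pos by simp
  ultimately have "0 < 2 * hausdorff1 (frontier S)" by (rule order.strict_trans2[rotated])
  then show ?thesis by (simp add: ennreal_zero_less_mult_iff)
qed

end

section \<open>Two-sided comparison of the lengths\<close>

lemma hausdorff1_alpha_shape_finite:
  assumes "finite X"
  shows "hausdorff1 (alpha_shape \<alpha> X) < top"
  unfolding alpha_shape_def
proof (rule hausdorff1_finite_Union_segments)
  have "{closed_segment x y |x y. alpha_edge \<alpha> X x y} \<subseteq> (\<lambda>(x, y). closed_segment x y) ` (X \<times> X)"
    by (auto simp: alpha_edge_def)
  then show "finite {closed_segment x y |x y. alpha_edge \<alpha> X x y}"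
    using assms by (meson finite_SigmaI finite_imageI finite_subset)
qed auto

context alpha_sample
begin

lemma perimeter_ratio:
  assumes \<zeta>: "0 < \<zeta>" "r * \<zeta>\<^sup>2 < \<alpha> * (r - \<alpha>)" "K * \<zeta> + \<zeta>\<^sup>2 < r"
    and \<rho>: "0 < \<rho>" "8 * \<alpha> * \<rho> < \<zeta>^4" "8 * \<rho> < \<zeta>\<^sup>2" "4 * \<rho> < \<alpha>"
    and dense: "\<And>q. ball q \<rho> \<subseteq> S \<Longrightarrow> ball q \<rho> \<inter> X \<noteq> {}"
    and M: "M = 484 * K\<^sup>2 / \<alpha>\<^sup>2 + 2 * (K + 4 * K\<^sup>2 / r) / r" "M * \<eta>\<^sup>2 < 1"
  shows "\<bar>enn2real (hausdorff1 (alpha_shape \<alpha> X)) / enn2real (hausdorff1 (frontier S)) - 1\<bar> \<le> M * \<eta>\<^sup>2"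
proof -
  define C where "C = alpha_shape \<alpha> X"
  define H where "H = (K + 4 * K\<^sup>2 / r) * \<eta>\<^sup>2"
  have H0: "0 \<le> H" using K r_pos by (simp add: H_def)
  \<comment> \<open>484 is 22 squared, from \<open>slope\<close>. Of the two copies of H / r, one is
    the second factor of L and the other absorbs its mixed product with
    \<open>slope\<^sup>2\<close>.\<close>
  have Meq: "M * \<eta>\<^sup>2 = slope\<^sup>2 + 2 * (H / r)"
    by (simp add: M H_def slope_def algebra_simps power_mult_distrib power_divide add_divide_distrib)
  then have Hr: "H / r < 1/2" using M(2) zero_le_power2[of slope] by linarith
  then have Hr1: "0 < 1 - H / r" by linarith
  have Hr0: "0 \<le> H / r" using H0 r_pos by simp
  define L where "L = (1 + slope\<^sup>2) * (1 + H / r)"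
  have "slope\<^sup>2 \<le> 1" using slope by (simp add: abs_square_le_1)
  then have "slope\<^sup>2 * (H / r) \<le> 1 * (H / r)" using Hr0 by (intro mult_right_mono)
  then have L: "L \<le> 1 + M * \<eta>\<^sup>2" unfolding L_def Meq distrib_left distrib_right by simp
  have L0: "0 < L" unfolding L_def using Hr0 by (intro mult_pos_pos) (auto simp: add_pos_nonneg)
  have up: "hausdorff1 C \<le> ennreal L * hausdorff1 (frontier S)"
  \<comment> \<open>The projection read backwards, from the boundary to the \<alpha>-shape.\<close>
  proof (rule hausdorff1_relation_le[where R = "\<lambda>x y. x = proj y" and \<rho> = "\<eta>\<^sup>2"])
    show "norm (y - y') \<le> L * norm (x - x')"
      if "y \<in> C" "y' \<in> C" "x = proj y" "x' = proj y'" "norm (x - x') \<le> \<eta>\<^sup>2" for x x' y y'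
      using alpha_shape_expanding[of y y'] that by (simp add: C_def L_def H_def)
  qed (use L0 \<eta> proj_frontier in auto)
  have "frontier S \<subseteq> proj ` C \<union> proj ` X"
    using frontier_covered[OF \<alpha> K(2) _ X \<zeta> \<rho> dense] K(1) by (auto simp: C_def)
  then have "hausdorff1 (frontier S) \<le> hausdorff1 (proj ` C \<union> proj ` X)" by (rule hausdorff1_mono)
  also have "\<dots> \<le> hausdorff1 (proj ` C)" using X by (intro hausdorff1_union_finite_le) simp
  also have "\<dots> \<le> ennreal (1 / (1 - H / r)) * hausdorff1 C"
  proof (rule hausdorff1_relation_le[where R = "\<lambda>x y. y = proj x" and \<rho> = 1])
    show "norm (y - y') \<le> 1 / (1 - H / r) * norm (x - x')"
      if "x \<in> C" "x' \<in> C" "y = proj x" "y' = proj x'" for x x' y y'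
    proof -
      have "(1 - H / r) * norm (y - y') \<le> norm (x - x')"
        unfolding that(3,4) by (intro proj_lipschitz) (use alpha_shape_height that in \<open>auto simp: C_def H_def\<close>)
      then have "norm (y - y') \<le> norm (x - x') / (1 - H / r)" using Hr1 by (simp only: pos_le_divide_eq mult.commute)
      then show ?thesis by simp
    qed
  qed (use Hr1 in auto)
  finally have lo: "hausdorff1 (frontier S) \<le> ennreal (1 / (1 - H / r)) * hausdorff1 C" .
  have finC: "hausdorff1 C < top" unfolding C_def by (rule hausdorff1_alpha_shape_finite[OF X(1)])
  \<comment> \<open>Finiteness matters because \<open>enn2real\<close> sends infinity to 0. The
    boundary inherits it from the \<alpha>-shape through the projection.\<close>
  then have finS: "hausdorff1 (frontier S) < top"
    using lo by (meson ennreal_less_top ennreal_mult_less_top le_less_trans)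
  define P where "P = enn2real (hausdorff1 (frontier S))"
  define Q where "Q = enn2real (hausdorff1 C)"
  have P: "hausdorff1 (frontier S) = ennreal P" and Q: "hausdorff1 C = ennreal Q"
    using finC finS by (simp_all add: P_def Q_def)
  have Q0: "0 \<le> Q" by (simp add: Q_def)
  have P0: "0 < P" using hausdorff1_frontier_pos P by (simp add: ennreal_less_zero_iff)
  have "ennreal Q \<le> ennreal (L * P)" using up L0 P0 by (simp add: P Q ennreal_mult)
  then have "Q \<le> L * P" using L0 P0 by (simp add: ennreal_le_iff)
  then have "Q / P \<le> L" using P0 by (simp add: pos_divide_le_eq)
  moreover have "ennreal P \<le> ennreal (1 / (1 - H / r) * Q)" using lo Hr1 unfolding P Q by (subst ennreal_mult') auto
  then have "P \<le> 1 / (1 - H / r) * Q" using Q0 Hr1 by (subst (asm) ennreal_le_iff) auto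
  then have "P \<le> Q / (1 - H / r)" by simp
  then have "(1 - H / r) * P \<le> Q" using Hr1 by (simp only: pos_le_divide_eq mult.commute)
  then have "1 - H / r \<le> Q / P" using P0 by (simp add: pos_le_divide_eq)
  ultimately have "\<bar>Q / P - 1\<bar> \<le> M * \<eta>\<^sup>2"
    using L Meq Hr0 zero_le_power2[of slope] by (intro abs_leI) linarith+
  then show ?thesis by (simp add: P_def Q_def C_def)
qed

end

section \<open>Product measures and circles through two points\<close>

lemma outer_prob_le: "B \<in> sets M \<Longrightarrow> A \<inter> space M \<subseteq> B \<Longrightarrow> outer_prob M A \<le> emeasure M B"
  unfolding outer_prob_def by (intro INF_lower) auto

text \<open>Fubini in coordinates i and j: the two fixed values determine the candidate circle while
  the other coordinates remain independent, so a uniform conditional bound carries over.\<close>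

lemma emeasure_PiM_two_coordinates_le:
  fixes M :: "'a measure"
  assumes M: "prob_space M" and I: "finite I" "i \<in> I" "j \<in> I" "i \<noteq> j"
    and meas: "{X \<in> space (PiM I (\<lambda>_. M)). P X} \<in> sets (PiM I (\<lambda>_. M))"
    and le: "\<And>a b. \<lbrakk>a \<in> space M; b \<in> space M\<rbrakk> \<Longrightarrow>
      emeasure (PiM (I - {i, j}) (\<lambda>_. M)) {X \<in> space (PiM (I - {i, j}) (\<lambda>_. M)). P (X(j := b, i := a))} \<le> e"
  shows "emeasure (PiM I (\<lambda>_. M)) {X \<in> space (PiM I (\<lambda>_. M)). P X} \<le> e"
proof -
  interpret M: prob_space M by (rule M)
  interpret product_prob_space "\<lambda>_. M" UNIV ..
  define J where "J = I - {i, j}"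
  have IJ: "I = insert i (insert j J)" "finite J" "i \<notin> insert j J" "j \<notin> J" using I by (auto simp: J_def)
  let ?A = "{X \<in> space (PiM I (\<lambda>_. M)). P X}"
  have upd_i: "(\<lambda>x. x(i := a)) \<in> measurable (PiM (insert j J) (\<lambda>_. M)) (PiM I (\<lambda>_. M))"
    if "a \<in> space M" for a
    using that by (intro measurable_fun_upd[where J = "insert j J"]) (auto simp: IJ)
  have upd_j: "(\<lambda>x. x(j := b)) \<in> measurable (PiM J (\<lambda>_. M)) (PiM (insert j J) (\<lambda>_. M))"
    if "b \<in> space M" for b
    using that by (intro measurable_fun_upd[where J = J]) auto
  have ind: "indicator ?A \<in> borel_measurable (PiM I (\<lambda>_. M))" using meas by simp
  have inner: "(\<integral>\<^sup>+x. indicator ?A (x(j := b, i := a)) \<partial>PiM J (\<lambda>_. M)) \<le> e"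
    if ab: "a \<in> space M" "b \<in> space M" for a b
  proof -
    let ?g = "\<lambda>x. x(j := b, i := a)"
    have g: "?g \<in> measurable (PiM J (\<lambda>_. M)) (PiM I (\<lambda>_. M))"
      using measurable_comp[OF upd_j[OF ab(2)] upd_i[OF ab(1)]] by (simp add: comp_def)
    have "(\<integral>\<^sup>+x. indicator ?A (?g x) \<partial>PiM J (\<lambda>_. M)) =
        (\<integral>\<^sup>+x. indicator (?g -` ?A \<inter> space (PiM J (\<lambda>_. M))) x \<partial>PiM J (\<lambda>_. M))"
      by (intro nn_integral_cong) (auto simp: indicator_def)
    also have "\<dots> = emeasure (PiM J (\<lambda>_. M)) (?g -` ?A \<inter> space (PiM J (\<lambda>_. M)))"
      using measurable_sets[OF g meas] by (rule nn_integral_indicator)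
    also have "?g -` ?A \<inter> space (PiM J (\<lambda>_. M)) = {X \<in> space (PiM J (\<lambda>_. M)). P (?g X)}"
      using measurable_space[OF g] by auto
    finally have "(\<integral>\<^sup>+x. indicator ?A (?g x) \<partial>PiM J (\<lambda>_. M)) =
        emeasure (PiM J (\<lambda>_. M)) {X \<in> space (PiM J (\<lambda>_. M)). P (?g X)}" .
    then show ?thesis using le[OF ab] unfolding J_def by (simp only:)
  qed
  have "emeasure (PiM I (\<lambda>_. M)) ?A = (\<integral>\<^sup>+x. indicator ?A x \<partial>PiM I (\<lambda>_. M))"
    using meas by simp
  also have "\<dots> = (\<integral>\<^sup>+a. \<integral>\<^sup>+x. indicator ?A (x(i := a)) \<partial>PiM (insert j J) (\<lambda>_. M) \<partial>M)"
    by (rule product_nn_integral_insert_rev[of "insert j J" i "indicator ?A", folded IJ(1), OF _ IJ(3) ind])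
      (simp add: IJ(2))
  also have "\<dots> \<le> (\<integral>\<^sup>+a. e \<partial>M)"
  proof (rule nn_integral_mono)
    fix a assume a: "a \<in> space M"
    have "(\<integral>\<^sup>+x. indicator ?A (x(i := a)) \<partial>PiM (insert j J) (\<lambda>_. M)) =
        (\<integral>\<^sup>+b. \<integral>\<^sup>+x. indicator ?A (x(j := b, i := a)) \<partial>PiM J (\<lambda>_. M) \<partial>M)"
      using measurable_comp[OF upd_i[OF a] ind] IJ
      by (subst product_nn_integral_insert_rev) (auto simp: comp_def)
    also have "\<dots> \<le> (\<integral>\<^sup>+b. e \<partial>M)" using a by (intro nn_integral_mono inner)
    finally show "(\<integral>\<^sup>+x. indicator ?A (x(i := a)) \<partial>PiM (insert j J) (\<lambda>_. M)) \<le> e"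
      by (simp add: M.emeasure_space_1)
  qed
  finally show ?thesis by (simp add: M.emeasure_space_1)
qed

text \<open>Each point avoids A with probability at most exp (- q), by 1 - m <= exp (- m).\<close>

lemma emeasure_PiM_avoid_le:
  fixes M :: "'a measure"
  assumes M: "prob_space M" and J: "finite J" and A: "A \<in> sets M" "q \<le> measure M A"
  shows "emeasure (PiM J (\<lambda>_. M)) {X \<in> space (PiM J (\<lambda>_. M)). \<forall>k\<in>J. X k \<notin> A}
    \<le> ennreal (exp (- (real (card J) * q)))"
proof -
  interpret M: prob_space M by (rule M)
  interpret product_prob_space "\<lambda>_. M" UNIV ..
  have "{X \<in> space (PiM J (\<lambda>_. M)). \<forall>k\<in>J. X k \<notin> A} = Pi\<^sub>E J (\<lambda>_. space M - A)"
    by (auto simp: space_PiM PiE_def extensional_def Pi_iff)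
  then have "emeasure (PiM J (\<lambda>_. M)) {X \<in> space (PiM J (\<lambda>_. M)). \<forall>k\<in>J. X k \<notin> A}
      = emeasure M (space M - A) ^ card J"
    using A J by (simp add: emeasure_PiM)
  also have "\<dots> \<le> ennreal (exp (- q)) ^ card J"
  proof (rule power_mono)
    have "measure M (space M - A) = 1 - measure M A" using A by (simp add: M.prob_compl)
    also have "\<dots> \<le> exp (- measure M A)" using exp_ge_add_one_self[of "- measure M A"] by simp
    also have "\<dots> \<le> exp (- q)" using A by simp
    finally show "emeasure M (space M - A) \<le> ennreal (exp (- q))"
      by (simp add: M.emeasure_eq_measure ennreal_leI)
  qed simp
  also have "\<dots> = ennreal (exp (- (real (card J) * q)))"
    by (simp add: ennreal_power exp_of_nat_mult[symmetric])
  finally show ?thesis .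
qed

lemma emeasure_PiM_coordinate_null:
  fixes M :: "'a measure"
  assumes M: "prob_space M" and J: "finite J" and A: "A \<in> sets M" "emeasure M A = 0"
  shows "emeasure (PiM J (\<lambda>_. M)) {X \<in> space (PiM J (\<lambda>_. M)). \<exists>k\<in>J. X k \<in> A} = 0"
proof -
  interpret M: prob_space M by (rule M)
  interpret product_prob_space "\<lambda>_. M" UNIV ..
  have 1: "emeasure (PiM J (\<lambda>_. M)) {X \<in> space (PiM J (\<lambda>_. M)). X k \<in> A} = 0" if "k \<in> J" for k
  proof -
    have "{X \<in> space (PiM J (\<lambda>_. M)). X k \<in> A} = Pi\<^sub>E J (\<lambda>l. if l = k then A else space M)"
      using that sets.sets_into_space[OF A(1)]
      by (fastforce simp: space_PiM PiE_def extensional_def Pi_iff split: if_splits)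
    then have "emeasure (PiM J (\<lambda>_. M)) {X \<in> space (PiM J (\<lambda>_. M)). X k \<in> A}
        = (\<Prod>l\<in>J. emeasure M (if l = k then A else space M))"
      using A J by (simp add: emeasure_PiM)
    also have "\<dots> = 0" using J that A by (auto intro!: prod_zero)
    finally show ?thesis .
  qed
  have "{X \<in> space (PiM J (\<lambda>_. M)). \<exists>k\<in>J. X k \<in> A} = (\<Union>k\<in>J. {X \<in> space (PiM J (\<lambda>_. M)). X k \<in> A})"
    by auto
  moreover have "{X \<in> space (PiM J (\<lambda>_. M)). X k \<in> A} \<in> sets (PiM J (\<lambda>_. M))" if "k \<in> J" for k
    using that A by measurable
  then have "emeasure (PiM J (\<lambda>_. M)) (\<Union>k\<in>J. {X \<in> space (PiM J (\<lambda>_. M)). X k \<in> A}) \<le>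
      (\<Sum>k\<in>J. emeasure (PiM J (\<lambda>_. M)) {X \<in> space (PiM J (\<lambda>_. M)). X k \<in> A})"
    using J by (intro emeasure_subadditive_finite) auto
  ultimately show ?thesis using 1 by simp
qed

text \<open>The centres of the two circles of radius \<alpha> through x and y, told apart by the
  sign s. If x = y or the points are more than 2 * \<alpha> apart the value has no geometric
  meaning; this only enlarges \<open>exceptional\<close>, whose probability is bounded for arbitrary
  centres. The explicit formula makes that event measurable.\<close>

definition circumcentre :: "real \<Rightarrow> real \<Rightarrow> real^2 \<Rightarrow> real^2 \<Rightarrow> real^2" where
  "circumcentre \<alpha> s x y = (1/2) *\<^sub>R (x + y) + (s * sqrt (\<alpha>\<^sup>2 / (norm (y - x))\<^sup>2 - 1/4)) *\<^sub>R perp (y - x)"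

text \<open>The difference of the two distance equations puts the centre on the perpendicular
  bisector; their sum gives its distance from the midpoint, leaving only a sign.\<close>

lemma circumcentre:
  assumes ne: "x \<noteq> y" and d: "dist c x = \<alpha>" "dist c y = \<alpha>"
  shows "\<exists>s\<in>{1, -1}. c = circumcentre \<alpha> s x y"
proof -
  define v where "v = y - x"
  define w where "w = c - (1/2) *\<^sub>R (x + y)"
  have v0: "0 < v \<bullet> v" using ne by (simp add: v_def)
  have cx: "c - x = w + (1/2) *\<^sub>R v" "c - y = w - (1/2) *\<^sub>R v"
    by (simp_all add: v_def w_def vec_eq_iff field_simps)
  have "(norm (w + (1/2) *\<^sub>R v))\<^sup>2 = \<alpha>\<^sup>2" "(norm (w - (1/2) *\<^sub>R v))\<^sup>2 = \<alpha>\<^sup>2"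
    using d by (simp_all add: dist_norm cx[symmetric])
  then have wv: "w \<bullet> v = 0" and nw: "(norm w)\<^sup>2 + (norm v)\<^sup>2 / 4 = \<alpha>\<^sup>2"
    unfolding norm_plus_sq norm_minus_sq by (simp_all add: power_divide)
  define l where "l = (w \<bullet> perp v) / (v \<bullet> v)"
  have wl: "w = l *\<^sub>R perp v"
  proof -
    have vv: "v$1 * v$1 + v$2 * v$2 \<noteq> 0" using v0 unfolding inner_vec_def sum_2 inner_real_def by linarith
    have "w$1 * v$1 + w$2 * v$2 = 0" using wv by (simp add: inner_vec_def sum_2)
    then have e: "w$1 * (v$1 * v$1 + v$2 * v$2) = (w$2 * v$1 - w$1 * v$2) * (- (v$2))"
      "w$2 * (v$1 * v$1 + v$2 * v$2) = (w$2 * v$1 - w$1 * v$2) * v$1" by algebra+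
    have "w$1 = (w$2 * v$1 - w$1 * v$2) * (- (v$2)) / (v$1 * v$1 + v$2 * v$2)"
      "w$2 = (w$2 * v$1 - w$1 * v$2) * v$1 / (v$1 * v$1 + v$2 * v$2)"
      using nonzero_eq_divide_eq[OF vv] e by blast+
    moreover have "l = (w$2 * v$1 - w$1 * v$2) / (v$1 * v$1 + v$2 * v$2)"
      by (simp add: l_def perp_def inner_vec_def sum_2)
    ultimately show ?thesis
      unfolding vec_eq_iff forall_2 by (simp add: perp_def)
  qed
  then have "l\<^sup>2 * (norm v)\<^sup>2 + (norm v)\<^sup>2 / 4 = \<alpha>\<^sup>2" using nw by (simp add: power_mult_distrib)
  then have "\<alpha>\<^sup>2 / (norm v)\<^sup>2 - 1/4 = l\<^sup>2"
    using v0 by (auto simp: field_simps)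
  then have "sqrt (\<alpha>\<^sup>2 / (norm v)\<^sup>2 - 1/4) = \<bar>l\<bar>" by simp
  then have "\<exists>s\<in>{1, -1}. l = s * sqrt (\<alpha>\<^sup>2 / (norm v)\<^sup>2 - 1/4)" by (auto simp: abs_if)
  moreover have "c = (1/2) *\<^sub>R (x + y) + l *\<^sub>R perp v" using wl by (simp add: w_def algebra_simps)
  ultimately show ?thesis unfolding circumcentre_def v_def by metis
qed

lemma measurable_perp [measurable]: "perp \<in> borel_measurable borel"
proof (rule borel_measurable_continuous_onI)
  have "linear perp"
    by (rule linearI) (auto simp: perp_def vec_eq_iff forall_2)
  then show "continuous_on UNIV perp"
    by (simp add: linear_continuous_on linear_conv_bounded_linear)
qed

lemma measurable_circumcentre [measurable]:
  assumes [measurable]: "f \<in> borel_measurable M" "g \<in> borel_measurable M"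
  shows "(\<lambda>x. circumcentre \<alpha> s (f x) (g x)) \<in> borel_measurable M"
  unfolding circumcentre_def by measurable

section \<open>The exceptional event\<close>

text \<open>The balls about N test density at a fixed scale. The last alternative, a third sample
  point on a circle through two others, is a null event whose exclusion yields
  \<open>no_triple\<close>.\<close>

definition exceptional ::
  "nat \<Rightarrow> (real^2) set \<Rightarrow> real \<Rightarrow> real \<Rightarrow> real \<Rightarrow> (real^2) set \<Rightarrow> (nat \<Rightarrow> real^2) \<Rightarrow> bool" where
  "exceptional n S \<alpha> \<eta> \<delta> N X \<longleftrightarrow>
     (\<exists>i<n. X i \<notin> S) \<or> (\<exists>k\<in>N. \<forall>i<n. X i \<notin> ball k \<delta>) \<or>
     (\<exists>i<n. \<exists>j<n. i \<noteq> j \<and> (\<exists>s\<in>{1, -1}.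
        (infdist (circumcentre \<alpha> s (X i) (X j)) S < \<alpha> - \<eta>\<^sup>2 \<and>
          (\<forall>k\<in>{..<n} - {i, j}. X k \<notin> ball (circumcentre \<alpha> s (X i) (X j)) \<alpha>)) \<or>
        (\<exists>k\<in>{..<n} - {i, j}. X k \<in> sphere (circumcentre \<alpha> s (X i) (X j)) \<alpha>)))"

lemma alpha_sample_of_not_exceptional:
  assumes S: "rolling_set S r" and \<alpha>: "0 < \<alpha>" "\<alpha> < r"
    and K: "1 \<le> K" "2 * \<alpha> * r / (r - \<alpha>) \<le> K\<^sup>2" "\<alpha> / (r - \<alpha>) \<le> K"
    and \<eta>: "0 < \<eta>" "\<eta> \<le> 1" "44 * K * \<eta> \<le> \<alpha>"
    and X: "\<not> exceptional n S \<alpha> \<eta> \<delta> N X"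
  shows "alpha_sample S r \<alpha> K \<eta> (X ` {..<n})"
proof -
  interpret rolling_set S r by (rule S)
  have c: "\<not> infdist c S < \<alpha> - \<eta>\<^sup>2 \<or> (\<exists>k<n. X k \<in> ball c \<alpha>)"
    and t: "dist c z = \<alpha> \<Longrightarrow> z \<in> X ` {..<n} \<Longrightarrow> z = x \<or> z = y"
    if xy: "x \<in> X ` {..<n}" "y \<in> X ` {..<n}" "x \<noteq> y" "dist c x = \<alpha>" "dist c y = \<alpha>" for c x y z
  proof -
    obtain i j where ij: "i < n" "j < n" "x = X i" "y = X j" using xy by auto
    then have ne: "i \<noteq> j" using xy by auto
    obtain s where s: "s \<in> {1, -1}" "c = circumcentre \<alpha> s x y"
      using circumcentre[OF xy(3-5)] by auto
    then show "\<not> infdist c S < \<alpha> - \<eta>\<^sup>2 \<or> (\<exists>k<n. X k \<in> ball c \<alpha>)"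
      using X ij ne unfolding exceptional_def by (metis DiffD1 lessThan_iff)
    assume z: "dist c z = \<alpha>" "z \<in> X ` {..<n}"
    then obtain k where k: "k < n" "z = X k" by auto
    show "z = x \<or> z = y"
    proof (rule ccontr)
      assume "\<not> ?thesis"
      \<comment> \<open>Different indices may carry the same point, but z differs from x and y, so
        its index differs from i and j.\<close>
      then have "k \<in> {..<n} - {i, j}" using k ij by auto
      moreover have "X k \<in> sphere (circumcentre \<alpha> s (X i) (X j)) \<alpha>" using z k s ij by simp
      ultimately show False using X ij ne s(1) unfolding exceptional_def by blast
    qed
  qed
  show ?thesis
  proof
    show "X ` {..<n} \<subseteq> S" using X by (auto simp: exceptional_def)
    show "\<alpha> - \<eta>\<^sup>2 \<le> infdist c S"
      if "x \<in> X ` {..<n}" "y \<in> X ` {..<n}" "x \<noteq> y" "dist c x = \<alpha>" "dist c y = \<alpha>"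
        "ball c \<alpha> \<inter> X ` {..<n} = {}" for c x y
      using c[OF that(1-5)] that(6) by auto
    show "z = x \<or> z = y"
      if "x \<in> X ` {..<n}" "y \<in> X ` {..<n}" "x \<noteq> y" "dist c x = \<alpha>" "dist c y = \<alpha>"
        "z \<in> X ` {..<n}" "dist c z = \<alpha>" for c x y z
      using t[OF that(1-5,7,6)] .
  qed (use \<alpha> K \<eta> in auto)
qed

text \<open>S enters only through the area bound V: a part of S of area b has probability at least b
  / V. Points outside S and third points on circles are null events; 2 * n^2 counts ordered pairs
  and the two centres of each.\<close>

lemma exceptional_prob:
  fixes S :: "(real^2) set"
  assumes S: "compact S" "0 < emeasure lborel S" "measure lborel S \<le> V"
    and N: "finite N" "\<And>k. k \<in> N \<Longrightarrow> ball k \<delta> \<subseteq> S" and \<beta>: "\<beta> = measure lborel (ball 0 \<delta> :: (real^2) set)"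
    and \<kappa>: "0 \<le> \<kappa>" "\<And>c. infdist c S < \<alpha> - \<eta>\<^sup>2 \<Longrightarrow> ennreal \<kappa> \<le> emeasure lborel (ball c \<alpha> \<inter> S)"
  shows "{X \<in> space (sample_law n S). exceptional n S \<alpha> \<eta> \<delta> N X} \<in> sets (sample_law n S)" (is "?E \<in> _")
    and "emeasure (sample_law n S) {X \<in> space (sample_law n S). exceptional n S \<alpha> \<eta> \<delta> N X}
      \<le> ennreal (real (card N) * exp (- (real n * (\<beta> / V))) +
          2 * (real n)\<^sup>2 * exp (- (real (n - 2) * (\<kappa> / V))))"
proof -
  let ?U = "uniform_measure lborel S"
  let ?P = "sample_law n S"
  have Sb: "S \<in> sets borel" using S(1) by (rule borel_compact)
  have Sfin: "emeasure lborel S < \<infinity>" using emeasure_compact_finite S(1) by blast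
  have U: "prob_space ?U" using S Sfin Sb by (intro prob_space_uniform_measure) auto
  interpret U: prob_space ?U by (rule U)
  have setsU [measurable_cong]: "sets ?U = sets borel" by simp
  have spU: "space ?U = UNIV" by simp
  have mS: "0 < measure lborel S" using S(2) Sfin by (simp add: measure_def enn2real_positive_iff)
  have V: "0 < V" using mS S(3) by linarith
  have Pdef: "?P = PiM {..<n} (\<lambda>_. ?U)" by (simp add: sample_law_def)
  have mU: "measure ?U A = measure lborel (S \<inter> A) / measure lborel S" if "A \<in> sets borel" for A
    using that S Sfin by (intro measure_uniform_measure) auto
  have mU_ge: "b / V \<le> measure ?U A" if "A \<in> sets borel" "b \<le> measure lborel (S \<inter> A)" "0 \<le> b" for A b
  proof -
    have "b / V \<le> measure lborel (S \<inter> A) / measure lborel S"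
      using that S(3) mS by (intro frac_le) auto
    then show ?thesis using mU[OF that(1)] by simp
  qed
  have nullU: "emeasure ?U A = 0" if "A \<in> sets borel" "emeasure lborel (S \<inter> A) = 0" for A
    using that Sb by simp
  define E1 where "E1 = {X \<in> space ?P. \<exists>i\<in>{..<n}. X i \<in> - S}"
  define E2 where "E2 k = {X \<in> space ?P. \<forall>i\<in>{..<n}. X i \<notin> ball k \<delta>}" for k
  define E3 where "E3 i j s = {X \<in> space ?P. infdist (circumcentre \<alpha> s (X i) (X j)) S < \<alpha> - \<eta>\<^sup>2 \<and>
          (\<forall>k\<in>{..<n} - {i, j}. X k \<notin> ball (circumcentre \<alpha> s (X i) (X j)) \<alpha>)}" for i j s
  define E4 where "E4 i j s = {X \<in> space ?P. \<exists>k\<in>{..<n} - {i, j}. X k \<in> sphere (circumcentre \<alpha> s (X i) (X j)) \<alpha>}" for i j s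
  define Q where "Q = {q \<in> {..<n} \<times> {..<n}. fst q \<noteq> snd q} \<times> {1, -1 :: real}"
  let ?E34 = "\<lambda>q. E3 (fst (fst q)) (snd (fst q)) (snd q) \<union> E4 (fst (fst q)) (snd (fst q)) (snd q)"
  have comp [measurable]: "(\<lambda>X. X i) \<in> borel_measurable ?P" if "i < n" for i
    using that unfolding Pdef by (intro measurable_PiM_component_rev) auto
  have E1: "E1 \<in> sets ?P" "emeasure ?P E1 = 0"
  proof -
    show "emeasure ?P E1 = 0"
      unfolding E1_def Pdef using Sb by (intro emeasure_PiM_coordinate_null[OF U] nullU) auto
    have "E1 = (\<Union>i\<in>{..<n}. (\<lambda>X. X i) -` (- S) \<inter> space ?P)" by (auto simp: E1_def)
    also have "\<dots> \<in> sets ?P" using Sb by (intro sets.finite_UN measurable_sets[OF comp]) auto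
    finally show "E1 \<in> sets ?P" .
  qed
  have E2: "E2 k \<in> sets ?P" "emeasure ?P (E2 k) \<le> ennreal (exp (- (real n * (\<beta> / V))))" if k: "k \<in> N" for k
  proof -
    have "measure lborel (ball k \<delta>) = \<beta>"
    proof -
      have "(+) k ` ball 0 \<delta> = ball k \<delta>" using ball_translation[of k 0 \<delta>] by simp
      then have "measure lebesgue (ball k \<delta>) = measure lebesgue (ball 0 \<delta> :: (real^2) set)"
        using measure_translation[of k "ball 0 \<delta>"] by simp
      then show ?thesis by (simp add: \<beta> measure_completion)
    qed
    moreover have "S \<inter> ball k \<delta> = ball k \<delta>" using N(2)[OF k] by auto
    ultimately have "\<beta> / V \<le> measure ?U (ball k \<delta>)" by (intro mU_ge) (auto simp: \<beta>)
    then have "emeasure (PiM {..<n} (\<lambda>_. ?U)) {X \<in> space (PiM {..<n} (\<lambda>_. ?U)). \<forall>i\<in>{..<n}. X i \<notin> ball k \<delta>}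
        \<le> ennreal (exp (- (real (card {..<n}) * (\<beta> / V))))"
      by (intro emeasure_PiM_avoid_le[OF U]) auto
    then show "emeasure ?P (E2 k) \<le> ennreal (exp (- (real n * (\<beta> / V))))"
      by (simp add: E2_def Pdef)
    show "E2 k \<in> sets ?P" unfolding E2_def
      by (intro sets.sets_Collect_finite_All) (auto intro!: measurable_sets_borel simp: dist_norm)
  qed
  have E3: "E3 i j s \<in> sets ?P" "emeasure ?P (E3 i j s) \<le> ennreal (exp (- (real (n - 2) * (\<kappa> / V))))"
    if ij: "i < n" "j < n" "i \<noteq> j" for i j s
  proof -
    note [measurable] = comp[OF ij(1)] comp[OF ij(2)]
    have inf [measurable]: "(\<lambda>x. infdist x S) \<in> borel_measurable borel"
      by (intro borel_measurable_continuous_onI continuous_intros)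
    have [measurable]: "(\<lambda>X. X k) \<in> borel_measurable ?P" if "k \<in> {..<n} - {i, j}" for k
      using that by (intro comp) auto
    show m: "E3 i j s \<in> sets ?P"
      unfolding E3_def mem_ball by measurable
    have "emeasure (PiM {..<n} (\<lambda>_. ?U)) (E3 i j s) \<le> ennreal (exp (- (real (n - 2) * (\<kappa> / V))))"
      unfolding E3_def Pdef
    proof (rule emeasure_PiM_two_coordinates_le[OF U, where i = i and j = j])
      fix a b :: "real^2"
      let ?c = "circumcentre \<alpha> s a b" and ?J = "{..<n} - {i, j}"
      have cJ: "card ?J = n - 2" using ij by (simp add: card_Diff_subset)
      \<comment> \<open>With both points fixed the centre is constant: the event is empty, or says
        that the remaining n - 2 points avoid a fixed ball.\<close>
      have eq: "{X \<in> space (PiM ?J (\<lambda>_. ?U)). infdist (circumcentre \<alpha> s ((X(j := b, i := a)) i) ((X(j := b, i := a)) j)) S < \<alpha> - \<eta>\<^sup>2 \<and>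
          (\<forall>k\<in>?J. (X(j := b, i := a)) k \<notin> ball (circumcentre \<alpha> s ((X(j := b, i := a)) i) ((X(j := b, i := a)) j)) \<alpha>)}
        = (if infdist ?c S < \<alpha> - \<eta>\<^sup>2 then {X \<in> space (PiM ?J (\<lambda>_. ?U)). \<forall>k\<in>?J. X k \<notin> ball ?c \<alpha>} else {})"
        using ij by auto
      show "emeasure (PiM ?J (\<lambda>_. ?U)) {X \<in> space (PiM ?J (\<lambda>_. ?U)). infdist (circumcentre \<alpha> s ((X(j := b, i := a)) i) ((X(j := b, i := a)) j)) S < \<alpha> - \<eta>\<^sup>2 \<and>
          (\<forall>k\<in>?J. (X(j := b, i := a)) k \<notin> ball (circumcentre \<alpha> s ((X(j := b, i := a)) i) ((X(j := b, i := a)) j)) \<alpha>)}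
        \<le> ennreal (exp (- (real (n - 2) * (\<kappa> / V))))"
      proof (cases "infdist ?c S < \<alpha> - \<eta>\<^sup>2")
        case True
        have "emeasure lborel (S \<inter> ball ?c \<alpha>) < top"
          using emeasure_mono[of "S \<inter> ball ?c \<alpha>" S lborel] Sfin Sb by (simp add: le_less_trans)
        then have "\<kappa> \<le> measure lborel (S \<inter> ball ?c \<alpha>)"
          using \<kappa>(2)[OF True] \<kappa>(1) by (simp add: Int_commute emeasure_eq_ennreal_measure less_top)
        then have "\<kappa> / V \<le> measure ?U (ball ?c \<alpha>)" using \<kappa>(1) by (intro mU_ge) auto
        then have "emeasure (PiM ?J (\<lambda>_. ?U)) {X \<in> space (PiM ?J (\<lambda>_. ?U)). \<forall>k\<in>?J. X k \<notin> ball ?c \<alpha>}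
            \<le> ennreal (exp (- (real (card ?J) * (\<kappa> / V))))"
          by (intro emeasure_PiM_avoid_le[OF U]) auto
        then show ?thesis unfolding eq cJ using True by simp
      qed (simp only: eq if_False emeasure_empty zero_le)
    qed (use ij m in \<open>auto simp: E3_def Pdef\<close>)
    then show "emeasure ?P (E3 i j s) \<le> ennreal (exp (- (real (n - 2) * (\<kappa> / V))))" by (simp add: Pdef)
  qed
  have E4: "E4 i j s \<in> sets ?P" "emeasure ?P (E4 i j s) = 0"
    if ij: "i < n" "j < n" "i \<noteq> j" for i j s
  proof -
    note [measurable] = comp[OF ij(1)] comp[OF ij(2)]
    have [measurable]: "(\<lambda>X. X k) \<in> borel_measurable ?P" if "k \<in> {..<n} - {i, j}" for k
      using that by (intro comp) auto
    show m: "E4 i j s \<in> sets ?P"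
      unfolding E4_def mem_sphere by measurable
    have "emeasure (PiM {..<n} (\<lambda>_. ?U)) (E4 i j s) \<le> 0"
      unfolding E4_def Pdef
    proof (rule emeasure_PiM_two_coordinates_le[OF U, where i = i and j = j])
      fix a b :: "real^2"
      let ?c = "circumcentre \<alpha> s a b" and ?J = "{..<n} - {i, j}"
      have eq: "{X \<in> space (PiM ?J (\<lambda>_. ?U)). \<exists>k\<in>?J. (X(j := b, i := a)) k \<in> sphere (circumcentre \<alpha> s ((X(j := b, i := a)) i) ((X(j := b, i := a)) j)) \<alpha>}
        = {X \<in> space (PiM ?J (\<lambda>_. ?U)). \<exists>k\<in>?J. X k \<in> sphere ?c \<alpha>}"
        using ij by auto
      have "sphere ?c \<alpha> \<in> null_sets lborel"
        using negligible_sphere[of ?c \<alpha>] by (simp add: negligible_iff_null_sets null_sets_completion_iff)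
      then have "S \<inter> sphere ?c \<alpha> \<in> null_sets lborel" using Sb by (intro null_set_Int1) auto
      then have "emeasure ?U (sphere ?c \<alpha>) = 0" by (intro nullU) auto
      then have "emeasure (PiM ?J (\<lambda>_. ?U)) {X \<in> space (PiM ?J (\<lambda>_. ?U)). \<exists>k\<in>?J. X k \<in> sphere ?c \<alpha>} = 0"
        by (intro emeasure_PiM_coordinate_null[OF U]) auto
      then show "emeasure (PiM ?J (\<lambda>_. ?U)) {X \<in> space (PiM ?J (\<lambda>_. ?U)). \<exists>k\<in>?J. (X(j := b, i := a)) k \<in> sphere (circumcentre \<alpha> s ((X(j := b, i := a)) i) ((X(j := b, i := a)) j)) \<alpha>} \<le> 0"
        unfolding eq by simp
    qed (use ij m in \<open>auto simp: E4_def Pdef\<close>)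
    then show "emeasure ?P (E4 i j s) = 0" by (simp add: Pdef)
  qed
  have split: "?E = E1 \<union> ((\<Union>k\<in>N. E2 k) \<union> (\<Union>q\<in>Q. ?E34 q))"
  proof -
    define G where "G i j s X \<longleftrightarrow>
        (infdist (circumcentre \<alpha> s (X i) (X j)) S < \<alpha> - \<eta>\<^sup>2 \<and>
          (\<forall>k\<in>{..<n} - {i, j}. X k \<notin> ball (circumcentre \<alpha> s (X i) (X j)) \<alpha>)) \<or>
        (\<exists>k\<in>{..<n} - {i, j}. X k \<in> sphere (circumcentre \<alpha> s (X i) (X j)) \<alpha>)" for i j s X
    have "E3 i j s \<union> E4 i j s = {X \<in> space ?P. G i j s X}" for i j s
      unfolding E3_def E4_def G_def by blast
    moreover have "exceptional n S \<alpha> \<eta> \<delta> N X \<longleftrightarrow> (\<exists>i\<in>{..<n}. X i \<in> - S) \<or>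
        (\<exists>k\<in>N. \<forall>i\<in>{..<n}. X i \<notin> ball k \<delta>) \<or> (\<exists>q\<in>Q. G (fst (fst q)) (snd (fst q)) (snd q) X)" for X
    proof -
      have "(\<exists>q\<in>Q. G (fst (fst q)) (snd (fst q)) (snd q) X) \<longleftrightarrow>
          (\<exists>i<n. \<exists>j<n. i \<noteq> j \<and> (\<exists>s\<in>{1, -1}. G i j s X))"
        unfolding Q_def by fastforce
      then show ?thesis unfolding exceptional_def G_def[symmetric] by auto
    qed
    ultimately show ?thesis unfolding E1_def E2_def by auto
  qed
  have finQ: "finite Q" by (simp add: Q_def)
  have mQ: "?E34 q \<in> sets ?P" "emeasure ?P (?E34 q) \<le> ennreal (exp (- (real (n - 2) * (\<kappa> / V))))" if "q \<in> Q" for q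
  proof -
    have q: "fst (fst q) < n" "snd (fst q) < n" "fst (fst q) \<noteq> snd (fst q)" using that by (auto simp: Q_def)
    show "?E34 q \<in> sets ?P" using E3(1)[OF q] E4(1)[OF q] by auto
    have "emeasure ?P (?E34 q) \<le> emeasure ?P (E3 (fst (fst q)) (snd (fst q)) (snd q)) + emeasure ?P (E4 (fst (fst q)) (snd (fst q)) (snd q))"
      using E3(1)[OF q] E4(1)[OF q] by (rule emeasure_subadditive)
    then show "emeasure ?P (?E34 q) \<le> ennreal (exp (- (real (n - 2) * (\<kappa> / V))))"
      unfolding E4(2)[OF q] add_0_right using E3(2)[OF q] by (rule order_trans)
  qed
  have mE2: "(\<Union>k\<in>N. E2 k) \<in> sets ?P" and mE34: "(\<Union>q\<in>Q. ?E34 q) \<in> sets ?P"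
    using N(1) finQ E2(1) mQ(1) by (auto intro!: sets.finite_UN)
  show "?E \<in> sets ?P" unfolding split using E1(1) mE2 mE34 by (intro sets.Un)
  have "emeasure ?P ?E \<le> emeasure ?P E1 + emeasure ?P ((\<Union>k\<in>N. E2 k) \<union> (\<Union>q\<in>Q. ?E34 q))"
    unfolding split using E1(1) mE2 mE34 by (intro emeasure_subadditive sets.Un)
  also have "\<dots> \<le> 0 + (emeasure ?P (\<Union>k\<in>N. E2 k) + emeasure ?P (\<Union>q\<in>Q. ?E34 q))"
    using E1(2) mE2 mE34 by (intro add_mono emeasure_subadditive) auto
  also have "\<dots> \<le> 0 + ((\<Sum>k\<in>N. emeasure ?P (E2 k)) + (\<Sum>q\<in>Q. emeasure ?P (?E34 q)))"
    using N(1) finQ E2(1) mQ(1) by (intro add_mono emeasure_subadditive_finite order_refl) auto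
  also have "\<dots> \<le> 0 + ((\<Sum>k\<in>N. ennreal (exp (- (real n * (\<beta> / V))))) + (\<Sum>q\<in>Q. ennreal (exp (- (real (n - 2) * (\<kappa> / V))))))"
    using E2(2) mQ(2) by (intro add_mono sum_mono order_refl) auto
  also have "\<dots> = ennreal (real (card N) * exp (- (real n * (\<beta> / V))) + real (card Q) * exp (- (real (n - 2) * (\<kappa> / V))))"
    by (simp add: ennreal_plus ennreal_mult ennreal_of_nat_eq_real_of_nat)
  also have "\<dots> \<le> ennreal (real (card N) * exp (- (real n * (\<beta> / V))) + 2 * (real n)\<^sup>2 * exp (- (real (n - 2) * (\<kappa> / V))))"
  proof (intro ennreal_leI add_left_mono mult_right_mono)
    have "card Q = card {q \<in> {..<n} \<times> {..<n}. fst q \<noteq> snd q} * 2" by (simp add: Q_def card_cartesian_product)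
    also have "\<dots> \<le> card ({..<n} \<times> {..<n}) * 2" by (intro mult_right_mono card_mono) auto
    also have "\<dots> = 2 * n ^ 2" by (simp add: power2_eq_square)
    finally have "real (card Q) \<le> real (2 * n ^ 2)" by (simp only: of_nat_le_iff)
    then show "real (card Q) \<le> 2 * (real n)\<^sup>2" by simp
  qed simp
  finally show "emeasure ?P ?E \<le> ennreal (real (card N) * exp (- (real n * (\<beta> / V))) +
          2 * (real n)\<^sup>2 * exp (- (real (n - 2) * (\<kappa> / V))))" .
qed

section \<open>The concentration inequality\<close>

text \<open>As \<tau> <= 1, the density term, free of \<tau>, is dominated too. The factor exp (2 *
  k) compensates for the two points that determine the circle; truncation of \<open>n - 2\<close> at
  n = 1 is harmless, since only \<open>real n - 2 \<le> real (n - 2)\<close> matters.\<close>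

lemma exp_bound_combine:
  fixes A :: real
  assumes n: "1 \<le> n" and \<tau>: "0 \<le> \<tau>" "\<tau> \<le> 1" and A: "0 < A" "1 / A \<le> b" "1 / A \<le> k"
    and c: "0 \<le> c" "c + 2 * exp (2 * k) \<le> A"
  shows "c * exp (- (real n * b)) + 2 * (real n)\<^sup>2 * exp (- (real (n - 2) * (k * \<tau>)))
    \<le> A * (real n)\<^sup>2 * exp (- real n * \<tau> / A)"
proof -
  let ?e = "exp (- real n * \<tau> / A)"
  have iA: "0 < 1 / A" using A by simp
  have k: "0 \<le> k" using A iA by linarith
  have n2: "1 \<le> (real n)\<^sup>2" using n by simp
  have "\<tau> / A \<le> 1 / A" using \<tau> A by (intro divide_right_mono) auto
  then have "\<tau> / A \<le> b" using A by linarith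
  then have "real n * (\<tau> / A) \<le> real n * b" by (intro mult_left_mono) auto
  then have 1: "exp (- (real n * b)) \<le> ?e" by simp
  have "\<tau> * (1 / A) \<le> \<tau> * k" using A \<tau> by (intro mult_left_mono) auto
  then have "real n * (\<tau> / A) \<le> real n * (k * \<tau>)" by (intro mult_left_mono) (auto simp: mult.commute)
  moreover have "(real n - 2) * (k * \<tau>) \<le> real (n - 2) * (k * \<tau>)"
    using k \<tau> by (intro mult_right_mono) auto
  moreover have "k * \<tau> \<le> k" using k \<tau> by (simp add: mult_left_le)
  ultimately have "- (real (n - 2) * (k * \<tau>)) \<le> 2 * k + - real n * \<tau> / A"
    by (simp add: algebra_simps)
  then have "exp (- (real (n - 2) * (k * \<tau>))) \<le> exp (2 * k + - real n * \<tau> / A)" by simp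
  also have "\<dots> = exp (2 * k) * ?e" by (rule exp_add)
  finally have 2: "exp (- (real (n - 2) * (k * \<tau>))) \<le> exp (2 * k) * ?e" .
  have "c * exp (- (real n * b)) \<le> (c * (real n)\<^sup>2) * ?e"
    using 1 c n2 by (intro mult_mono) (auto simp: mult_left_le mult_le_cancel_left1)
  moreover have "2 * (real n)\<^sup>2 * exp (- (real (n - 2) * (k * \<tau>))) \<le> 2 * (real n)\<^sup>2 * (exp (2 * k) * ?e)"
    using 2 by (intro mult_left_mono) auto
  moreover have "(c * (real n)\<^sup>2) * ?e + 2 * (real n)\<^sup>2 * (exp (2 * k) * ?e) = (c + 2 * exp (2 * k)) * ((real n)\<^sup>2 * ?e)"
    by (simp add: algebra_simps)
  moreover have "(c + 2 * exp (2 * k)) * ((real n)\<^sup>2 * ?e) \<le> A * ((real n)\<^sup>2 * ?e)"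
    using c by (intro mult_right_mono) auto
  ultimately show ?thesis by (simp add: mult.assoc)
qed

lemma outer_prob_sample_law_le_1:
  assumes "compact S" "0 < emeasure lborel S"
  shows "outer_prob (sample_law n S) E \<le> 1"
proof -
  have "emeasure lborel S < \<infinity>" using emeasure_compact_finite assms(1) by blast
  then have U: "prob_space (uniform_measure lborel S)"
    using assms by (intro prob_space_uniform_measure) auto
  interpret product_prob_space "\<lambda>_. uniform_measure lborel S" UNIV
    using U by (intro product_prob_spaceI)
  have "outer_prob (sample_law n S) E \<le> emeasure (sample_law n S) (space (sample_law n S))"
    by (intro outer_prob_le) auto
  also have "\<dots> = 1"
    unfolding sample_law_def using prob_space_PiM[of "{..<n}" "\<lambda>_. uniform_measure lborel S"] U
    by (simp add: prob_space.emeasure_space_1)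
  finally show ?thesis .
qed

lemma compact_ball_net:
  fixes B :: "'a::heine_borel set"
  assumes "compact B" "0 < \<delta>"
  obtains N where "finite N" "\<And>x. x \<in> B \<Longrightarrow> \<exists>k\<in>N. dist k x < \<delta>"
proof -
  have "B \<subseteq> (\<Union>x\<in>B. ball x \<delta>)" using assms(2) by auto
  then obtain N where N: "finite N" "B \<subseteq> (\<Union>x\<in>N. ball x \<delta>)"
    by (rule compactE_image[OF assms(1), rotated]) auto
  have "\<exists>k\<in>N. dist k x < \<delta>" if x: "x \<in> B" for x
  proof -
    obtain k where "k \<in> N" "x \<in> ball k \<delta>" using N(2) x by blast
    then show ?thesis by auto
  qed
  then show thesis using that N(1) by blast
qed

theorem theorem1:
  fixes \<alpha> r :: real
  assumes "0 < \<alpha>" and "\<alpha> < r"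
  shows "\<exists>t0>0. \<forall>D. \<exists>A>0. \<forall>S :: (real^2) set.
           compact S \<and> 0 < emeasure lborel S \<and> rolling r S \<and> rolling r (- S) \<and> diameter S = D \<longrightarrow>
           (\<forall>n::nat. n \<ge> 1 \<longrightarrow> (\<forall>t::real. 0 \<le> t \<and> t \<le> t0 \<longrightarrow>
              outer_prob (sample_law n S)
                {X. \<bar>enn2real (hausdorff1 (alpha_shape \<alpha> (X ` {..<n})))
                      / enn2real (hausdorff1 (frontier S)) - 1\<bar> > t}
              \<le> ennreal (A * real n ^ 2 * exp (- real n * t powr (3/2) / A))))"
proof -
  note \<alpha> = assms
  have r: "0 < r" using \<alpha> by linarith
  \<comment> \<open>The sum dominates each summand, and 1 <= K gives
    \<open>K \<le> K\<^sup>2\<close>, so all requirements on K hold together.\<close>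
  define K where "K = 1 + 2 * \<alpha> * r / (r - \<alpha>) + \<alpha> / (r - \<alpha>)"
  have K': "0 \<le> 2 * \<alpha> * r / (r - \<alpha>)" "0 \<le> \<alpha> / (r - \<alpha>)" using \<alpha> r by auto
  then have K1: "1 \<le> K" unfolding K_def by linarith
  then have "K \<le> K\<^sup>2" by (simp add: self_le_power)
  then have K: "1 \<le> K" "2 * \<alpha> * r / (r - \<alpha>) \<le> K\<^sup>2" "\<alpha> / (r - \<alpha>) \<le> K"
    using K1 K' unfolding K_def by linarith+
  define \<zeta> where "\<zeta> = min 1 (min (\<alpha> * (r - \<alpha>) / (2 * r)) (r / (2 * (K + 1))))"
  have \<zeta>0: "0 < \<zeta>" "\<zeta> \<le> 1" using \<alpha> r K1 by (auto simp: \<zeta>_def)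
  then have \<zeta>sq: "\<zeta>\<^sup>2 \<le> \<zeta>" by (simp add: power2_eq_square mult_left_le)
  have \<zeta>: "0 < \<zeta>" "r * \<zeta>\<^sup>2 < \<alpha> * (r - \<alpha>)" "K * \<zeta> + \<zeta>\<^sup>2 < r"
  proof -
    have pos: "0 < \<alpha> * (r - \<alpha>)" using \<alpha> by simp
    have "r * \<zeta>\<^sup>2 \<le> r * (\<alpha> * (r - \<alpha>) / (2 * r))"
      using r \<zeta>sq by (intro mult_left_mono) (auto simp: \<zeta>_def)
    also have "\<dots> = \<alpha> * (r - \<alpha>) / 2" using r by simp
    finally show "r * \<zeta>\<^sup>2 < \<alpha> * (r - \<alpha>)" using pos by linarith
    have "K * \<zeta> + \<zeta>\<^sup>2 \<le> (K + 1) * \<zeta>" using \<zeta>sq by (simp add: algebra_simps)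
    also have "\<dots> \<le> (K + 1) * (r / (2 * (K + 1)))" using K1 by (intro mult_left_mono) (auto simp: \<zeta>_def)
    also have "\<dots> = r / 2" using K1 by (auto simp: field_simps)
    finally show "K * \<zeta> + \<zeta>\<^sup>2 < r" using r by linarith
  qed (rule \<zeta>0)
  \<comment> \<open>Half of what each condition of \<open>frontier_covered\<close> allows. It
    depends on \<alpha> and r only.\<close>
  define \<rho> where "\<rho> = min (\<zeta>^4 / (16 * \<alpha>)) (min (\<zeta>\<^sup>2 / 16) (\<alpha> / 8))"
  have \<rho>: "0 < \<rho>" "8 * \<alpha> * \<rho> < \<zeta>^4" "8 * \<rho> < \<zeta>\<^sup>2" "4 * \<rho> < \<alpha>"
  proof -
    show "0 < \<rho>" using \<alpha> \<zeta> by (auto simp: \<rho>_def)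
    have "8 * \<alpha> * \<rho> \<le> 8 * \<alpha> * (\<zeta>^4 / (16 * \<alpha>))" using \<alpha> by (intro mult_left_mono) (auto simp: \<rho>_def)
    also have "\<dots> = \<zeta>^4 / 2" using \<alpha> by simp
    finally show "8 * \<alpha> * \<rho> < \<zeta>^4" using \<zeta>(1) zero_less_power[of \<zeta> 4] by linarith
    have "\<rho> \<le> \<zeta>\<^sup>2 / 16" "\<rho> \<le> \<alpha> / 8" by (auto simp: \<rho>_def)
    moreover have "0 < \<zeta>\<^sup>2" using \<zeta>(1) by simp
    ultimately show "8 * \<rho> < \<zeta>\<^sup>2" "4 * \<rho> < \<alpha>" using \<alpha> by linarith+
  qed
  define M where "M = 484 * K\<^sup>2 / \<alpha>\<^sup>2 + 2 * (K + 4 * K\<^sup>2 / r) / r"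
  have M: "0 < M" unfolding M_def using K1 \<alpha> r by (intro add_pos_nonneg) auto
  define e0 where "e0 = min 1 (\<alpha> / (44 * K))"
  have e0: "0 < e0" using \<alpha> K1 by (simp add: e0_def)
  \<comment> \<open>For \<eta> = sqrt (t / M) the first bound gives
    \<open>M * \<eta>\<^sup>2 < 1\<close>, the second \<eta> <= e0.\<close>
  define t0 where "t0 = min (1/2) (M * e0\<^sup>2)"
  have t0: "0 < t0" using M e0 by (simp add: t0_def)
  \<comment> \<open>A ball of radius \<rho> contains the \<delta>-ball about every point within
    \<delta> of its centre, so hitting the net balls gives density at scale \<rho>.\<close>
  define \<delta> where "\<delta> = \<rho> / 2"
  define \<beta> where "\<beta> = measure lborel (ball 0 \<delta> :: (real^2) set)"
  have \<delta>: "0 < \<delta>" using \<rho> by (simp add: \<delta>_def)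
  have \<beta>: "0 < \<beta>" using content_ball_pos[OF \<delta>, of "0::real^2"] by (simp add: \<beta>_def)
  \<comment> \<open>Makes the cap area \<open>sqrt \<alpha> / 4 * \<eta>^3\<close> equal to
    \<open>\<kappa> * t powr (3/2)\<close>.\<close>
  define \<kappa> where "\<kappa> = sqrt \<alpha> / 4 / M powr (3/2)"
  have \<kappa>: "0 < \<kappa>" using \<alpha> M by (simp add: \<kappa>_def)
  have main: "\<exists>A>0. \<forall>S :: (real^2) set.
           compact S \<and> 0 < emeasure lborel S \<and> rolling r S \<and> rolling r (- S) \<and> diameter S = D \<longrightarrow>
           (\<forall>n::nat. n \<ge> 1 \<longrightarrow> (\<forall>t::real. 0 \<le> t \<and> t \<le> t0 \<longrightarrow>
              outer_prob (sample_law n S)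
                {X. \<bar>enn2real (hausdorff1 (alpha_shape \<alpha> (X ` {..<n})))
                      / enn2real (hausdorff1 (frontier S)) - 1\<bar> > t}
              \<le> ennreal (A * real n ^ 2 * exp (- real n * t powr (3/2) / A))))" for D :: real
  proof -
    \<comment> \<open>A set of diameter D lies in a disc of radius D about any of its points. The
      added 1 keeps V positive for every D.\<close>
    define V where "V = measure lborel (cball 0 D :: (real^2) set) + 1"
    have V: "1 \<le> V" by (simp add: V_def)
    \<comment> \<open>The net is fixed before S is given and translated to S later, so that A
      depends on S only through D.\<close>
    obtain N0 :: "(real^2) set" where N0: "finite N0" "\<And>x. x \<in> cball 0 D \<Longrightarrow> \<exists>k\<in>N0. dist k x < \<delta>"
      using compact_ball_net[OF compact_cball \<delta>] by metis
    define A where "A = 1 + V / \<beta> + V / \<kappa> + real (card N0) + 2 * exp (2 * (\<kappa> / V))"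
    have An: "0 \<le> V / \<beta>" "0 \<le> V / \<kappa>" "0 \<le> real (card N0)" "0 \<le> 2 * exp (2 * (\<kappa> / V))"
      using V \<beta> \<kappa> by auto
    have A: "1 \<le> A" "V / \<beta> \<le> A" "V / \<kappa> \<le> A" "real (card N0) + 2 * exp (2 * (\<kappa> / V)) \<le> A"
      using An unfolding A_def by linarith+
    have "1 / A \<le> \<beta> / V" "1 / A \<le> \<kappa> / V"
      using A V \<beta> \<kappa> by (simp_all add: field_simps)
    note A' = this
    show ?thesis
    proof (intro exI[of _ A] conjI allI impI)
      show "0 < A" using A by linarith
      fix S :: "(real^2) set" and n :: nat and t :: real
      assume S: "compact S \<and> 0 < emeasure lborel S \<and> rolling r S \<and> rolling r (- S) \<and> diameter S = D"
        and n: "1 \<le> n" and t: "0 \<le> t \<and> t \<le> t0"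
      let ?bad = "{X. \<bar>enn2real (hausdorff1 (alpha_shape \<alpha> (X ` {..<n})))
                      / enn2real (hausdorff1 (frontier S)) - 1\<bar> > t}"
      have S_ne: "S \<noteq> {}" using S by auto
      interpret rolling_set S r by unfold_locales (use S S_ne r in auto)
      show "outer_prob (sample_law n S) ?bad \<le> ennreal (A * real n ^ 2 * exp (- real n * t powr (3/2) / A))"
      proof (cases "t = 0")
        \<comment> \<open>Here \<eta> would be 0, but the claimed bound is at least 1.\<close>
        case True
        have "1 * 1 \<le> A * real n ^ 2" using A n by (intro mult_mono) auto
        then have "1 \<le> ennreal (A * real n ^ 2 * exp (- real n * t powr (3/2) / A))"
          using True by simp
        then show ?thesis using outer_prob_sample_law_le_1[of S n ?bad] S by (meson order_trans)
      next
        case False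
        then have t: "0 < t" "t \<le> 1/2" "t \<le> M * e0\<^sup>2" using t by (auto simp: t0_def)
        define \<eta> where "\<eta> = sqrt (t / M)"
        have \<eta>0: "0 < \<eta>" using t M by (simp add: \<eta>_def)
        have M\<eta>: "M * \<eta>\<^sup>2 = t" using t M by (simp add: \<eta>_def)
        have "\<eta>\<^sup>2 \<le> e0\<^sup>2" using t M by (simp add: \<eta>_def pos_divide_le_eq mult.commute)
        then have "\<eta> \<le> e0" by (rule power2_le_imp_le) (use e0 in simp)
        then have \<eta>1: "\<eta> \<le> 1" and "\<eta> \<le> \<alpha> / (44 * K)" by (auto simp: e0_def)
        then have \<eta>2: "44 * K * \<eta> \<le> \<alpha>" using K1 by (simp add: pos_le_divide_eq mult.commute)
        have \<eta>3: "\<eta>\<^sup>2 \<le> \<alpha> / 2"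
        proof -
          have "\<eta>\<^sup>2 \<le> \<eta>" using \<eta>0 \<eta>1 by (simp add: power2_eq_square mult_left_le)
          moreover have "44 * 1 * \<eta> \<le> 44 * K * \<eta>" using K1 \<eta>0 by (intro mult_right_mono) auto
          ultimately show ?thesis using \<eta>2 \<eta>0 by linarith
        qed
        have \<kappa>t: "sqrt \<alpha> / 4 * \<eta>^3 = \<kappa> * t powr (3/2)"
        proof -
          have "\<eta>^3 = (t / M) powr (3/2)"
            using t M by (simp add: \<eta>_def powr_half_sqrt[symmetric] powr_power)
          also have "\<dots> = t powr (3/2) / M powr (3/2)" using t M by (simp add: powr_divide)
          finally show ?thesis by (simp add: \<kappa>_def)
        qed
        obtain x0 where x0: "x0 \<in> S" using S_ne by auto
        have Sball: "S \<subseteq> cball x0 D"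
          using diameter_bounded_bound[OF compact_imp_bounded[OF compact_S] x0] S by auto
        have mV: "measure lborel S \<le> V"
        proof -
          have "measure lebesgue ((+) x0 ` cball 0 D) = measure lebesgue (cball (0::real^2) D)"
            by (rule measure_translation)
          then have "measure lborel (cball x0 D) = measure lborel (cball (0::real^2) D)"
            using cball_translation[of x0 0 D] by (simp add: measure_completion)
          moreover have "measure lborel S \<le> measure lborel (cball x0 D)"
            using Sball closed_S by (intro measure_mono_fmeasurable) (auto intro: fmeasurable_compact)
          ultimately show ?thesis by (simp add: V_def)
        qed
        \<comment> \<open>Only net balls inside S are kept, since the others need not have
          probability at least \<beta> / V.\<close>
        define N where "N = {k \<in> (+) x0 ` N0. ball k \<delta> \<subseteq> S}"
        have N: "finite N" "\<And>k. k \<in> N \<Longrightarrow> ball k \<delta> \<subseteq> S" using N0 by (auto simp: N_def)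
        have cardN: "card N \<le> card N0"
        proof -
          have "card N \<le> card ((+) x0 ` N0)" using N0 by (intro card_mono) (auto simp: N_def)
          also have "\<dots> \<le> card N0" using N0 by (intro card_image_le)
          finally show ?thesis .
        qed
        let ?E = "{X \<in> space (sample_law n S). exceptional n S \<alpha> \<eta> \<delta> N X}"
        have cap: "ennreal (sqrt \<alpha> / 4 * \<eta>^3) \<le> emeasure lborel (ball c \<alpha> \<inter> S)"
          if "infdist c S < \<alpha> - \<eta>\<^sup>2" for c
          using that by (intro cap_area[OF \<alpha> \<eta>0 \<eta>3]) simp
        have k0: "0 \<le> sqrt \<alpha> / 4 * \<eta>^3" using \<alpha> \<eta>0 by simp
        note ex = exceptional_prob[of S V N \<delta> \<beta> "sqrt \<alpha> / 4 * \<eta>^3" \<alpha> \<eta> n, OF _ _ mV N \<beta>_def k0 cap]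
        have sub: "?bad \<inter> space (sample_law n S) \<subseteq> ?E"
        proof (rule ccontr)
          assume "\<not> ?thesis"
          then obtain X where typical: "\<not> exceptional n S \<alpha> \<eta> \<delta> N X" and bad: "X \<in> ?bad" by auto
          interpret alpha_sample S r \<alpha> K \<eta> "X ` {..<n}"
            by (rule alpha_sample_of_not_exceptional[OF rolling_set_axioms \<alpha> K \<eta>0 \<eta>1 \<eta>2 typical])
          have dense: "ball q \<rho> \<inter> X ` {..<n} \<noteq> {}" if q: "ball q \<rho> \<subseteq> S" for q
          proof -
            have "q \<in> S" using q \<rho>(1) by auto
            then have "q - x0 \<in> cball 0 D" using Sball by (auto simp: dist_norm norm_minus_commute)
            then obtain k where k: "k \<in> N0" "dist k (q - x0) < \<delta>" using N0(2) by blast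
            have dq: "dist q (x0 + k) < \<delta>" using k(2) by (simp add: dist_norm norm_minus_commute algebra_simps)
            have kq: "ball (x0 + k) \<delta> \<subseteq> ball q \<rho>"
            proof
              fix z assume "z \<in> ball (x0 + k) \<delta>"
              then show "z \<in> ball q \<rho>"
                using dq dist_triangle[of q z "x0 + k"] by (simp add: \<delta>_def)
            qed
            then have "x0 + k \<in> N" using q k(1) by (auto simp: N_def)
            moreover have "\<not> (\<exists>k\<in>N. \<forall>i<n. X i \<notin> ball k \<delta>)"
              using typical unfolding exceptional_def by (simp only: de_Morgan_disj not_False_eq_True)
            ultimately obtain i where "i < n" "X i \<in> ball (x0 + k) \<delta>" by blast
            then show ?thesis using kq by blast
          qed
          have "\<bar>enn2real (hausdorff1 (alpha_shape \<alpha> (X ` {..<n}))) / enn2real (hausdorff1 (frontier S)) - 1\<bar> \<le> M * \<eta>\<^sup>2"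
            using perimeter_ratio[OF \<zeta> \<rho> dense M_def] M\<eta> t by simp
          then show False using bad M\<eta> by simp
        qed
        have "outer_prob (sample_law n S) ?bad \<le> emeasure (sample_law n S) ?E"
          using sub ex(1) S by (intro outer_prob_le) auto
        also have "\<dots> \<le> ennreal (real (card N) * exp (- (real n * (\<beta> / V))) +
            2 * (real n)\<^sup>2 * exp (- (real (n - 2) * (sqrt \<alpha> / 4 * \<eta>^3 / V))))"
          using ex(2) S by auto
        also have "\<dots> \<le> ennreal (A * real n ^ 2 * exp (- real n * t powr (3/2) / A))"
        proof (rule ennreal_leI)
          have eq: "sqrt \<alpha> / 4 * \<eta>^3 / V = \<kappa> / V * t powr (3/2)" unfolding \<kappa>t by simp
          have "t powr (3/2) \<le> 1 powr (3/2)" using t by (intro powr_mono2) auto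
          then show "real (card N) * exp (- (real n * (\<beta> / V))) +
            2 * (real n)\<^sup>2 * exp (- (real (n - 2) * (sqrt \<alpha> / 4 * \<eta>^3 / V)))
            \<le> A * real n ^ 2 * exp (- real n * t powr (3/2) / A)"
            unfolding eq using A A' n cardN by (intro exp_bound_combine) auto
        qed
        finally show ?thesis .
      qed
    qed
  qed
  show ?thesis using t0 main by blast
qed

end
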